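(* An isometric refreshment process on $\mathbb{R}^{2d}$ (e.g. the Zig-Zag process or a Pure Reflection process) is Feller, and $C_c^\infty(\mathbb{R}^{2d})$ is a core of the generator of the corresponding semigroup.
   Context: Isometric refreshment process: a piecewise-deterministic Markov process $Z_t$ on $\mathbb{R}^{2d}=\mathbb{R}^d\times\mathbb{R}^d\ni z=(q,p)$ with the following data. The deterministic flow is $\varphi_t(q,p)=(q+tp,p)$ (vector field $g(q,p)=(p,0)$); the intensity $\lambda:\mathbb{R}^{2d}\to\mathbb{R}_{\ge0}$ is an arbitrary continuous function; and the jumps are $R^\xi(q,p)=(q,O^{\xi,q}(p))$, where $\xi$ is a random sample from a probability space $(S,\mathcal{S},\Xi)$ and $O^{\xi,q}\in\mathcal{O}(d)$ is a (random) orthogonal matrix (depending measurably on $\xi$ and $q$). Examples: Zig-Zag process, $R^\xi(q,p)=(q,p_1,\dots,p_{i(\xi)-1},-p_{i(\xi)},p_{i(\xi)+1},\dots,p_d)$ with a random index $i(\xi)$; Pure Reflection process, $R(q,p)=(q,-p)$. Dynamics: started at $z$, the waiting time $T$ to the next jump satisfies $\mathbb{P}(T\ge t)=\exp(-\int_0^t\lambda(\varphi_s(z))\,ds)$; until then the process follows $\varphi_s(z)$; at time $T$ it jumps to $R^\xi(\varphi_T(z))$ with a fresh independent $\xi\sim\Xi$; then the procedure restarts independently from the new position. The Markov semigroup is $P_tf(z)=\mathbb{E}_z[f(Z_t)]$. $C_0(\mathbb{R}^{2d})$ is the space of continuous real functions vanishing at infinity, with supremum norm $\|\cdot\|_\infty$;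 $C_c^\infty(\mathbb{R}^{2d})$ is the space of infinitely differentiable functions with compact support. The process is Feller if $P_tf\in C_0(\mathbb{R}^{2d})$ for all $t\ge0$, $f\in C_0(\mathbb{R}^{2d})$, and $\lim_{t\to0}\|P_tf-f\|_\infty=0$ for all $f\in C_0(\mathbb{R}^{2d})$. The generator is $\mathcal{L}f=\lim_{t\downarrow0}\frac1t(P_tf-f)$ (limit in $\|\cdot\|_\infty$), with domain $\mathrm{dom}(\mathcal{L})$ the set of $f\in C_0(\mathbb{R}^{2d})$ for which the limit exists. A core of $\mathcal{L}$ is a subset $E\subset\mathrm{dom}(\mathcal{L})$ such that for every $f\in\mathrm{dom}(\mathcal{L})$ there is a sequence $f_n\in E$ with $\|f_n-f\|_\infty\to0$ and $\|\mathcal{L}f_n-\mathcal{L}f\|_\infty\to0$.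
   Formalization: Added assumption: z ↦ λ(z)·E[f(R^ξ(z))] is continuous for every f in C_0. With O^{ξ,q} only measurable in q the claim fails (d=1, λ=1, O^q=1 for q≤0 and −1 for q>0). It holds automatically for Zig-Zag and Pure Reflection. *)

theory Defs
  imports "HOL-Probability.Probability"
begin

section \<open>Function spaces\<close>

definition C_zero :: "('a::real_normed_vector \<Rightarrow> real) set" where
  "C_zero = {f. continuous_on UNIV f \<and> (f \<longlongrightarrow> 0) at_infinity}"

text \<open>
  \<open>Ck k f\<close>: \<open>f\<close> is \<open>k\<close> times continuously differentiable, by iterating directional derivatives.
  On a finite-dimensional space this is the usual notion.
\<close>

primrec Ck :: "nat \<Rightarrow> ('a::euclidean_space \<Rightarrow> real) \<Rightarrow> bool" where
  "Ck 0 f \<longleftrightarrow> continuous_on UNIV f"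
| "Ck (Suc k) f \<longleftrightarrow>
     (\<forall>x. f differentiable (at x)) \<and> (\<forall>v. Ck k (\<lambda>x. frechet_derivative f (at x) v))"

definition Cc_infinity :: "('a::euclidean_space \<Rightarrow> real) set" where
  "Cc_infinity = {f. (\<forall>k. Ck k f) \<and> compact (closure {x. f x \<noteq> 0})}"


section \<open>Feller property, generator and cores\<close>

text \<open>
  \<^const>\<open>uniform_limit\<close> on \<^const>\<open>UNIV\<close> is convergence in the supremum norm.
  A family \<open>P\<close> is only looked at for times \<open>t \<ge> 0\<close>.
\<close>

type_synonym 'a family = "real \<Rightarrow> ('a \<Rightarrow> real) \<Rightarrow> 'a \<Rightarrow> real"

definition feller :: "'a::real_normed_vector family \<Rightarrow> bool" where
  "feller P \<longleftrightarrow>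
     (\<forall>t\<ge>0. \<forall>f\<in>C_zero. P t f \<in> C_zero) \<and>
     (\<forall>f\<in>C_zero. uniform_limit UNIV (\<lambda>t. P t f) f (at_right 0))"

definition has_generator :: "'a::real_normed_vector family \<Rightarrow> ('a \<Rightarrow> real) \<Rightarrow> ('a \<Rightarrow> real) \<Rightarrow> bool" where
  "has_generator P f h \<longleftrightarrow>
     f \<in> C_zero \<and> h \<in> C_zero \<and>
     uniform_limit UNIV (\<lambda>t z. (P t f z - f z) / t) h (at_right 0)"

definition generator_dom :: "'a::real_normed_vector family \<Rightarrow> ('a \<Rightarrow> real) set" where
  "generator_dom P = {f. \<exists>h. has_generator P f h}"

definition generator :: "'a::real_normed_vector family \<Rightarrow> ('a \<Rightarrow> real) \<Rightarrow> 'a \<Rightarrow> real" where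
  "generator P f = (THE h. has_generator P f h)"

lemma has_generator_unique:
  assumes "has_generator P f h" "has_generator P f h'"
  shows "h = h'"
proof
  fix z
  from assms have "((\<lambda>t. (P t f z - f z) / t) \<longlongrightarrow> h z) (at_right 0)"
    and "((\<lambda>t. (P t f z - f z) / t) \<longlongrightarrow> h' z) (at_right 0)"
    by (auto simp: has_generator_def intro: tendsto_uniform_limitI)
  then show "h z = h' z"
    by (rule tendsto_unique[rotated]) simp
qed

lemma generator_eqI: "has_generator P f h \<Longrightarrow> generator P f = h"
  unfolding generator_def by (blast intro: has_generator_unique)

definition core :: "'a::real_normed_vector family \<Rightarrow> ('a \<Rightarrow> real) set \<Rightarrow> bool" where
  "core P E \<longleftrightarrow>
     E \<subseteq> generator_dom P \<and>
     (\<forall>f\<in>generator_dom P. \<exists>F::nat \<Rightarrow> 'a \<Rightarrow> real.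
        (\<forall>n. F n \<in> E) \<and>
        uniform_limit UNIV F f sequentially \<and>
        uniform_limit UNIV (\<lambda>n. generator P (F n)) (generator P f) sequentially)"


section \<open>Piecewise-deterministic Markov processes\<close>

text \<open>
  The process with flow \<open>\<phi>\<close>, intensity \<open>\<lambda>\<close> and jumps \<open>R \<xi>\<close>, \<open>\<xi> \<sim> \<Xi>\<close>, is constructed on the
  space of sequences of independent pairs \<open>(e, \<xi>)\<close>, where \<open>e\<close> has the standard exponential
  distribution and \<open>\<xi>\<close> has law \<open>\<Xi>\<close>.  The \<open>n\<close>-th pair drives the \<open>n\<close>-th waiting time (by inversion
  of the cumulative intensity, see \<open>waiting_time_law\<close> below) and the \<open>n\<close>-th jump.
\<close>

definition cumulative_rate :: "(real \<Rightarrow> 'z \<Rightarrow> 'z) \<Rightarrow> ('z \<Rightarrow> real) \<Rightarrow> 'z \<Rightarrow> real \<Rightarrow> real" where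
  "cumulative_rate \<phi> lam z t = integral {0..t} (\<lambda>s. lam (\<phi> s z))"

text \<open>The waiting time is \<open>\<infinity>\<close> (the infimum of the empty set) if there is no further jump.\<close>

definition waiting_time :: "(real \<Rightarrow> 'z \<Rightarrow> 'z) \<Rightarrow> ('z \<Rightarrow> real) \<Rightarrow> 'z \<Rightarrow> real \<Rightarrow> ereal" where
  "waiting_time \<phi> lam z e = (INF t\<in>{t. 0 \<le> t \<and> e < cumulative_rate \<phi> lam z t}. ereal t)"

definition std_exponential :: "real measure" where
  "std_exponential = density lborel (exponential_density 1)"

text \<open>
  \<open>jump_chain \<phi> lam R z \<omega> n\<close> is the \<open>n\<close>-th jump time together with the position right after that
  jump; entry \<open>0\<close> is the start.  The position is irrelevant once the jump time is \<open>\<infinity>\<close>.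
\<close>

primrec jump_chain ::
    "(real \<Rightarrow> 'z \<Rightarrow> 'z) \<Rightarrow> ('z \<Rightarrow> real) \<Rightarrow> ('s \<Rightarrow> 'z \<Rightarrow> 'z) \<Rightarrow> 'z \<Rightarrow> (real \<times> 's) stream \<Rightarrow> nat \<Rightarrow> ereal \<times> 'z"
where
  "jump_chain \<phi> lam R z \<omega> 0 = (0, z)"
| "jump_chain \<phi> lam R z \<omega> (Suc n) =
     (let (\<tau>, y) = jump_chain \<phi> lam R z \<omega> n;
          (e, \<xi>) = \<omega> !! n;
          T = waiting_time \<phi> lam y e
      in (\<tau> + T, if T = \<infinity> then y else R \<xi> (\<phi> (real_of_ereal T) y)))"

text \<open>
  The position at time \<open>t \<ge> 0\<close>, for the \<open>n\<close> such that \<open>t\<close> lies in the interval from jump time \<open>n\<close>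
  (included) to jump time \<open>n + 1\<close> (excluded).  Such an \<open>n\<close> exists unless infinitely many jumps
  occur up to time \<open>t\<close>; in that case the value is an unspecified one.  For the processes below
  this is a null event.
\<close>

definition pdmp :: "(real \<Rightarrow> 'z \<Rightarrow> 'z) \<Rightarrow> ('z \<Rightarrow> real) \<Rightarrow> ('s \<Rightarrow> 'z \<Rightarrow> 'z) \<Rightarrow> 'z \<Rightarrow> (real \<times> 's) stream \<Rightarrow> real \<Rightarrow> 'z"
where
  "pdmp \<phi> lam R z \<omega> t =
     (let n = (LEAST n. ereal t < fst (jump_chain \<phi> lam R z \<omega> (Suc n)));
          (\<tau>, y) = jump_chain \<phi> lam R z \<omega> n
      in \<phi> (t - real_of_ereal \<tau>) y)"

definition pdmp_semigroup ::
    "(real \<Rightarrow> 'z \<Rightarrow> 'z) \<Rightarrow> ('z \<Rightarrow> real) \<Rightarrow> 's measure \<Rightarrow> ('s \<Rightarrow> 'z \<Rightarrow> 'z) \<Rightarrow> 'z family"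
where
  "pdmp_semigroup \<phi> lam Xi R t f z =
     (\<integral>\<omega>. f (pdmp \<phi> lam R z \<omega> t) \<partial>stream_space (std_exponential \<Otimes>\<^sub>M Xi))"

lemma waiting_time_law:
  assumes cont: "continuous_on {0..} (\<lambda>s. lam (\<phi> s z))"
    and nonneg: "\<And>s. 0 \<le> s \<Longrightarrow> 0 \<le> lam (\<phi> s z)"
    and t: "0 \<le> t"
  shows "measure std_exponential {e. ereal t \<le> waiting_time \<phi> lam z e}
           = exp (- integral {0..t} (\<lambda>s. lam (\<phi> s z)))"
proof -
  let ?L = "cumulative_rate \<phi> lam z"
  have int: "(\<lambda>s. lam (\<phi> s z)) integrable_on {0..u}" for u
    by (intro integrable_continuous_real continuous_on_subset[OF cont]) auto
  have mono: "?L u \<le> ?L v" if "u \<le> v" for u v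
    unfolding cumulative_rate_def using that nonneg
    by (intro integral_subset_le int) auto
  have contL: "continuous_on {0..t} ?L"
    unfolding cumulative_rate_def by (rule indefinite_integral_continuous_1[OF int])
  have L0: "?L 0 = 0" by (simp add: cumulative_rate_def)
  have Lt: "0 \<le> ?L t" using mono[OF t] L0 by simp
  have iff: "ereal t \<le> waiting_time \<phi> lam z e \<longleftrightarrow> ?L t \<le> e" if e: "0 \<le> e" for e
  proof
    assume "?L t \<le> e"
    have "t \<le> u" if "e < ?L u" for u
    proof (rule ccontr)
      assume "\<not> t \<le> u"
      then have "?L u \<le> ?L t" by (intro mono) simp
      with that \<open>?L t \<le> e\<close> show False by simp
    qed
    then show "ereal t \<le> waiting_time \<phi> lam z e"
      unfolding waiting_time_def by (intro INF_greatest) auto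
  next
    assume a: "ereal t \<le> waiting_time \<phi> lam z e"
    show "?L t \<le> e"
    proof (rule ccontr)
      assume "\<not> ?L t \<le> e"
      then have lt: "e < ?L t" by simp
      have "\<exists>u. 0 \<le> u \<and> u \<le> t \<and> ?L u = (e + ?L t) / 2"
        by (rule IVT') (use L0 e lt contL t in auto)
      then obtain u where u: "0 \<le> u" "u \<le> t" "?L u = (e + ?L t) / 2" by blast
      with lt have "u \<noteq> t" "e < ?L u" by auto
      then have "waiting_time \<phi> lam z e \<le> ereal u"
        unfolding waiting_time_def using u by (intro INF_lower) auto
      with a u \<open>u \<noteq> t\<close> show False
        by (meson ereal_less_eq(3) order_antisym order_trans)
    qed
  qed
  interpret E: prob_space std_exponential
    unfolding std_exponential_def by (rule prob_space_exponential_density) simp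
  have sets_E [simp]: "sets std_exponential = sets borel" "space std_exponential = UNIV"
    by (auto simp: std_exponential_def)
  have dist: "distributed std_exponential lborel (\<lambda>x. x) (exponential_density 1)"
    unfolding distributed_def std_exponential_def
    by (auto simp: distr_id2)
  have AE_pos: "AE e in std_exponential. 0 \<le> e"
    unfolding std_exponential_def by (subst AE_density) (auto simp: exponential_density_def)
  have wt_mono: "waiting_time \<phi> lam z e \<le> waiting_time \<phi> lam z e'" if "e \<le> e'" for e e'
    unfolding waiting_time_def using that by (intro INF_superset_mono) auto
  have meas: "{e. ereal t \<le> waiting_time \<phi> lam z e} \<in> sets borel"
    by (intro real_interval_borel_measurable)
       (use wt_mono order_trans in \<open>unfold is_interval_1, blast\<close>)
  have "measure std_exponential {e. ereal t \<le> waiting_time \<phi> lam z e}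
      = measure std_exponential {e. ?L t \<le> e}"
    by (rule E.finite_measure_eq_AE) (use AE_pos iff meas in auto)
  also have "\<dots> = measure std_exponential {e. ?L t < e}"
  proof (rule E.finite_measure_eq_AE)
    have "AE x in lborel. x \<noteq> ?L t" by (rule AE_lborel_singleton)
    then have "AE e in std_exponential. e \<noteq> ?L t"
      unfolding std_exponential_def by (subst AE_density) (auto elim: eventually_mono)
    then show "AE e in std_exponential. (e \<in> {e. ?L t \<le> e}) = (e \<in> {e. ?L t < e})"
      by eventually_elim auto
  qed auto
  also have "\<dots> = exp (- ?L t)"
    using E.exponential_distributedD_gt[OF dist Lt] by simp
  finally show ?thesis by (simp add: cumulative_rate_def)
qed


section \<open>Isometric refreshment processes\<close>

definition free_flow :: "real \<Rightarrow> 'a \<times> 'a \<Rightarrow> 'a \<times> ('a::real_vector)" where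
  "free_flow t = (\<lambda>(q, p). (q + t *\<^sub>R p, p))"

definition refreshment_jump ::
    "('s \<Rightarrow> real^'d \<Rightarrow> real^'d^'d) \<Rightarrow> 's \<Rightarrow> (real^'d) \<times> (real^'d) \<Rightarrow> (real^'d) \<times> (real^'d)"
where
  "refreshment_jump Orth \<xi> = (\<lambda>(q, p). (q, Orth \<xi> q *v p))"

text \<open>
  The condition \<open>jump_rate_continuous\<close> says that the jump part of the generator preserves
  continuity.  For merely measurable \<open>Orth\<close> it can fail, and it cannot be dispensed with: on
  \<open>C\<^sub>c\<^sup>\<infinity>\<close> the generator is \<open>f \<mapsto> g \<bullet> \<nabla>f + \<lambda> (Q f - f)\<close>, with \<open>Q f z = \<integral> f (R \<xi> z) d\<Xi>(\<xi>)\<close>, and it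
  takes values in continuous functions only if \<open>\<lambda> (Q f)\<close> is continuous.  It holds in particular
  if \<open>Orth \<xi>\<close> is continuous for almost all \<open>\<xi>\<close> (\<open>isometric_refreshmentI_continuous\<close> below).
\<close>

locale isometric_refreshment = prob_space Xi
  for Xi :: "'s measure" +
  fixes lam :: "(real^'d) \<times> (real^'d) \<Rightarrow> real"
    and Orth :: "'s \<Rightarrow> real^'d \<Rightarrow> real^'d^'d"
  assumes rate_nonneg: "0 \<le> lam z"
    and rate_continuous: "continuous_on UNIV lam"
    and orthogonal: "\<xi> \<in> space Xi \<Longrightarrow> orthogonal_matrix (Orth \<xi> q)"
    and Orth_measurable: "(\<lambda>(\<xi>, q). Orth \<xi> q) \<in> borel_measurable (Xi \<Otimes>\<^sub>M borel)"
    and jump_rate_continuous: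
      "f \<in> C_zero \<Longrightarrow> continuous_on UNIV (\<lambda>z. lam z * (\<integral>\<xi>. f (refreshment_jump Orth \<xi> z) \<partial>Xi))"

definition refreshment_semigroup ::
    "'s measure \<Rightarrow> ((real^'d) \<times> (real^'d) \<Rightarrow> real) \<Rightarrow> ('s \<Rightarrow> real^'d \<Rightarrow> real^'d^'d)
      \<Rightarrow> ((real^'d) \<times> (real^'d)) family"
where
  "refreshment_semigroup Xi lam Orth = pdmp_semigroup free_flow lam Xi (refreshment_jump Orth)"

lemma C_zero_bounded:
  fixes f :: "'a::euclidean_space \<Rightarrow> real"
  assumes "f \<in> C_zero"
  obtains B where "\<And>x. \<bar>f x\<bar> \<le> B"
proof -
  from assms have f: "continuous_on UNIV f" "(f \<longlongrightarrow> 0) at_infinity"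
    by (auto simp: C_zero_def)
  from tendstoD[OF f(2), of 1] obtain b where b: "\<And>x. b \<le> norm x \<Longrightarrow> \<bar>f x\<bar> < 1"
    by (auto simp: eventually_at_infinity dist_real_def)
  have "compact (f ` cball 0 b)"
    by (intro compact_continuous_image continuous_on_subset[OF f(1)]) auto
  then obtain c where c: "\<And>x. norm x \<le> b \<Longrightarrow> \<bar>f x\<bar> \<le> c"
    by (fastforce dest: compact_imp_bounded simp: bounded_iff)
  have "\<bar>f x\<bar> \<le> max 1 c" for x
    using b[of x] c[of x] by (cases "norm x \<le> b") auto
  then show ?thesis using that by blast
qed

lemma isometric_refreshmentI_continuous:
  fixes lam :: "(real^'d) \<times> (real^'d) \<Rightarrow> real"
  assumes "prob_space Xi"
    and nonneg: "\<And>z. 0 \<le> lam z" and cont: "continuous_on UNIV lam"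
    and orth: "\<And>\<xi> q. \<xi> \<in> space Xi \<Longrightarrow> orthogonal_matrix (Orth \<xi> q)"
    and meas: "(\<lambda>(\<xi>, q). Orth \<xi> q) \<in> borel_measurable (Xi \<Otimes>\<^sub>M borel)"
    and contO: "AE \<xi> in Xi. continuous_on UNIV (Orth \<xi>)"
  shows "isometric_refreshment Xi lam Orth"
proof -
  interpret prob_space Xi by fact
  show ?thesis
  proof
    fix f :: "(real^'d) \<times> (real^'d) \<Rightarrow> real"
    assume f: "f \<in> C_zero"
    then have fc: "continuous_on UNIV f" by (simp add: C_zero_def)
    obtain B where B: "\<And>x. \<bar>f x\<bar> \<le> B" using C_zero_bounded[OF f] by blast
    have [measurable]: "f \<in> borel_measurable borel"
      using fc by (rule borel_measurable_continuous_onI)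
    have mO: "(\<lambda>\<xi>. Orth \<xi> q) \<in> borel_measurable Xi" for q
      using measurable_compose[OF measurable_Pair2'[of q borel Xi] meas] by simp
    have mJ: "(\<lambda>\<xi>. f (refreshment_jump Orth \<xi> z)) \<in> borel_measurable Xi" for z
    proof -
      have "continuous_on UNIV (\<lambda>A::real^'d^'d. f (fst z, A *v snd z))"
        by (intro continuous_on_compose2[OF fc] continuous_intros
              linear_continuous_on linear_conv_bounded_linear[THEN iffD1] linearI)
           (auto simp: matrix_vector_mult_add_rdistrib scaleR_matrix_vector_assoc)
      then have "(\<lambda>A::real^'d^'d. f (fst z, A *v snd z)) \<in> borel_measurable borel"
        by (rule borel_measurable_continuous_onI)
      from measurable_compose[OF mO[of "fst z"] this]
      show ?thesis by (simp add: refreshment_jump_def split_beta)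
    qed
    have jc: "continuous_on UNIV (\<lambda>z. f (refreshment_jump Orth \<xi> z))"
      if c: "continuous_on UNIV (Orth \<xi>)" for \<xi>
      unfolding refreshment_jump_def split_beta matrix_vector_mult_def
      by (intro continuous_on_compose2[OF fc] continuous_intros
            continuous_on_compose2[OF c]) auto
    have "continuous_on UNIV (\<lambda>z. \<integral>\<xi>. f (refreshment_jump Orth \<xi> z) \<partial>Xi)"
      unfolding continuous_on_sequentially
    proof (intro ballI allI impI, elim conjE)
      fix x and a :: "(real^'d) \<times> (real^'d)"
      assume x: "x \<longlonglongrightarrow> a"
      show "((\<lambda>z. \<integral>\<xi>. f (refreshment_jump Orth \<xi> z) \<partial>Xi) \<circ> x) \<longlonglongrightarrow> (\<integral>\<xi>. f (refreshment_jump Orth \<xi> a) \<partial>Xi)"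
        unfolding comp_def
      proof (rule integral_dominated_convergence[where w="\<lambda>_. B"])
        show "AE \<xi> in Xi. (\<lambda>i. f (refreshment_jump Orth \<xi> (x i))) \<longlonglongrightarrow> f (refreshment_jump Orth \<xi> a)"
          using contO
        proof eventually_elim
          case (elim \<xi>)
          from continuous_on_tendsto_compose[OF jc[OF elim] x] show ?case by simp
        qed
      qed (use B mJ in auto)
    qed
    then show "continuous_on UNIV (\<lambda>z. lam z * (\<integral>\<xi>. f (refreshment_jump Orth \<xi> z) \<partial>Xi))"
      by (intro continuous_on_mult cont)
  qed (use nonneg cont orth meas in auto)
qed


section \<open>Zig-Zag and Pure Reflection processes\<close>

definition flip_matrix :: "'d \<Rightarrow> real^'d^'d" where
  "flip_matrix i = (\<chi> r c. if r = c then (if r = i then - 1 else 1) else 0)"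

lemma flip_matrix_mult: "flip_matrix i *v p = (\<chi> j. if j = i then - (p $ j) else p $ j)"
proof -
  have "(\<Sum>c\<in>UNIV. flip_matrix i $ r $ c * p $ c)
      = (\<Sum>c\<in>UNIV. if r = c then (if c = i then - (p $ c) else p $ c) else 0)" for r
    by (rule sum.cong) (auto simp: flip_matrix_def)
  then show ?thesis
    by (simp add: vec_eq_iff matrix_vector_mult_def)
qed

lemma orthogonal_flip_matrix: "orthogonal_matrix (flip_matrix i)"
proof -
  have "transpose (flip_matrix i) = flip_matrix i"
    by (auto simp: vec_eq_iff flip_matrix_def transpose_def)
  moreover have "flip_matrix i ** flip_matrix i = mat 1"
    by (rule matrix_eq[THEN iffD2]) (simp add: matrix_vector_mul_assoc[symmetric] flip_matrix_mult vec_eq_iff)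
  ultimately show ?thesis by (simp add: orthogonal_matrix_def)
qed

definition zigzag :: "('s \<Rightarrow> 'd) \<Rightarrow> 's \<Rightarrow> real^'d \<Rightarrow> real^'d^'d" where
  "zigzag i \<xi> q = flip_matrix (i \<xi>)"

lemma zigzag_jump:
  "refreshment_jump (zigzag i) \<xi> (q, p) = (q, \<chi> j. if j = i \<xi> then - (p $ j) else p $ j)"
  by (simp add: refreshment_jump_def zigzag_def flip_matrix_mult)

lemma zigzag_isometric_refreshment:
  fixes i :: "'s \<Rightarrow> 'd::finite"
  assumes "prob_space Xi" "i \<in> measurable Xi (count_space UNIV)"
    and "\<And>z. 0 \<le> lam z" "continuous_on UNIV lam"
  shows "isometric_refreshment Xi lam (zigzag i)"
proof (rule isometric_refreshmentI_continuous)
  have "(\<lambda>x. i (fst x)) \<in> measurable (Xi \<Otimes>\<^sub>M (borel :: (real^'d) measure)) (count_space UNIV)"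
    using measurable_fst assms(2) by (rule measurable_compose)
  then have "(\<lambda>x. flip_matrix (i (fst x))) \<in> borel_measurable (Xi \<Otimes>\<^sub>M (borel :: (real^'d) measure))"
    by (rule measurable_compose) simp
  then show "(\<lambda>(\<xi>, q). zigzag i \<xi> q) \<in> borel_measurable (Xi \<Otimes>\<^sub>M borel)"
    by (simp add: zigzag_def split_beta)
qed (use assms in \<open>auto simp: zigzag_def orthogonal_flip_matrix\<close>)

definition pure_reflection :: "'s \<Rightarrow> real^'d \<Rightarrow> real^'d^'d" where
  "pure_reflection \<xi> q = - mat 1"

lemma uminus_mat_1_mult: "(- mat 1 :: real^'d^'d) *v p = - p"
  using matrix_vector_mult_diff_rdistrib[of 0 "mat 1 :: real^'d^'d" p] by simp

lemma pure_reflection_jump: "refreshment_jump pure_reflection \<xi> (q, p) = (q, - p)"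
  by (simp add: refreshment_jump_def pure_reflection_def uminus_mat_1_mult)

lemma pure_reflection_isometric_refreshment:
  fixes Xi :: "'s measure" and lam :: "(real^'d) \<times> (real^'d) \<Rightarrow> real"
  assumes "prob_space Xi" "\<And>z. 0 \<le> lam z" "continuous_on UNIV lam"
  shows "isometric_refreshment Xi lam pure_reflection"
proof (rule isometric_refreshmentI_continuous)
  have "transpose (- mat 1 :: real^'d^'d) = - mat 1"
    by (auto simp: vec_eq_iff transpose_def mat_def)
  moreover have "(- mat 1 :: real^'d^'d) ** (- mat 1) = mat 1"
    by (rule matrix_eq[THEN iffD2])
       (simp only: matrix_vector_mul_assoc[symmetric] uminus_mat_1_mult
         minus_minus matrix_vector_mul_lid simp_thms)
  ultimately have "orthogonal_matrix (- mat 1 :: real^'d^'d)"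
    by (simp add: orthogonal_matrix_def)
  then show "orthogonal_matrix (pure_reflection \<xi> q :: real^'d^'d)" for \<xi> :: 's and q
    by (simp add: pure_reflection_def)
qed (use assms in \<open>auto simp: pure_reflection_def\<close>)

end

theory Submission
  imports Defs
begin

text \<open>
  Write \<open>G f\<close> for the derivative of \<open>f\<close> along the free flow and \<open>Q f\<close> for the average of \<open>f\<close> after a jump.
  On smooth functions of compact support the generator is \<open>f \<mapsto> G f + \<lambda> (Q f - f)\<close>.  The intensity \<open>\<lambda>\<close> is
  merely continuous, so the semigroup need not preserve smoothness, and it may be unbounded.  The theorem is
  true because jumps are isometries of the velocity: the speed \<open>\<parallel>p\<parallel>\<close> is constant in time, so that
  during a time \<open>t\<close> the process started in the compact set \<open>slab\<close> of the \<open>(q, p)\<close> with \<open>\<parallel>p\<parallel> \<le> a\<close> and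
  \<open>\<parallel>q\<parallel> \<le> b\<close> does not leave the one with \<open>\<parallel>q\<parallel> \<le> b + t a\<close>, where \<open>\<lambda>\<close> is bounded.  Jumps therefore do
  not accumulate, functions of compact support keep a compact support, and over finite times everything is
  as for a bounded intensity.

  From paths to an equation.  Conditioning on the first waiting time and the first jump expresses the
  expectation over the paths with at most \<open>n\<close> jumps by the one over the paths with at most \<open>n - 1\<close> jumps
  (\<open>trunc_Suc\<close>).  This is the Picard iteration for Duhamel's formula: its iterates are continuous by
  induction, they converge locally uniformly because at least \<open>n\<close> jumps up to time \<open>t\<close> have a probability
  of order \<open>2\<^sup>-\<^sup>n\<close>, and so \<open>u\<^sub>t = P\<^sub>t f\<close> is continuous in \<open>(t, z)\<close> and satisfies (\<open>evolve_duhamel\<close>)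
  \<open>u\<^sub>t(z) = f(\<phi>\<^sub>t z) exp (- \<Lambda>(z, t)) + \<integral>\<^sub>0\<^sup>t \<lambda> Q u\<^sub>t\<^sub>-\<^sub>s (\<phi>\<^sub>s z) exp (- \<Lambda>(z, s)) ds\<close>, where
  \<open>\<Lambda>(z, t) = \<integral>\<^sub>0\<^sup>t \<lambda>(\<phi>\<^sub>s z) ds\<close>.  The Feller property follows by approximation with functions of
  compact support, and all that is said about the generator is read off from this equation.  In particular, a
  continuous function of compact support whose difference quotients along the flow converge uniformly is in
  the domain, with the above formula for the generator (\<open>has_generator_supported\<close>).

  The core.  Let \<open>f\<close> be in the domain and let \<open>g\<close> be continuous with compact support and uniformly close to
  \<open>f\<close>.  The average \<open>A = h\<^sup>-\<^sup>1 \<integral>\<^sub>0\<^sup>h P\<^sub>s g ds\<close> still has compact support, it is differentiable along the flow,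
  and its generator is \<open>(P\<^sub>h g - g) / h\<close> (\<open>flow_derivative_evolve_average\<close>).  For small \<open>h\<close> and \<open>g\<close> close to
  \<open>f\<close> even compared to \<open>h\<close>, this is near \<open>(P\<^sub>h f - f) / h\<close> and hence near the generator of \<open>f\<close>.  It remains to
  smooth \<open>A\<close> without spoiling its derivative along the flow; the jump part of the generator then takes care
  of itself, since \<open>\<lambda>\<close> is bounded on a common compact support.  The field \<open>p \<cdot> \<nabla>\<^sub>q\<close> does not commute with
  translations of \<open>p\<close>, and \<open>\<nabla>\<^sub>q A\<close> need not exist.  So \<open>A\<close> is mollified in \<open>q\<close> first, which commutes with the
  flow and creates a continuous \<open>\<nabla>\<^sub>q\<close> (\<open>mollify_position\<close>), and then in all variables
  (\<open>smooth_approximation\<close>).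
\<close>

section \<open>Smooth functions and mollifiers\<close>

text \<open>
  The derivative of \<open>s \<mapsto> exp (- 1 / s)\<close>, extended by zero, is a combination of such functions with
  additional powers of \<open>1 / s\<close>.  Having these powers in the definition makes the family closed under
  differentiation.
\<close>

definition flat_exp :: "nat \<Rightarrow> real \<Rightarrow> real" where
  "flat_exp m s = (if 0 < s then exp (- (1 / s)) / s ^ m else 0)"

lemma flat_exp_nonneg: "0 \<le> flat_exp m s"
  by (simp add: flat_exp_def)

lemma flat_exp_tendsto_0: "(flat_exp m \<longlongrightarrow> 0) (at 0)"
proof (rule filterlim_split_at)
  show "(flat_exp m \<longlongrightarrow> 0) (at_left 0)"
    by (rule tendsto_eventually) (auto simp: eventually_at_filter flat_exp_def)
  have "((\<lambda>s::real. inverse s ^ m / exp (inverse s)) \<longlongrightarrow> 0) (at_right 0)"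
    by (rule filterlim_compose[OF tendsto_power_div_exp_0 filterlim_inverse_at_top_right])
  then show "(flat_exp m \<longlongrightarrow> 0) (at_right 0)"
    by (rule Lim_transform_eventually)
       (auto simp: eventually_at_filter flat_exp_def exp_minus field_simps)
qed

lemma flat_exp_deriv:
  "(flat_exp m has_real_derivative flat_exp (m + 2) s - real m * flat_exp (m + 1) s) (at s)"
proof -
  consider "s < 0" | "s = 0" | "0 < s" by linarith
  then show ?thesis
  proof cases
    case 1
    have "((\<lambda>_. 0) has_real_derivative 0) (at s)" by simp
    then have "(flat_exp m has_real_derivative 0) (at s)"
      by (rule DERIV_cong_ev[OF refl _ refl, THEN iffD1, rotated])
         (use 1 in \<open>auto simp: flat_exp_def intro!: eventually_nhds_in_open[of "{..<0}", THEN eventually_mono]\<close>)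
    with 1 show ?thesis by (simp add: flat_exp_def)
  next
    case 2
    have "((\<lambda>h. (flat_exp m (0 + h) - flat_exp m 0) / h) \<longlongrightarrow> 0) (at 0)"
      by (rule Lim_transform_eventually[OF flat_exp_tendsto_0[of "m + 1"]])
         (auto simp: eventually_at_filter flat_exp_def field_simps)
    then have "(flat_exp m has_real_derivative 0) (at 0)" by (simp add: DERIV_def)
    with 2 show ?thesis by (simp add: flat_exp_def)
  next
    case 3
    have "((\<lambda>s. exp (- (1 / s)) / s ^ m) has_real_derivative
        (exp (- (1 / s)) * (1 / (s * s)) * s ^ m - exp (- (1 / s)) * (real m * s ^ (m - Suc 0)))
          / (s ^ m * s ^ m)) (at s)"
      using 3 by (auto intro!: derivative_eq_intros)
    also have "(exp (- (1 / s)) * (1 / (s * s)) * s ^ m - exp (- (1 / s)) * (real m * s ^ (m - Suc 0)))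
          / (s ^ m * s ^ m) = flat_exp (m + 2) s - real m * flat_exp (m + 1) s"
      using 3 by (cases m) (simp_all add: flat_exp_def field_simps)
    finally have "((\<lambda>s. exp (- (1 / s)) / s ^ m) has_real_derivative
        (flat_exp (m + 2) s - real m * flat_exp (m + 1) s)) (at s)" .
    then show ?thesis
      by (rule DERIV_cong_ev[OF refl _ refl, THEN iffD1, rotated])
         (use 3 in \<open>auto simp: flat_exp_def intro!: eventually_nhds_in_open[of "{0<..}", THEN eventually_mono]\<close>)
  qed
qed

text \<open>
  All elements are infinitely differentiable, and the class is closed under directional derivatives
  (\<open>smooth_class_derivative\<close>).  The two facts together replace calculus with \<open>C\<^sup>k\<close> functions, and the class is
  just rich enough to contain bump functions.
\<close>

inductive_set smooth_class :: "('a::euclidean_space \<Rightarrow> real) set" where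
  const: "(\<lambda>_. c) \<in> smooth_class"
| linear: "bounded_linear l \<Longrightarrow> l \<in> smooth_class"
| add: "f \<in> smooth_class \<Longrightarrow> g \<in> smooth_class \<Longrightarrow> (\<lambda>x. f x + g x) \<in> smooth_class"
| mult: "f \<in> smooth_class \<Longrightarrow> g \<in> smooth_class \<Longrightarrow> (\<lambda>x. f x * g x) \<in> smooth_class"
| flat: "f \<in> smooth_class \<Longrightarrow> (\<lambda>x. flat_exp m (f x)) \<in> smooth_class"

lemma smooth_class_sum:
  "finite I \<Longrightarrow> (\<And>i. i \<in> I \<Longrightarrow> f i \<in> smooth_class) \<Longrightarrow> (\<lambda>x. \<Sum>i\<in>I. f i x) \<in> smooth_class"
  by (induction I rule: finite_induct) (auto intro: smooth_class.intros)

lemma smooth_class_cmult: "f \<in> smooth_class \<Longrightarrow> (\<lambda>x. c * f x) \<in> smooth_class"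
  by (rule smooth_class.mult[OF smooth_class.const])

lemma smooth_class_derivative:
  assumes "f \<in> smooth_class"
  shows "\<exists>D. (\<forall>x. (f has_derivative D x) (at x)) \<and> (\<forall>v. (\<lambda>x. D x v) \<in> smooth_class)"
  using assms
proof induction
  case (const c)
  show ?case by (rule exI[of _ "\<lambda>_ _. 0"]) (auto intro: smooth_class.intros)
next
  case (linear l)
  then show ?case
    by (intro exI[of _ "\<lambda>_. l"]) (auto intro: smooth_class.intros bounded_linear_imp_has_derivative)
next
  case (add f g)
  then obtain D E where D: "\<And>x. (f has_derivative D x) (at x)" "\<And>v. (\<lambda>x. D x v) \<in> smooth_class"
    and E: "\<And>x. (g has_derivative E x) (at x)" "\<And>v. (\<lambda>x. E x v) \<in> smooth_class" by blast
  show ?case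
    by (intro exI[of _ "\<lambda>x v. D x v + E x v"] conjI allI has_derivative_add D E smooth_class.intros)
next
  case (mult f g)
  then obtain D E where D: "\<And>x. (f has_derivative D x) (at x)" "\<And>v. (\<lambda>x. D x v) \<in> smooth_class"
    and E: "\<And>x. (g has_derivative E x) (at x)" "\<And>v. (\<lambda>x. E x v) \<in> smooth_class" by blast
  show ?case
    by (intro exI[of _ "\<lambda>x v. f x * E x v + D x v * g x"] conjI allI has_derivative_mult D E
        smooth_class.intros mult.hyps)
next
  case (flat f m)
  then obtain D where D: "\<And>x. (f has_derivative D x) (at x)" "\<And>v. (\<lambda>x. D x v) \<in> smooth_class"
    by blast
  let ?p = "\<lambda>x. flat_exp (m + 2) (f x) + (- real m) * flat_exp (m + 1) (f x)"
  have "((\<lambda>x. flat_exp m (f x)) has_derivative (\<lambda>v. ?p x * D x v)) (at x)" for x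
    using has_derivative_compose[OF D(1) flat_exp_deriv[unfolded has_field_derivative_def]]
    by (simp add: algebra_simps)
  then show ?case
    by (intro exI[of _ "\<lambda>x v. ?p x * D x v"] conjI allI D smooth_class.intros flat.hyps) auto
qed

lemma smooth_class_continuous:
  assumes "f \<in> smooth_class"
  shows "continuous_on A f"
  using smooth_class_derivative[OF assms]
  by (meson continuous_at_imp_continuous_on has_derivative_continuous)

definition mollifier :: "real \<Rightarrow> ('a::euclidean_space \<Rightarrow> real) \<Rightarrow> bool" where
  "mollifier d \<kappa> \<longleftrightarrow> \<kappa> \<in> smooth_class \<and> (\<forall>w. 0 \<le> \<kappa> w) \<and> (\<forall>w. d \<le> norm w \<longrightarrow> \<kappa> w = 0) \<and>
    (\<kappa> has_integral 1) UNIV"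

lemma mollifierD:
  assumes "mollifier d \<kappa>"
  shows "\<kappa> \<in> smooth_class" "0 \<le> \<kappa> w" "d \<le> norm w \<Longrightarrow> \<kappa> w = 0" "(\<kappa> has_integral 1) UNIV"
    "continuous_on A \<kappa>"
  using assms smooth_class_continuous by (auto simp: mollifier_def)

text \<open>
  A multiple of \<open>exp (- 1 / (d\<^sup>2 - \<parallel>w\<parallel>\<^sup>2))\<close>, extended by zero outside the ball.
\<close>

lemma mollifier_exists:
  assumes d: "0 < d"
  obtains \<kappa> :: "'a::euclidean_space \<Rightarrow> real" where "mollifier d \<kappa>"
proof -
  let ?b = "\<lambda>w::'a. flat_exp 0 (d\<^sup>2 + (- 1) * (\<Sum>b\<in>Basis. (w \<bullet> b) * (w \<bullet> b)))"
  have b_eq: "?b w = flat_exp 0 (d\<^sup>2 - (norm w)\<^sup>2)" for w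
    by (simp only: euclidean_inner[symmetric] power2_norm_eq_inner) simp
  have S: "?b \<in> smooth_class"
    by (intro smooth_class.intros smooth_class_sum bounded_linear_inner_left finite_Basis)
  have supp: "?b w = 0" if "d \<le> norm w" for w
    unfolding b_eq using that d by (simp add: flat_exp_def power_mono not_less)
  obtain a c :: 'a where ac: "cball 0 d \<subseteq> cbox a c"
    by (metis bounded_subset_cbox_symmetric[OF bounded_cball])
  have cont: "continuous_on (cbox a c) ?b" by (rule smooth_class_continuous[OF S])
  have int: "?b integrable_on cbox a c" by (rule integrable_continuous[OF cont])
  have "ball 0 d \<subseteq> box a c"
    using ac by (metis ball_subset_cball interior_cbox interior_maximal open_ball order_trans)
  then have box: "box a c \<noteq> {}" and 0: "0 \<in> cbox a c" using d box_subset_cbox[of a c] by fastforce+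
  have "integral (cbox a c) ?b \<noteq> 0"
  proof
    assume "integral (cbox a c) ?b = 0"
    then have "?b 0 = 0"
      using integral_cbox_eq_0_iff[OF cont box] 0 flat_exp_nonneg by blast
    moreover have "?b 0 > 0" using d by (simp only: b_eq) (simp add: flat_exp_def)
    ultimately show False by simp
  qed
  moreover have "0 \<le> integral (cbox a c) ?b"
    by (rule integral_nonneg[OF int]) (simp add: flat_exp_nonneg)
  ultimately have pos: "0 < integral (cbox a c) ?b" by simp
  let ?k = "\<lambda>w. (1 / integral (cbox a c) ?b) * ?b w"
  have "(?b has_integral integral (cbox a c) ?b) UNIV"
  proof (rule has_integral_on_superset[OF integrable_integral[OF int]])
    show "?b w = 0" if "w \<notin> cbox a c" for w
      by (rule supp) (use ac that in \<open>force simp: subset_iff\<close>)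
  qed simp
  from has_integral_mult_right[OF this, of "1 / integral (cbox a c) ?b"] pos
  have "(?k has_integral 1) UNIV" by simp
  moreover have "?k \<in> smooth_class" by (rule smooth_class_cmult[OF S])
  moreover have "0 \<le> ?k w" for w using pos by (intro mult_nonneg_nonneg) (auto simp: flat_exp_nonneg)
  moreover have "?k w = 0" if "d \<le> norm w" for w using supp[OF that] by simp
  ultimately show ?thesis by (intro that[of ?k]) (simp add: mollifier_def)
qed

text \<open>
  The convolution is written with \<open>z + w\<close> rather than \<open>z - w\<close>, so that moving the variable from \<open>F\<close> to \<open>\<kappa>\<close> is
  a mere translation.
\<close>

definition mollify :: "('a::euclidean_space \<Rightarrow> real) \<Rightarrow> ('a \<Rightarrow> real) \<Rightarrow> 'a \<Rightarrow> real" where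
  "mollify \<kappa> F z = integral UNIV (\<lambda>w. F (z + w) * \<kappa> w)"

lemma mollify_cbox:
  assumes "\<And>w. w \<notin> cbox a b \<Longrightarrow> \<kappa> w = 0"
  shows "mollify \<kappa> F z = integral (cbox a b) (\<lambda>w. F (z + w) * \<kappa> w)"
proof -
  have "integral UNIV (\<lambda>w. F (z + w) * \<kappa> w)
      = integral UNIV (\<lambda>w. if w \<in> cbox a b then F (z + w) * \<kappa> w else 0)"
    by (rule arg_cong[where f="integral UNIV"]) (use assms in auto)
  then show ?thesis unfolding mollify_def by (simp only: integral_restrict_UNIV)
qed

text \<open>
  In this form the variable \<open>z\<close> occurs only in \<open>\<kappa>\<close>, hence \<open>mollify \<kappa> F\<close> is as smooth as \<open>\<kappa>\<close>.
\<close>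

lemma mollify_translate:
  assumes F: "continuous_on UNIV F" "\<And>w. w \<notin> cbox a b \<Longrightarrow> F w = 0" and \<kappa>: "continuous_on UNIV \<kappa>"
  shows "mollify \<kappa> F z = integral (cbox a b) (\<lambda>w. F w * \<kappa> (w - z))"
proof -
  let ?g = "\<lambda>w. F w * \<kappa> (w - z)"
  have "?g integrable_on cbox a b"
    by (intro integrable_continuous continuous_intros continuous_on_compose2[OF \<kappa>]
        continuous_on_subset[OF F(1)]) auto
  then have "(?g has_integral integral (cbox a b) ?g) (cbox a b)"
    by (rule integrable_integral)
  from has_integral_affinity[OF this, of 1 z]
  have "((\<lambda>x. F (x + z) * \<kappa> x) has_integral integral (cbox a b) ?g) ((\<lambda>x. x - z) ` cbox a b)"
    by simp
  then have "((\<lambda>x. F (x + z) * \<kappa> x) has_integral integral (cbox a b) ?g) UNIV"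
    by (rule has_integral_on_superset) (force intro!: F(2) intro: image_eqI[where x="_ + z"])+
  then show ?thesis unfolding mollify_def by (simp add: add.commute integral_unique)
qed

lemma mollify_approx:
  assumes "mollifier d \<kappa>" and F: "continuous_on UNIV F"
    and e: "\<And>w. norm w < d \<Longrightarrow> \<bar>F (z + w) - c\<bar> \<le> e"
  shows "\<bar>mollify \<kappa> F z - c\<bar> \<le> e"
proof -
  note \<kappa> = mollifierD(2,3,4)[OF assms(1)] and \<kappa>c = mollifierD(5)[OF assms(1)]
  obtain a b :: 'a where ab: "cball 0 d \<subseteq> cbox a b"
    by (metis bounded_subset_cbox_symmetric[OF bounded_cball])
  have k0: "\<kappa> w = 0" if "w \<notin> cbox a b" for w
    by (rule \<kappa>(2)) (use ab that in \<open>force simp: subset_iff\<close>)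
  have k1: "(\<kappa> has_integral 1) (cbox a b)"
  proof -
    have "(\<lambda>w. if w \<in> cbox a b then \<kappa> w else 0) = \<kappa>" using k0 by auto
    with \<kappa>(3) show ?thesis by (metis has_integral_restrict_UNIV)
  qed
  have int: "(\<lambda>w. F (z + w) * \<kappa> w) integrable_on cbox a b"
    by (intro integrable_continuous continuous_intros continuous_on_compose2[OF F]
        continuous_on_subset[OF \<kappa>c]) auto
  have i2: "((\<lambda>w. F (z + w) * \<kappa> w - c * \<kappa> w) has_integral mollify \<kappa> F z - c * 1) (cbox a b)"
    by (intro has_integral_diff has_integral_mult_right k1)
       (use integrable_integral[OF int] mollify_cbox[of a b \<kappa> F z] k0 in simp)
  have ek: "((\<lambda>w. e * \<kappa> w) has_integral e * 1) (cbox a b)"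
    by (intro has_integral_mult_right k1)
  have "norm (F (z + w) * \<kappa> w - c * \<kappa> w) \<le> e * \<kappa> w" for w
  proof (cases "norm w < d")
    case True
    from mult_right_mono[OF e[OF this] \<kappa>(1)[of w]] \<kappa>(1)[of w] show ?thesis
      by (simp add: left_diff_distrib[symmetric] abs_mult)
  qed (use \<kappa>(2) in simp)
  then have "norm (integral (cbox a b) (\<lambda>w. F (z + w) * \<kappa> w - c * \<kappa> w)) \<le> integral (cbox a b) (\<lambda>w. e * \<kappa> w)"
    using i2 ek by (intro integral_norm_bound_integral) (auto simp: integrable_on_def)
  then show ?thesis unfolding integral_unique[OF i2] integral_unique[OF ek] by simp
qed

text \<open>
  Differentiation under the integral sign; the derivative has the same form with another element of
  \<^const>\<open>smooth_class\<close> in place of \<open>\<kappa>\<close>, which is what the induction for \<open>Ck_convolution\<close> needs.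
\<close>

lemma convolution_derivative:
  fixes F :: "'a::euclidean_space \<Rightarrow> real"
  assumes F: "continuous_on UNIV F" and \<kappa>: "\<kappa> \<in> smooth_class"
    and E: "\<And>x. (\<kappa> has_derivative E x) (at x)" "\<And>v. (\<lambda>x. E x v) \<in> smooth_class"
  shows "((\<lambda>z. integral (cbox a b) (\<lambda>w. F w * \<kappa> (w - z))) has_derivative
    (\<lambda>v. integral (cbox a b) (\<lambda>w. F w * ((- 1) * E (w - z) v)))) (at z)"
proof -
  have linE: "bounded_linear (E x)" for x by (rule has_derivative_bounded_linear[OF E(1)])
  define B where "B z w = Blinfun (\<lambda>v. - (F w * E (w - z) v))" for z w
  have B: "blinfun_apply (B z w) = (\<lambda>v. - (F w * E (w - z) v))" for z w
    unfolding B_def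
    by (intro bounded_linear_Blinfun_apply bounded_linear_minus bounded_linear_mult_right
        bounded_linear_compose[OF bounded_linear_mult_right linE])
  have contF: "continuous_on (UNIV \<times> cbox a b) (\<lambda>x. F (snd x))"
    by (intro continuous_on_compose2[OF F] continuous_intros) auto
  have contB: "continuous_on (UNIV \<times> cbox a b) (\<lambda>(z, w). B z w)"
    unfolding split_beta
  proof (rule continuous_on_blinfun_componentwise)
    fix i :: 'a
    show "continuous_on (UNIV \<times> cbox a b) (\<lambda>x. blinfun_apply (B (fst x) (snd x)) i)"
      unfolding B
      by (intro continuous_intros contF continuous_on_compose2[OF smooth_class_continuous[OF E(2), of UNIV i]]) auto
  qed
  have der: "((\<lambda>z. integral (cbox a b) (\<lambda>w. F w * \<kappa> (w - z))) has_derivative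
      blinfun_apply (integral (cbox a b) (B z))) (at z)" for z
  proof (rule leibniz_rule[where U=UNIV])
    fix z w
    have "((\<lambda>z. F w * \<kappa> (w - z)) has_derivative (\<lambda>v. F w * E (w - z) (- v))) (at z)"
      by (intro has_derivative_mult_right has_derivative_compose[OF _ E(1)])
         (auto intro!: derivative_eq_intros)
    then show "((\<lambda>z. F w * \<kappa> (w - z)) has_derivative blinfun_apply (B z w)) (at z)"
      unfolding B by (simp add: linear_neg[OF bounded_linear.linear[OF linE]])
  next
    fix z show "(\<lambda>w. F w * \<kappa> (w - z)) integrable_on cbox a b"
      by (intro integrable_continuous continuous_intros continuous_on_subset[OF F]
          continuous_on_compose2[OF smooth_class_continuous[OF \<kappa>, of UNIV]]) auto
  qed (use contB in auto)
  have "blinfun_apply (integral (cbox a b) (B z)) v = integral (cbox a b) (\<lambda>w. F w * ((- 1) * E (w - z) v))" for z v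
  proof -
    have "continuous_on (cbox a b) (\<lambda>w. B z w)"
      using continuous_on_compose2[OF contB, of "cbox a b" "\<lambda>w. (z, w)"]
      by (simp add: image_subset_iff continuous_on_Pair continuous_on_const continuous_on_id)
    then have "blinfun_apply (integral (cbox a b) (B z)) v = integral (cbox a b) (\<lambda>w. blinfun_apply (B z w) v)"
      by (subst blinfun_apply_integral) (auto intro: integrable_continuous)
    then show ?thesis unfolding B by simp
  qed
  then have "blinfun_apply (integral (cbox a b) (B z)) = (\<lambda>v. integral (cbox a b) (\<lambda>w. F w * ((- 1) * E (w - z) v)))"
    by (intro ext)
  with der[of z] show ?thesis by (simp only:)
qed

lemma Ck_convolution:
  fixes F :: "'a::euclidean_space \<Rightarrow> real"
  assumes F: "continuous_on UNIV F" and \<kappa>: "\<kappa> \<in> smooth_class"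
  shows "Ck k (\<lambda>z. integral (cbox a b) (\<lambda>w. F w * \<kappa> (w - z)))"
  using \<kappa>
proof (induction k arbitrary: \<kappa>)
  case 0
  obtain E where E: "\<And>x. (\<kappa> has_derivative E x) (at x)" "\<And>v. (\<lambda>x. E x v) \<in> smooth_class"
    using smooth_class_derivative[OF 0] by blast
  from convolution_derivative[OF F 0 E] show ?case
    by (auto intro!: continuous_at_imp_continuous_on intro: has_derivative_continuous)
next
  case (Suc k)
  let ?c = "\<lambda>\<kappa> z. integral (cbox a b) (\<lambda>w. F w * \<kappa> (w - z))"
  obtain E where E: "\<And>x. (\<kappa> has_derivative E x) (at x)" "\<And>v. (\<lambda>x. E x v) \<in> smooth_class"
    using smooth_class_derivative[OF Suc.prems] by blast
  note D = convolution_derivative[OF F Suc.prems E, of a b]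
  have "frechet_derivative (?c \<kappa>) (at z) = (\<lambda>v. ?c (\<lambda>x. (- 1) * E x v) z)" for z
    using frechet_derivative_at[OF D] by simp
  moreover have "Ck k (?c (\<lambda>x. (- 1) * E x v))" for v
    by (rule Suc.IH[OF smooth_class_cmult[OF E(2)]])
  ultimately show ?case using D by (auto simp: differentiable_def)
qed

section \<open>Integrals with a varying endpoint\<close>

lemma integral_0_scale:
  fixes g :: "real \<Rightarrow> real"
  assumes "0 \<le> t" and g: "continuous_on UNIV g"
  shows "integral {0..t} g = integral {0..1} (\<lambda>s. t * g (t * s))"
proof (cases "t = 0")
  case False
  with assms have t: "0 < t" by simp
  have "g integrable_on {0..t}"
    by (intro integrable_continuous_real continuous_on_subset[OF g]) auto
  then have "(g has_integral integral {0..t} g) (cbox 0 t)"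
    by (simp add: integrable_integral)
  from has_integral_affinity[OF this, of t 0] t
  have "((\<lambda>s. g (t * s)) has_integral (1 / t) * integral {0..t} g) ((\<lambda>x. x / t) ` {0..t})"
    by simp
  also have "(\<lambda>x. x / t) ` {0..t} = {0..1}"
    using t by (auto simp: image_iff field_simps intro!: bexI[of _ "t * _"])
  finally have "((\<lambda>s. t * g (t * s)) has_integral t * ((1 / t) * integral {0..t} g)) {0..1}"
    by (rule has_integral_mult_right)
  from integral_unique[OF this] t show ?thesis by simp
qed simp

text \<open>
  Rescaling to the interval \<open>{0..1}\<close> moves the endpoint into the integrand.
\<close>

lemma continuous_on_integral_upper:
  fixes f :: "'a::topological_space \<Rightarrow> real \<Rightarrow> real"
  assumes f: "continuous_on UNIV (\<lambda>(x, s). f x s)" and t: "continuous_on UNIV t"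
  shows "continuous_on UNIV (\<lambda>x. integral {0..t x} (f x))"
proof -
  have fx: "continuous_on UNIV (f x)" for x
    using continuous_on_compose2[OF f, of UNIV "\<lambda>s. (x, s)"]
    by (simp add: continuous_on_Pair continuous_on_const continuous_on_id)
  have "integral {0..t x} (f x)
      = integral (cbox 0 1) (\<lambda>s. max 0 (t x) * f x (max 0 (t x) * s))" for x
  proof (cases "0 \<le> t x")
    case True
    then show ?thesis using integral_0_scale[OF True fx] by simp
  qed simp
  moreover have "continuous_on UNIV (\<lambda>x. integral (cbox 0 (1::real)) (\<lambda>s. max 0 (t x) * f x (max 0 (t x) * s)))"
  proof (rule integral_continuous_on_param, unfold split_beta)
    show "continuous_on (UNIV \<times> cbox 0 1) (\<lambda>p. max 0 (t (fst p)) * f (fst p) (max 0 (t (fst p)) * snd p))"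
      by (intro continuous_intros continuous_on_compose2[OF t] continuous_on_compose2[OF f,
          where f="\<lambda>p. (fst p, max 0 (t (fst p)) * snd p)", unfolded split_conv fst_conv snd_conv]) auto
  qed
  ultimately show ?thesis by simp
qed

lemma integral_combine_shift:
  fixes g :: "real \<Rightarrow> real"
  assumes g: "continuous_on UNIV g" and "0 \<le> s" "0 \<le> t"
  shows "integral {0..s + t} g = integral {0..s} g + integral {0..t} (\<lambda>r. g (s + r))"
proof -
  have int: "g integrable_on {a..b}" for a b
    by (intro integrable_continuous_real continuous_on_subset[OF g]) auto
  have "integral {0..s + t} g = integral {0..s} g + integral {s..s + t} g"
    using assms by (intro Henstock_Kurzweil_Integration.integral_combine[symmetric] int) auto
  also have "integral {s..s + t} g = integral {0..t} (\<lambda>r. g (s + r))"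
    using integral_shift_real_ivl[of s s "s + t" g] by (simp add: add.commute)
  finally show ?thesis .
qed

section \<open>The free flow and the sets it moves through\<close>

lemma free_flow_0 [simp]: "free_flow 0 z = z"
  by (simp add: free_flow_def split_beta)

lemma free_flow_free_flow [simp]: "free_flow s (free_flow t z) = free_flow (s + t) z"
  by (simp add: free_flow_def split_beta scaleR_add_left)

lemma fst_free_flow: "fst (free_flow t z) = fst z + t *\<^sub>R snd z"
  and snd_free_flow [simp]: "snd (free_flow t z) = snd z"
  by (simp_all add: free_flow_def split_beta)

lemma continuous_on_free_flow [continuous_intros]:
  fixes g :: "'b::topological_space \<Rightarrow> 'a::real_normed_vector \<times> 'a"
  assumes "continuous_on A t" "continuous_on A g"
  shows "continuous_on A (\<lambda>x. free_flow (t x) (g x))"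
  unfolding free_flow_def split_beta using assms by (intro continuous_intros)

text \<open>
  The compact sets of phase space that fit the dynamics: \<open>a\<close> bounds the speed, which is constant in time,
  and \<open>b\<close> bounds the distance from the origin, which grows at most at speed \<open>a\<close>.
\<close>

definition slab :: "real \<Rightarrow> real \<Rightarrow> ('a::real_normed_vector \<times> 'a) set" where
  "slab a b = {z. norm (snd z) \<le> a \<and> norm (fst z) \<le> b}"

lemma slab_eq: "slab a b = cball 0 b \<times> cball 0 a"
  by (auto simp: slab_def)

lemma compact_slab: "compact (slab a b :: ('a::euclidean_space \<times> 'a) set)"
  unfolding slab_eq by (intro compact_Times compact_cball)

lemma slab_mono: "a \<le> a' \<Longrightarrow> b \<le> b' \<Longrightarrow> slab a b \<subseteq> slab a' b'"
  by (auto simp: slab_def)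

lemma free_flow_slab:
  assumes "z \<in> slab a b" "0 \<le> s" "b + s * a \<le> c"
  shows "free_flow s z \<in> slab a c"
proof -
  have "norm (fst z + s *\<^sub>R snd z) \<le> norm (fst z) + s * norm (snd z)"
    using norm_triangle_ineq[of "fst z" "s *\<^sub>R snd z"] assms(2) by simp
  also have "\<dots> \<le> b + s * a"
    using assms by (intro add_mono mult_left_mono) (auto simp: slab_def)
  finally show ?thesis using assms by (auto simp: slab_def fst_free_flow)
qed

lemma free_flow_slab_reverse:
  assumes "free_flow s z \<in> slab a b" "0 \<le> s" "b + s * a \<le> c"
  shows "z \<in> slab a c"
proof -
  have "norm (fst z) \<le> norm (fst z + s *\<^sub>R snd z) + s * norm (snd z)"
    using norm_triangle_ineq4[of "fst z + s *\<^sub>R snd z" "s *\<^sub>R snd z"] assms(2) by simp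
  also have "\<dots> \<le> b + s * a"
    using assms by (intro add_mono mult_left_mono) (auto simp: slab_def fst_free_flow)
  finally show ?thesis using assms by (auto simp: slab_def fst_free_flow)
qed

lemma refreshment_jump_slab:
  assumes "orthogonal_matrix (Orth \<xi> (fst z))"
  shows "refreshment_jump Orth \<xi> z \<in> slab a b \<longleftrightarrow> z \<in> slab a b"
proof -
  have "orthogonal_transformation ((*v) (Orth \<xi> (fst z)))"
    using assms by (simp add: orthogonal_transformation_matrix)
  then have "norm (Orth \<xi> (fst z) *v snd z) = norm (snd z)"
    by (rule orthogonal_transformation_norm)
  then show ?thesis by (simp add: slab_def refreshment_jump_def split_beta)
qed

section \<open>The integrated rate and the waiting time\<close>

context isometric_refreshment
begin

abbreviation Lam :: "(real^'d) \<times> (real^'d) \<Rightarrow> real \<Rightarrow> real" where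
  "Lam \<equiv> cumulative_rate free_flow lam"

abbreviation wait :: "(real^'d) \<times> (real^'d) \<Rightarrow> real \<Rightarrow> ereal" where
  "wait \<equiv> waiting_time free_flow lam"

lemma continuous_on_lam [continuous_intros]:
  "continuous_on A g \<Longrightarrow> continuous_on A (\<lambda>x. lam (g x))"
  by (rule continuous_on_compose2[OF rate_continuous]) auto

lemma continuous_on_Lam [continuous_intros]:
  fixes t :: "'b::topological_space \<Rightarrow> real"
  assumes "continuous_on A t" "continuous_on A g"
  shows "continuous_on A (\<lambda>x. Lam (g x) (t x))"
proof -
  have "continuous_on UNIV (\<lambda>x. integral {0..fst x} (\<lambda>s. lam (free_flow s (snd x))))"
    by (intro continuous_on_integral_upper) (auto simp: split_beta intro!: continuous_intros)
  from continuous_on_compose2[OF this, of A "\<lambda>x. (t x, g x)"] assms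
  show ?thesis by (simp add: cumulative_rate_def continuous_on_Pair)
qed

lemma Lam_0 [simp]: "Lam z 0 = 0"
  by (simp add: cumulative_rate_def)

lemma lam_integrable: "(\<lambda>s. lam (free_flow s z)) integrable_on {a..b}"
  by (intro integrable_continuous_real continuous_intros)

lemma Lam_mono: "s \<le> t \<Longrightarrow> Lam z s \<le> Lam z t"
  unfolding cumulative_rate_def using rate_nonneg
  by (intro integral_subset_le lam_integrable) auto

lemma Lam_nonneg: "0 \<le> Lam z t"
  unfolding cumulative_rate_def using rate_nonneg by (intro integral_nonneg lam_integrable) auto

lemma Lam_add:
  "0 \<le> s \<Longrightarrow> 0 \<le> t \<Longrightarrow> Lam z (s + t) = Lam z s + Lam (free_flow s z) t"
  unfolding cumulative_rate_def
  by (subst integral_combine_shift) (auto intro!: continuous_intros simp: add.commute)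

lemma Lam_bound:
  assumes "\<And>s. 0 \<le> s \<Longrightarrow> s \<le> t \<Longrightarrow> lam (free_flow s z) \<le> B" "0 \<le> t"
  shows "Lam z t \<le> B * t"
proof -
  have "Lam z t \<le> integral {0..t} (\<lambda>_. B)"
    unfolding cumulative_rate_def by (intro integral_le lam_integrable) (use assms in auto)
  with assms show ?thesis by (simp add: mult.commute)
qed

text \<open>
  The substitution rule below asks for two-sided derivatives, also at time \<open>0\<close>; integrating from a negative
  time provides them.
\<close>

lemma Lam_extension:
  obtains L where "\<And>s. 0 \<le> s \<Longrightarrow> (L has_real_derivative lam (free_flow s z)) (at s)"
    "\<And>s. 0 \<le> s \<Longrightarrow> L s = Lam z s"
proof -
  let ?l = "\<lambda>s. lam (free_flow s z)"
  define L where "L u = integral {- 1..u} ?l - integral {- 1..0} ?l" for u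
  have cont: "continuous_on A ?l" for A by (intro continuous_intros)
  have "(L has_real_derivative ?l s) (at s)" if "0 \<le> s" for s
  proof -
    have "((\<lambda>u. integral {- 1..u} ?l) has_vector_derivative ?l s) (at s within {- 1..s + 1})"
      by (rule integral_has_vector_derivative[OF cont]) (use that in auto)
    moreover have "at s within {- 1..s + 1} = at s"
      by (rule at_within_interior) (use that in auto)
    ultimately show ?thesis
      unfolding L_def has_real_derivative_iff_has_vector_derivative
      by (auto intro!: derivative_eq_intros)
  qed
  moreover have "L s = Lam z s" if "0 \<le> s" for s
    using Henstock_Kurzweil_Integration.integral_combine[OF _ that lam_integrable, of "- 1" z]
    by (simp add: L_def cumulative_rate_def)
  ultimately show ?thesis using that by blast
qed

text \<open>
  The density of the waiting time is \<open>\<lambda>(\<phi>\<^sub>s z) exp (- \<Lambda>(z, s))\<close>.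
\<close>

lemma has_integral_rate_exp_Lam:
  assumes t: "0 \<le> t"
  shows "((\<lambda>s. lam (free_flow s z) * exp (- Lam z s)) has_integral 1 - exp (- Lam z t)) {0..t}"
proof -
  obtain L where L: "\<And>s. 0 \<le> s \<Longrightarrow> (L has_real_derivative lam (free_flow s z)) (at s)"
    "\<And>s. 0 \<le> s \<Longrightarrow> L s = Lam z s" using Lam_extension by blast
  have "((\<lambda>s. lam (free_flow s z) * exp (- Lam z s)) has_integral (- exp (- L t)) - (- exp (- L 0))) {0..t}"
  proof (rule fundamental_theorem_of_calculus[OF t])
    fix s assume s: "s \<in> {0..t}"
    then have "((\<lambda>s. - exp (- L s)) has_real_derivative - (exp (- L s) * (- lam (free_flow s z)))) (at s)"
      by (auto intro!: derivative_eq_intros L(1))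
    then show "((\<lambda>s. - exp (- L s)) has_vector_derivative lam (free_flow s z) * exp (- Lam z s)) (at s within {0..t})"
      using s L(2)[of s]
      by (auto simp: has_real_derivative_iff_has_vector_derivative algebra_simps intro: has_vector_derivative_at_within)
  qed
  with L(2) t show ?thesis by simp
qed

lemma wait_nonneg: "0 \<le> wait z e"
  unfolding waiting_time_def by (intro INF_greatest) auto

lemma wait_less_iff: "wait z e < a \<longleftrightarrow> (\<exists>t\<ge>0. ereal t < a \<and> e < Lam z t)"
  unfolding waiting_time_def by (auto simp: INF_less_iff)

lemma wait_le: "0 \<le> t \<Longrightarrow> e < Lam z t \<Longrightarrow> wait z e \<le> ereal t"
  unfolding waiting_time_def by (intro INF_lower) auto

lemma Lam_ge_of_wait_le:
  assumes "0 \<le> t" "wait z e \<le> ereal t"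
  shows "e \<le> Lam z t"
proof (rule field_le_epsilon)
  fix \<epsilon> :: real assume "0 < \<epsilon>"
  have "continuous_on UNIV (Lam z)" using continuous_on_Lam[of UNIV "\<lambda>t. t" "\<lambda>_. z"] by auto
  then have "isCont (Lam z) t" by (simp add: continuous_on_eq_continuous_at)
  then obtain d where d: "0 < d" "\<And>u. \<bar>u - t\<bar> < d \<Longrightarrow> \<bar>Lam z u - Lam z t\<bar> < \<epsilon>"
    using \<open>0 < \<epsilon>\<close> unfolding continuous_at_eps_delta dist_real_def by metis
  have "wait z e < ereal (t + d)" using assms(2) d(1) by (simp add: order.strict_trans1)
  then obtain u where u: "0 \<le> u" "u < t + d" "e < Lam z u" unfolding wait_less_iff by auto
  have "Lam z u \<le> Lam z (max u t)" by (rule Lam_mono) simp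
  moreover have "\<bar>Lam z (max u t) - Lam z t\<bar> < \<epsilon>" using u d by (intro d(2)) auto
  ultimately show "e \<le> Lam z t + \<epsilon>" using u by linarith
qed

text \<open>
  The waiting time inverts \<open>Lam z\<close> except where it is flat, and there the intensity vanishes.
\<close>

lemma wait_Lam:
  assumes "0 \<le> s" "lam (free_flow s z) \<noteq> 0"
  shows "wait z (Lam z s) = ereal s"
proof (rule antisym)
  obtain L where L: "\<And>s. 0 \<le> s \<Longrightarrow> (L has_real_derivative lam (free_flow s z)) (at s)"
    "\<And>s. 0 \<le> s \<Longrightarrow> L s = Lam z s" using Lam_extension by blast
  have "0 < lam (free_flow s z)" using assms rate_nonneg[of "free_flow s z"] by simp
  from DERIV_pos_inc_right[OF L(1)[OF assms(1)] this]
  obtain d where d: "0 < d" "\<And>h. 0 < h \<Longrightarrow> h < d \<Longrightarrow> L s < L (s + h)" by blast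
  show "wait z (Lam z s) \<le> ereal s"
  proof (rule ereal_le_epsilon2)
    fix e :: real assume "0 < e"
    let ?h = "min e (d / 2)"
    have "Lam z s < Lam z (s + ?h)" using d(2)[of ?h] \<open>0 < e\<close> d(1) L(2) assms(1) by auto
    then have "wait z (Lam z s) \<le> ereal (s + ?h)" using assms(1) \<open>0 < e\<close> d(1) by (intro wait_le) auto
    also have "\<dots> \<le> ereal s + ereal e" by simp
    finally show "wait z (Lam z s) \<le> ereal s + ereal e" .
  qed
  show "ereal s \<le> wait z (Lam z s)"
    unfolding waiting_time_def
  proof (intro INF_greatest, clarify)
    fix t assume "0 \<le> t" "Lam z s < Lam z t"
    then show "ereal s \<le> ereal t" using Lam_mono[of t s z] by (cases "s \<le> t") auto
  qed
qed

text \<open>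
  Monotonicity of \<open>Lam z\<close> allows rational times only in the description of \<open>wait z e < a\<close>.
\<close>

lemma measurable_wait [measurable]:
  "(\<lambda>(z, e). wait z e) \<in> borel_measurable (borel \<Otimes>\<^sub>M borel)"
proof -
  have [measurable]: "(\<lambda>z. Lam z t) \<in> borel_measurable borel" for t
    by (intro borel_measurable_continuous_onI continuous_intros)
  have "wait z e < a \<longleftrightarrow> (\<exists>q::rat. 0 \<le> q \<and> ereal (of_rat q) < a \<and> e < Lam z (of_rat q))" for z e a
  proof
    assume "wait z e < a"
    then obtain t where t: "0 \<le> t" "ereal t < a" "e < Lam z t" unfolding wait_less_iff by blast
    obtain b where b: "t < b" "ereal b \<le> a"
    proof (cases a)
      case (real r) with t that show ?thesis by auto
    next
      case PInf with that[of "t + 1"] show ?thesis by auto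
    qed (use t in auto)
    from of_rat_dense[OF b(1)] obtain q where q: "t < of_rat q" "of_rat q < b" by blast
    have "0 \<le> q" using q t by (metis less_eq_real_def of_rat_0 of_rat_less order.strict_trans1 order_less_imp_le)
    moreover have "ereal (of_rat q) < a" using q b by (metis ereal_less(1) less_ereal.simps(1) order_less_le_trans)
    moreover have "e < Lam z (of_rat q)" using t q Lam_mono[of t "of_rat q" z] by simp
    ultimately show "\<exists>q::rat. 0 \<le> q \<and> ereal (of_rat q) < a \<and> e < Lam z (of_rat q)" by blast
  qed (metis wait_less_iff zero_le_of_rat_iff)
  note iff = this
  show ?thesis
  proof (rule borel_measurableI_less)
    fix a :: ereal
    show "{x \<in> space (borel \<Otimes>\<^sub>M borel). (case x of (z, e) \<Rightarrow> wait z e) < a} \<in> sets (borel \<Otimes>\<^sub>M borel)"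
      unfolding split_beta iff by measurable
  qed
qed

end

section \<open>Decomposition at the first jump\<close>

text \<open>
  The version of \<open>nn_integral_stream_space\<close> for bounded functions that may change sign.
\<close>

lemma (in prob_space) integral_stream_space:
  fixes g :: "'a stream \<Rightarrow> real"
  assumes g: "g \<in> borel_measurable (stream_space M)" and B: "\<And>\<omega>. \<bar>g \<omega>\<bar> \<le> B"
  shows "(\<integral>\<omega>. g \<omega> \<partial>stream_space M) = (\<integral>x. (\<integral>\<omega>. g (x ## \<omega>) \<partial>stream_space M) \<partial>M)"
proof -
  interpret S: prob_space "stream_space M" by (rule prob_space_stream_space)
  interpret P: pair_prob_space M "stream_space M" ..
  have c: "(\<lambda>(x, \<omega>). x ## \<omega>) \<in> M \<Otimes>\<^sub>M stream_space M \<rightarrow>\<^sub>M stream_space M" by measurable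
  have eq: "stream_space M = distr (M \<Otimes>\<^sub>M stream_space M) (stream_space M) (\<lambda>(x, \<omega>). x ## \<omega>)"
  proof (rule measure_eqI)
    fix A assume A: "A \<in> sets (stream_space M)"
    then show "emeasure (stream_space M) A
        = emeasure (distr (M \<Otimes>\<^sub>M stream_space M) (stream_space M) (\<lambda>(x, \<omega>). x ## \<omega>)) A"
      by (subst emeasure_distr[OF c A], subst S.emeasure_pair_measure_alt,
          use measurable_sets[OF c A] in simp, subst emeasure_stream_space[OF A])
         (auto intro!: nn_integral_cong arg_cong[where f="emeasure (stream_space M)"]
           simp: space_pair_measure)
  qed simp
  have int: "integrable (M \<Otimes>\<^sub>M stream_space M) (\<lambda>(x, \<omega>). g (x ## \<omega>))"
    by (rule P.integrable_const_bound[of _ B])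
       (use B measurable_compose[OF c g] in \<open>auto simp: split_beta\<close>)
  have "(\<integral>\<omega>. g \<omega> \<partial>stream_space M) = (\<integral>p. (\<lambda>(x, \<omega>). g (x ## \<omega>)) p \<partial>(M \<Otimes>\<^sub>M stream_space M))"
    by (subst eq, subst integral_distr[OF c g]) (simp add: case_prod_beta')
  also have "\<dots> = (\<integral>x. (\<integral>\<omega>. g (x ## \<omega>) \<partial>stream_space M) \<partial>M)"
    using P.integral_fst'[OF int] by simp
  finally show ?thesis .
qed

lemma (in prob_space) abs_expectation_le:
  fixes f :: "'a \<Rightarrow> real"
  assumes "\<And>x. x \<in> space M \<Longrightarrow> \<bar>f x\<bar> \<le> C"
  shows "\<bar>\<integral>x. f x \<partial>M\<bar> \<le> C"
proof (cases "integrable M f")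
  case True
  have "\<bar>\<integral>x. f x \<partial>M\<bar> \<le> (\<integral>x. \<bar>f x\<bar> \<partial>M)"
    by (rule integral_abs_bound)
  also have "\<dots> \<le> (\<integral>x. C \<partial>M)"
    using assms True by (intro integral_mono integrable_abs) auto
  finally show ?thesis by (simp add: prob_space)
next
  case False
  obtain x where "x \<in> space M" using not_empty by blast
  from assms[OF this] have "0 \<le> C" by linarith
  with False show ?thesis by (simp add: not_integrable_integral_eq)
qed

lemma (in prob_space) abs_expectation_le_prob:
  fixes f :: "'a \<Rightarrow> real"
  assumes "A \<in> events" "0 \<le> C" "\<And>x. \<bar>f x\<bar> \<le> C * indicator A x"
  shows "\<bar>\<integral>x. f x \<partial>M\<bar> \<le> C * prob A"
proof (cases "integrable M f")
  case True
  have "\<bar>\<integral>x. f x \<partial>M\<bar> \<le> (\<integral>x. \<bar>f x\<bar> \<partial>M)"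
    by (rule integral_abs_bound)
  also have "\<dots> \<le> (\<integral>x. C * indicator A x \<partial>M)"
    using assms True by (intro integral_mono integrable_abs integrable_mult_right integrable_real_indicator) (auto simp: emeasure_eq_measure)
  also have "\<dots> = C * prob A" using assms(1) by simp
  finally show ?thesis .
qed (use assms(2) in \<open>simp add: not_integrable_integral_eq\<close>)

lemma prob_space_std_exponential: "prob_space std_exponential"
  unfolding std_exponential_def by (rule prob_space_exponential_density) simp

lemma sets_std_exponential [measurable_cong, simp]: "sets std_exponential = sets borel"
  and space_std_exponential [simp]: "space std_exponential = UNIV"
  by (auto simp: std_exponential_def)

lemma nn_integral_std_exponential_exp_minus:
  "(\<integral>\<^sup>+e. ennreal (exp (- e)) \<partial>std_exponential) = ennreal (1 / 2)"
proof -
  interpret E2: prob_space "density lborel (exponential_density 2)"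
    by (rule prob_space_exponential_density) simp
  have "(\<integral>\<^sup>+e. ennreal (exp (- e)) \<partial>std_exponential)
      = (\<integral>\<^sup>+e. ennreal (exponential_density 1 e) * ennreal (exp (- e)) \<partial>lborel)"
    unfolding std_exponential_def by (subst nn_integral_density) auto
  also have "\<dots> = (\<integral>\<^sup>+e. ennreal (1 / 2) * ennreal (exponential_density 2 e) \<partial>lborel)"
  proof (rule nn_integral_cong)
    fix e :: real
    have "exponential_density 1 e * exp (- e) = 1 / 2 * exponential_density 2 e"
      by (auto simp: exponential_density_def exp_add[symmetric])
    then show "ennreal (exponential_density 1 e) * ennreal (exp (- e))
        = ennreal (1 / 2) * ennreal (exponential_density 2 e)"
      by (metis ennreal_mult' ennreal_mult'' exp_ge_zero zero_le_divide_1_iff zero_le_numeral)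
  qed
  also have "\<dots> = ennreal (1 / 2) * emeasure (density lborel (exponential_density 2)) UNIV"
    by (subst nn_integral_cmult) (auto simp: emeasure_density)
  also have "\<dots> = ennreal (1 / 2)" using E2.emeasure_space_1 by simp
  finally show ?thesis .
qed

context isometric_refreshment
begin

abbreviation Mark :: "(real \<times> 's) measure" where
  "Mark \<equiv> std_exponential \<Otimes>\<^sub>M Xi"

abbreviation J where "J \<equiv> jump_chain free_flow lam (refreshment_jump Orth)"

abbreviation Z where "Z \<equiv> pdmp free_flow lam (refreshment_jump Orth)"

sublocale E: prob_space std_exponential by (rule prob_space_std_exponential)

sublocale EX: pair_prob_space std_exponential Xi ..

sublocale Str: prob_space "stream_space Mark" by (rule EX.prob_space_stream_space)

lemma measurable_refreshment_jump [measurable]: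
  assumes [measurable]: "f \<in> M \<rightarrow>\<^sub>M Xi" "g \<in> borel_measurable M"
  shows "(\<lambda>x. refreshment_jump Orth (f x) (g x)) \<in> borel_measurable M"
proof -
  have [measurable]: "fst \<in> borel_measurable (borel :: ((real^'d) \<times> (real^'d)) measure)"
      "snd \<in> borel_measurable (borel :: ((real^'d) \<times> (real^'d)) measure)"
    by (auto intro!: borel_measurable_continuous_onI continuous_intros)
  have "(\<lambda>x. (f x, fst (g x))) \<in> M \<rightarrow>\<^sub>M Xi \<Otimes>\<^sub>M borel" by measurable
  from measurable_compose[OF this Orth_measurable]
  have m: "(\<lambda>x. Orth (f x) (fst (g x))) \<in> borel_measurable M" by simp
  have "(\<lambda>x. Orth (f x) (fst (g x)) *v snd (g x)) \<in> borel_measurable M"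
    by (rule borel_measurable_continuous_Pair[OF m]) 
       (auto simp: matrix_vector_mult_def intro!: continuous_intros)
  then show ?thesis
    unfolding refreshment_jump_def split_beta by (intro borel_measurable_Pair) measurable
qed

lemma measurable_free_flow [measurable]:
  assumes "t \<in> borel_measurable M" "g \<in> borel_measurable M"
  shows "(\<lambda>x. free_flow (t x) (g x :: (real^'d) \<times> (real^'d))) \<in> borel_measurable M"
  by (rule borel_measurable_continuous_Pair[OF assms]) (intro continuous_intros)

lemma measurable_wait' [measurable]:
  assumes [measurable]: "g \<in> borel_measurable M" "e \<in> borel_measurable M"
  shows "(\<lambda>x. wait (g x) (e x)) \<in> borel_measurable M"
  using measurable_compose[OF _ measurable_wait, of "\<lambda>x. (g x, e x)" M] by simp

lemma J_Suc:
  "J z \<omega> (Suc n) =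
    (let T = wait (snd (J z \<omega> n)) (fst (\<omega> !! n))
     in (fst (J z \<omega> n) + T,
         if T = \<infinity> then snd (J z \<omega> n)
         else refreshment_jump Orth (snd (\<omega> !! n)) (free_flow (real_of_ereal T) (snd (J z \<omega> n)))))"
  by (simp add: split_beta Let_def)

declare jump_chain.simps(2) [simp del]

lemma measurable_J:
  "(\<lambda>x. fst (J (fst x) (snd x) n)) \<in> borel_measurable (borel \<Otimes>\<^sub>M stream_space Mark) \<and>
   (\<lambda>x. snd (J (fst x) (snd x) n)) \<in> borel_measurable (borel \<Otimes>\<^sub>M stream_space Mark)"
proof (induction n)
  case 0
  show ?case by simp
next
  case (Suc n)
  then have [measurable]:
    "(\<lambda>x. fst (J (fst x) (snd x) n)) \<in> borel_measurable (borel \<Otimes>\<^sub>M stream_space Mark)"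
    "(\<lambda>x. snd (J (fst x) (snd x) n)) \<in> borel_measurable (borel \<Otimes>\<^sub>M stream_space Mark)" by auto
  show ?case unfolding J_Suc Let_def fst_conv snd_conv by (intro conjI) measurable
qed

lemma measurable_fst_J [measurable]:
  assumes [measurable]: "g \<in> borel_measurable M" "w \<in> M \<rightarrow>\<^sub>M stream_space Mark"
  shows "(\<lambda>x. fst (J (g x) (w x) n)) \<in> borel_measurable M"
  using measurable_compose[OF _ conjunct1[OF measurable_J], of "\<lambda>x. (g x, w x)" M n] by simp

lemma measurable_snd_J [measurable]:
  assumes [measurable]: "g \<in> borel_measurable M" "w \<in> M \<rightarrow>\<^sub>M stream_space Mark"
  shows "(\<lambda>x. snd (J (g x) (w x) n)) \<in> borel_measurable M"
  using measurable_compose[OF _ conjunct2[OF measurable_J], of "\<lambda>x. (g x, w x)" M n] by simp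

lemma measurable_Z [measurable]:
  assumes [measurable]: "t \<in> borel_measurable M" "g \<in> borel_measurable M" "w \<in> M \<rightarrow>\<^sub>M stream_space Mark"
  shows "(\<lambda>x. Z (g x) (w x) (t x)) \<in> borel_measurable M"
proof -
  let ?N = "\<lambda>x. LEAST n. ereal (t x) < fst (J (g x) (w x) (Suc n))"
  have [measurable]: "?N \<in> M \<rightarrow>\<^sub>M count_space UNIV"
    by (rule measurable_Least) measurable
  have [measurable]: "(\<lambda>x. fst (J (g x) (w x) (?N x))) \<in> borel_measurable M"
    by (rule measurable_compose_countable[of "\<lambda>n x. fst (J (g x) (w x) n)"]) measurable
  have [measurable]: "(\<lambda>x. snd (J (g x) (w x) (?N x))) \<in> borel_measurable M"
    by (rule measurable_compose_countable[of "\<lambda>n x. snd (J (g x) (w x) n)"]) measurable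
  show ?thesis unfolding pdmp_def Let_def split_beta by measurable
qed

lemma J_nonneg: "0 \<le> fst (J z \<omega> n)"
  by (induction n) (auto simp: J_Suc Let_def wait_nonneg intro!: add_nonneg_nonneg)

text \<open>
  The jump chain driven by \<open>x ## \<omega>\<close> is, after the first jump, the one driven by \<open>\<omega>\<close> and started at the
  position after that jump, with all jump times shifted.
\<close>

lemma J_Stream:
  shows "wait z (fst x) = \<infinity> \<Longrightarrow> fst (J z (x ## \<omega>) (Suc n)) = \<infinity>"
    and "wait z (fst x) = ereal T \<Longrightarrow> J z (x ## \<omega>) (Suc n) =
      (let y = refreshment_jump Orth (snd x) (free_flow T z) in (ereal T + fst (J y \<omega> n), snd (J y \<omega> n)))"
proof -
  show "wait z (fst x) = \<infinity> \<Longrightarrow> fst (J z (x ## \<omega>) (Suc n)) = \<infinity>"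
  proof (induction n)
    case (Suc n)
    then show ?case by (subst J_Suc) (simp add: Let_def)
  qed (simp add: J_Suc)
  show "wait z (fst x) = ereal T \<Longrightarrow> J z (x ## \<omega>) (Suc n) =
      (let y = refreshment_jump Orth (snd x) (free_flow T z) in (ereal T + fst (J y \<omega> n), snd (J y \<omega> n)))"
  proof (induction n)
    case 0
    then show ?case by (simp add: J_Suc)
  next
    case (Suc n)
    then show ?case
      by (subst J_Suc[of z]) (simp add: Let_def add.assoc J_Suc[of _ \<omega> n])
  qed
qed

lemma Z_Stream_before:
  assumes "0 \<le> t" "ereal t < wait z (fst x)"
  shows "ereal t < fst (J z (x ## \<omega>) (Suc n))" and "Z z (x ## \<omega>) t = free_flow t z"
proof -
  show *: "ereal t < fst (J z (x ## \<omega>) (Suc n))" for n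
  proof (cases "wait z (fst x)")
    case (real T)
    have "ereal t < ereal T + 0" using assms real by simp
    also have "\<dots> \<le> ereal T + fst (J y \<omega> n)" for y by (intro add_left_mono J_nonneg)
    finally show ?thesis using J_Stream(2)[OF real] by (simp add: Let_def)
  next
    case PInf
    then show ?thesis using J_Stream(1) by simp
  qed (use assms in auto)
  have "(LEAST n. ereal t < fst (J z (x ## \<omega>) (Suc n))) = 0"
    by (rule Least_eq_0) (rule *)
  then show "Z z (x ## \<omega>) t = free_flow t z" by (simp add: pdmp_def)
qed

text \<open>
  The index that \<^const>\<open>pdmp\<close> looks up is one larger than for the process restarted after the first jump.  This
  is only so when the index exists, which is why the paths are restricted to those with \<open>t\<close> before the \<open>n\<close>-th
  jump time; for these no null set has to be discarded.
\<close>

lemma Z_Stream_after: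
  fixes T :: real and x :: "real \<times> 's" and z :: "(real^'d) \<times> (real^'d)"
  defines "y \<equiv> refreshment_jump Orth (snd x) (free_flow T z)"
  assumes "0 \<le> t" and T: "wait z (fst x) = ereal T" "T \<le> t"
  shows "ereal t < fst (J z (x ## \<omega>) (Suc n)) \<longleftrightarrow> ereal (t - T) < fst (J y \<omega> n)"
    and "ereal (t - T) < fst (J y \<omega> n) \<Longrightarrow> Z z (x ## \<omega>) t = Z y \<omega> (t - T)"
proof -
  have J: "J z (x ## \<omega>) (Suc n) = (ereal T + fst (J y \<omega> n), snd (J y \<omega> n))" for n
    using J_Stream(2)[OF T(1)] by (simp add: y_def Let_def)
  show iff: "ereal t < fst (J z (x ## \<omega>) (Suc n)) \<longleftrightarrow> ereal (t - T) < fst (J y \<omega> n)" for n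
    unfolding J fst_conv by (cases "fst (J y \<omega> n)") auto
  let ?P = "\<lambda>n. ereal t < fst (J z (x ## \<omega>) (Suc n))"
  let ?P' = "\<lambda>n. ereal (t - T) < fst (J y \<omega> (Suc n))"
  assume n: "ereal (t - T) < fst (J y \<omega> n)"
  have n0: "\<not> ?P 0" using iff[of 0] T(2) by simp
  have Pn: "?P n" using n iff by simp
  have LP: "(LEAST n. ?P n) = Suc (LEAST m. ?P (Suc m))"
    by (rule Least_Suc[of ?P, OF Pn n0])
  have iff': "?P (Suc m) \<longleftrightarrow> ?P' m" for m by (rule iff)
  define m where "m = (LEAST m. ?P' m)"
  have LP': "(LEAST n. ?P n) = Suc m" using LP unfolding m_def iff' .
  have fin: "fst (J y \<omega> m) \<noteq> \<infinity>"
  proof (cases m)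
    case (Suc k)
    then have "\<not> ?P' k" unfolding m_def by (metis lessI not_less_Least)
    then show ?thesis using Suc by auto
  qed simp
  then obtain \<tau> where \<tau>: "fst (J y \<omega> m) = ereal \<tau>"
    using J_nonneg[of y \<omega> m] by (cases "fst (J y \<omega> m)") auto
  show "Z z (x ## \<omega>) t = Z y \<omega> (t - T)"
  proof -
    have "Z z (x ## \<omega>) t = free_flow (t - real_of_ereal (fst (J z (x ## \<omega>) (Suc m)))) (snd (J z (x ## \<omega>) (Suc m)))"
      by (simp only: pdmp_def Let_def split_beta LP')
    moreover have "Z y \<omega> (t - T) = free_flow (t - T - real_of_ereal (fst (J y \<omega> m))) (snd (J y \<omega> m))"
      by (simp only: pdmp_def Let_def split_beta m_def)
    ultimately show ?thesis by (simp add: J \<tau> diff_diff_eq)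
  qed
qed

text \<open>
  The semigroup restricted to the paths with fewer than \<open>n\<close> jumps up to time \<open>t\<close>.
\<close>

definition trunc :: "nat \<Rightarrow> ((real^'d) \<times> (real^'d) \<Rightarrow> real) \<Rightarrow> real \<Rightarrow> (real^'d) \<times> (real^'d) \<Rightarrow> real" where
  "trunc n f t z = (\<integral>\<omega>. (if ereal t < fst (J z \<omega> n) then f (Z z \<omega> t) else 0) \<partial>stream_space Mark)"

abbreviation Q :: "((real^'d) \<times> (real^'d) \<Rightarrow> real) \<Rightarrow> (real^'d) \<times> (real^'d) \<Rightarrow> real" where
  "Q f z \<equiv> (\<integral>\<xi>. f (refreshment_jump Orth \<xi> z) \<partial>Xi)"

lemma measurable_trunc [measurable]:
  assumes [measurable]: "f \<in> borel_measurable borel" "t \<in> borel_measurable M" "g \<in> borel_measurable M"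
  shows "(\<lambda>x. trunc n f (t x) (g x)) \<in> borel_measurable M"
  unfolding trunc_def by measurable

lemma trunc_bound:
  assumes "f \<in> borel_measurable borel" "\<And>z. \<bar>f z\<bar> \<le> C"
  shows "\<bar>trunc n f t z\<bar> \<le> C"
proof -
  have [measurable]: "f \<in> borel_measurable borel" by fact
  have C: "0 \<le> C" using assms(2)[of 0] by linarith
  show ?thesis
    unfolding trunc_def by (rule Str.abs_expectation_le) (use C assms(2) in auto)
qed

text \<open>
  Substitution of \<open>e = Lam z s\<close> in the integral against the exponential density.  By \<open>wait_Lam\<close> the waiting
  time turns back into \<open>s\<close> wherever the factor \<open>lam (free_flow s z)\<close> that comes with the substitution is not
  zero.
\<close>

lemma integral_wait:
  fixes k :: "real \<Rightarrow> real"
  assumes [measurable]: "k \<in> borel_measurable borel" and C: "\<And>s. \<bar>k s\<bar> \<le> C" "\<bar>c\<bar> \<le> C" and t: "0 \<le> t"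
  shows "(\<integral>e. (if ereal t < wait z e then c else k (real_of_ereal (wait z e))) \<partial>std_exponential)
      = c * exp (- Lam z t) + (LINT s:{0..t}|lborel. lam (free_flow s z) * k s * exp (- Lam z s))"
proof -
  obtain L where L: "\<And>s. 0 \<le> s \<Longrightarrow> (L has_real_derivative lam (free_flow s z)) (at s)"
    "\<And>s. 0 \<le> s \<Longrightarrow> L s = Lam z s" using Lam_extension by blast
  \<comment> \<open>The constant \<open>c\<close> is split off so that only the bounded interval of \<open>e\<close> with a jump up to time \<open>t\<close> remains.\<close>
  define h where "h e = (k (real_of_ereal (wait z e)) - c) * exp (- e)" for e
  have [measurable]: "h \<in> borel_measurable borel" unfolding h_def by measurable
  have hint: "set_integrable lborel {L 0..L t} h"
    unfolding set_integrable_def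
  proof (rule Bochner_Integration.integrable_bound[where f="\<lambda>e. indicator {L 0..L t} e *\<^sub>R (2 * C * 1)"])
    show "AE e in lborel. norm (indicator {L 0..L t} e *\<^sub>R h e) \<le> norm (indicator {L 0..L t} e *\<^sub>R (2 * C * 1))"
    proof (rule AE_I2)
      fix e
      have "\<bar>h e\<bar> \<le> (2 * C) * 1" if "0 \<le> e"
        unfolding h_def abs_mult using that C(1)[of "real_of_ereal (wait z e)"] C(2)
        by (intro mult_mono) auto
      then show "norm (indicator {L 0..L t} e *\<^sub>R h e) \<le> norm (indicator {L 0..L t} e *\<^sub>R (2 * C * 1))"
        using L(2)[of 0] by (auto simp: indicator_def)
    qed
  qed (auto intro!: integrable_real_indicator[THEN integrable_mult_left] simp: emeasure_lborel_Icc_eq)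
  have sub: "(LBINT x. h x * indicator {L 0..L t} x)
      = (LBINT x. h (L x) * lam (free_flow x z) * indicator {0..t} x)"
    by (rule integral_substitution(2)[of L 0 t, OF hint])
       (use L(1) t rate_nonneg in \<open>auto intro!: continuous_intros\<close>)
  have contint: "continuous_on UNIV g \<Longrightarrow> set_integrable lborel {0..t} g" for g :: "real \<Rightarrow> real"
    by (intro borel_integrable_atLeastAtMost') (auto intro: continuous_on_subset)
  have ic: "set_integrable lborel {0..t} (\<lambda>s. lam (free_flow s z) * c * exp (- Lam z s))"
    by (intro contint continuous_intros)
  have ik: "set_integrable lborel {0..t} (\<lambda>s. lam (free_flow s z) * k s * exp (- Lam z s))"
    unfolding set_integrable_def
  proof (rule Bochner_Integration.integrable_bound)
    show "integrable lborel (\<lambda>s. indicator {0..t} s *\<^sub>R (lam (free_flow s z) * C * exp (- Lam z s)))"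
      unfolding set_integrable_def[symmetric] by (intro contint continuous_intros)
    have [measurable]: "(\<lambda>s. lam (free_flow s z)) \<in> borel_measurable borel" 
       "(\<lambda>s. Lam z s) \<in> borel_measurable borel"
      by (auto intro!: borel_measurable_continuous_onI continuous_intros)
    show "(\<lambda>s. indicator {0..t} s *\<^sub>R (lam (free_flow s z) * k s * exp (- Lam z s))) \<in> borel_measurable lborel"
      by measurable
    show "AE s in lborel. norm (indicator {0..t} s *\<^sub>R (lam (free_flow s z) * k s * exp (- Lam z s)))
        \<le> norm (indicator {0..t} s *\<^sub>R (lam (free_flow s z) * C * exp (- Lam z s)))"
      using C(1) by (intro AE_I2) (auto simp: abs_mult rate_nonneg intro!: mult_mono order_trans[OF C(1) abs_ge_self] split: split_indicator)
  qed
  have "((\<lambda>s. lam (free_flow s z) * c * exp (- Lam z s)) has_integral c * (1 - exp (- Lam z t))) {0..t}"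
    using has_integral_mult_right[OF has_integral_rate_exp_Lam[OF t, of z], of c] by (simp add: mult_ac)
  then have cint: "(LINT s:{0..t}|lborel. lam (free_flow s z) * c * exp (- Lam z s)) = c - c * exp (- Lam z t)"
    using set_borel_integral_eq_integral(2)[OF ic] by (simp add: integral_unique right_diff_distrib)
  \<comment> \<open>may fail at the single point \<open>e = L t\<close>, where the waiting time may exceed \<open>t\<close> or not\<close>
  have eq1: "exponential_density 1 e * (if ereal t < wait z e then c else k (real_of_ereal (wait z e)))
      = exponential_density 1 e * c + h e * indicator {L 0..L t} e" if "e \<noteq> L t" for e
  proof -
    consider "e < 0" | "0 \<le> e" "e < Lam z t" | "0 \<le> e" "Lam z t < e" using \<open>e \<noteq> L t\<close> L(2)[OF t] by linarith
    then show ?thesis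
    proof cases
      case 1
      then show ?thesis using L(2)[of 0] by (simp add: exponential_density_def)
    next
      case 2
      then have "\<not> ereal t < wait z e" using wait_le[OF t] by (simp add: not_less)
      with 2 show ?thesis using L(2)[of 0] L(2)[OF t]
        by (simp add: exponential_density_def h_def algebra_simps)
    next
      case 3
      then have "ereal t < wait z e" using Lam_ge_of_wait_le[OF t] by (meson not_less)
      with 3 show ?thesis using L(2)[of 0] L(2)[OF t] by (simp add: exponential_density_def)
    qed
  qed
  have hint': "integrable lborel (\<lambda>e. h e * indicator {L 0..L t} e)"
    using hint by (simp add: set_integrable_def mult.commute)
  have dint: "integrable lborel (\<lambda>e. exponential_density 1 e * c)"
      "(LBINT e. exponential_density 1 e * c) = c"
  proof -
    have "integrable std_exponential (\<lambda>_. c)" by simp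
    then show "integrable lborel (\<lambda>e. exponential_density 1 e * c)"
      unfolding std_exponential_def by (subst (asm) integrable_density) auto
    have "(\<integral>e. c \<partial>std_exponential) = (LBINT e. exponential_density 1 e * c)"
      unfolding std_exponential_def by (subst integral_density) auto
    then show "(LBINT e. exponential_density 1 e * c) = c"
      using E.prob_space by simp
  qed
  have "(\<integral>e. (if ereal t < wait z e then c else k (real_of_ereal (wait z e))) \<partial>std_exponential)
      = (LBINT e. exponential_density 1 e * (if ereal t < wait z e then c else k (real_of_ereal (wait z e))))"
    unfolding std_exponential_def by (subst integral_density) auto
  also have "\<dots> = (LBINT e. exponential_density 1 e * c + h e * indicator {L 0..L t} e)"
  proof (rule integral_cong_AE)
    show "AE e in lborel. exponential_density 1 e * (if ereal t < wait z e then c else k (real_of_ereal (wait z e)))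
        = exponential_density 1 e * c + h e * indicator {L 0..L t} e"
      using AE_lborel_singleton[of "L t"] by eventually_elim (rule eq1)
  qed measurable
  also have "\<dots> = c + (LBINT e. h e * indicator {L 0..L t} e)"
    using dint hint' by simp
  also have "(LBINT e. h e * indicator {L 0..L t} e)
      = (LINT s:{0..t}|lborel. lam (free_flow s z) * k s * exp (- Lam z s) - lam (free_flow s z) * c * exp (- Lam z s))"
    unfolding sub set_lebesgue_integral_def
  proof (rule Bochner_Integration.integral_cong[OF refl])
    fix s
    show "h (L s) * lam (free_flow s z) * indicator {0..t} s = indicator {0..t} s *\<^sub>R
        (lam (free_flow s z) * k s * exp (- Lam z s) - lam (free_flow s z) * c * exp (- Lam z s))"
    proof (cases "s \<in> {0..t} \<and> lam (free_flow s z) \<noteq> 0")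
      case True
      then have "wait z (L s) = ereal s" using wait_Lam[of s z] L(2) by simp
      with True show ?thesis using L(2) by (simp add: h_def algebra_simps)
    qed auto
  qed
  also have "\<dots> = (LINT s:{0..t}|lborel. lam (free_flow s z) * k s * exp (- Lam z s)) - (c - c * exp (- Lam z t))"
    by (simp add: set_integral_diff(2)[OF ik ic] cint)
  finally show ?thesis by simp
qed

text \<open>
  Either there is no jump up to time \<open>t\<close>, or the first jump is at time \<open>s\<close> and the process starts afresh from
  the position after it, with time \<open>t - s\<close> and one jump fewer.
\<close>

lemma trunc_Suc:
  assumes f: "f \<in> borel_measurable borel" and C: "\<And>z. \<bar>f z\<bar> \<le> C" and t: "0 \<le> t"
  shows "trunc (Suc n) f t z = f (free_flow t z) * exp (- Lam z t) +
    (LINT s:{0..t}|lborel. lam (free_flow s z) * Q (trunc n f (t - s)) (free_flow s z) * exp (- Lam z s))"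
proof -
  note [measurable] = f
  have C0: "0 \<le> C" using C[of 0] by linarith
  let ?K = "\<lambda>n t z \<omega>. if ereal t < fst (J z \<omega> n) then f (Z z \<omega> t) else 0"
  let ?T = "\<lambda>e. real_of_ereal (wait z e)"
  let ?G = "\<lambda>x. if ereal t < wait z (fst x) then f (free_flow t z)
    else trunc n f (t - ?T (fst x)) (refreshment_jump Orth (snd x) (free_flow (?T (fst x)) z))"
  have inner: "(\<integral>\<omega>. ?K (Suc n) t z (x ## \<omega>) \<partial>stream_space Mark) = ?G x" for x
  proof (cases "ereal t < wait z (fst x)")
    case True
    then show ?thesis using Z_Stream_before[OF t True] Str.prob_space by simp
  next
    case False
    then obtain T where T: "wait z (fst x) = ereal T" "T \<le> t"
      using wait_nonneg[of z "fst x"] by (cases "wait z (fst x)") auto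
    show ?thesis
      using False T Z_Stream_after[OF t T] unfolding trunc_def
      by (auto intro!: Bochner_Integration.integral_cong)
  qed
  have Gb: "\<bar>?G x\<bar> \<le> C" for x using C trunc_bound[OF f C] by auto
  have Gm: "?G \<in> borel_measurable Mark" by measurable
  have "trunc (Suc n) f t z = (\<integral>x. ?G x \<partial>Mark)"
    unfolding trunc_def[of "Suc n"] inner[symmetric]
    by (rule EX.integral_stream_space[of _ C]) (use C C0 in auto)
  also have "\<dots> = (\<integral>e. \<integral>\<xi>. ?G (e, \<xi>) \<partial>Xi \<partial>std_exponential)"
    by (rule EX.integral_fst'[symmetric]) (rule EX.P.integrable_const_bound[of _ C], use Gb Gm in auto)
  also have "\<dots> = (\<integral>e. (if ereal t < wait z e then f (free_flow t z)
      else Q (trunc n f (t - ?T e)) (free_flow (?T e) z)) \<partial>std_exponential)"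
    by (intro Bochner_Integration.integral_cong refl) (simp add: prob_space)
  also have "\<dots> = f (free_flow t z) * exp (- Lam z t) +
    (LINT s:{0..t}|lborel. lam (free_flow s z) * Q (trunc n f (t - s)) (free_flow s z) * exp (- Lam z s))"
  proof (rule integral_wait[where C=C and k="\<lambda>s. Q (trunc n f (t - s)) (free_flow s z)"])
    show "(\<lambda>s. Q (trunc n f (t - s)) (free_flow s z)) \<in> borel_measurable borel" by measurable
    fix s
    show "\<bar>Q (trunc n f (t - s)) (free_flow s z)\<bar> \<le> C"
      by (rule abs_expectation_le) (rule trunc_bound[OF f C])
  qed (use C t in auto)
  finally show ?thesis .
qed

lemma trunc_0: "0 \<le> t \<Longrightarrow> trunc 0 f t z = 0"
  by (simp add: trunc_def)

end

section \<open>Functions of compact support\<close>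

(* Splitting quantifiers over phase space into position and velocity only gets in the way below. *)
declare split_paired_All [simp del] split_paired_Ex [simp del]

lemma C_zeroI_compact_support:
  fixes f :: "'a::real_normed_vector \<Rightarrow> real"
  assumes "continuous_on UNIV f" "bounded K" "\<And>x. x \<notin> K \<Longrightarrow> f x = 0"
  shows "f \<in> C_zero"
proof -
  obtain B where B: "\<And>x. x \<in> K \<Longrightarrow> norm x \<le> B" using assms(2) by (auto simp: bounded_iff)
  have "f x = 0" if "B + 1 \<le> norm x" for x
    using B[of x] that by (intro assms(3)) auto
  then have "(f \<longlongrightarrow> 0) at_infinity"
    by (intro tendsto_eventually) (auto simp: eventually_at_infinity)
  with assms(1) show ?thesis by (simp add: C_zero_def)
qed

lemma C_zero_continuous: "f \<in> C_zero \<Longrightarrow> continuous_on A f"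
  by (auto simp: C_zero_def intro: continuous_on_subset)

lemma continuous_on_Pair_fixed:
  assumes "continuous_on UNIV (\<lambda>(x, y). g x y)"
  shows "continuous_on A (g x)"
  using continuous_on_compose2[OF assms, of A "\<lambda>y. (x, y)"]
  by (simp add: continuous_on_Pair continuous_on_const continuous_on_id)

lemma continuous_on_case_prod_compose:
  assumes "continuous_on UNIV (\<lambda>(x, y). g x y)" "continuous_on A a" "continuous_on A b"
  shows "continuous_on A (\<lambda>p. g (a p) (b p))"
  using continuous_on_compose2[OF assms(1), of A "\<lambda>p. (a p, b p)"] assms(2,3)
  by (simp add: continuous_on_Pair)

definition supported :: "real \<Rightarrow> real \<Rightarrow> ('a::real_normed_vector \<times> 'a \<Rightarrow> real) \<Rightarrow> bool" where
  "supported a b f \<longleftrightarrow> (\<forall>z. z \<notin> slab a b \<longrightarrow> f z = 0)"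

lemma C_zeroI_supported:
  fixes f :: "'a::euclidean_space \<times> 'a \<Rightarrow> real"
  assumes "continuous_on UNIV f" "supported a b f"
  shows "f \<in> C_zero"
  using assms compact_imp_bounded[OF compact_slab[of a b, where 'a='a]]
  by (intro C_zeroI_compact_support) (auto simp: supported_def)

lemma supported_free_flow:
  assumes "supported a b f" "0 \<le> a" "0 \<le> t" "b + t * a \<le> c" "z \<notin> slab a c"
  shows "f (free_flow t z) = 0"
  using assms free_flow_slab_reverse[of t z a b c] by (auto simp: supported_def)

lemma supported_mono: "supported a b f \<Longrightarrow> a \<le> a' \<Longrightarrow> b \<le> b' \<Longrightarrow> supported a' b' f"
  using slab_mono[of a a' b b'] by (auto simp: supported_def)

text \<open>
  Soft thresholding: subtracting from \<open>f\<close> its truncation to \<open>{- e..e}\<close> removes all small values.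
\<close>

lemma C_zero_approx_supported:
  fixes f :: "'a::euclidean_space \<times> 'a \<Rightarrow> real"
  assumes "f \<in> C_zero" "0 < e"
  obtains g a b where "continuous_on UNIV g" "0 \<le> a" "0 \<le> b" "supported a b g" "\<And>z. \<bar>f z - g z\<bar> \<le> e"
proof -
  have c: "continuous_on UNIV f" and l: "(f \<longlongrightarrow> 0) at_infinity"
    using assms(1) by (auto simp: C_zero_def)
  from tendstoD[OF l assms(2)] obtain r where r: "\<And>x. r \<le> norm x \<Longrightarrow> \<bar>f x\<bar> < e"
    by (auto simp: eventually_at_infinity dist_real_def)
  let ?g = "\<lambda>z. f z - max (- e) (min e (f z))"
  have "continuous_on UNIV ?g" by (intro continuous_intros c)
  moreover have "supported (max 0 r) (max 0 r) ?g"
  proof (unfold supported_def, intro allI impI)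
    fix z :: "'a \<times> 'a" assume "z \<notin> slab (max 0 r) (max 0 r)"
    then have "r \<le> norm z" using norm_fst_le[of "fst z" "snd z"] norm_snd_le[of "snd z" "fst z"] by (auto simp: slab_def)
    from r[OF this] show "?g z = 0" by auto
  qed
  moreover have "\<bar>f z - ?g z\<bar> \<le> e" for z using assms(2) by auto
  ultimately show ?thesis using that[of ?g "max 0 r" "max 0 r"] by auto
qed

lemma slab_cover: "z \<in> slab (norm z) (norm z)"
  using norm_fst_le[of "fst z" "snd z"] norm_snd_le[of "snd z" "fst z"] by (auto simp: slab_def)

lemma slab_nonneg: "z \<in> slab a b \<Longrightarrow> 0 \<le> a"
  by (auto simp: slab_def intro: order_trans[OF norm_ge_zero])

section \<open>Jumps do not accumulate\<close>

context isometric_refreshment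
begin

lemma lam_bounded_on_slab:
  obtains B where "0 \<le> B" "\<And>z. z \<in> slab a b \<Longrightarrow> lam z \<le> B"
proof -
  have "compact (lam ` slab a b)"
    by (intro compact_continuous_image compact_slab continuous_on_subset[OF rate_continuous]) auto
  then obtain B where "\<And>z. z \<in> slab a b \<Longrightarrow> \<bar>lam z\<bar> \<le> B"
    by (fastforce dest: compact_imp_bounded simp: bounded_iff)
  then show ?thesis by (intro that[of "max 0 B"]) fastforce+
qed

lemma jump_slab: "\<xi> \<in> space Xi \<Longrightarrow> refreshment_jump Orth \<xi> z \<in> slab a b \<longleftrightarrow> z \<in> slab a b"
  by (rule refreshment_jump_slab) (rule orthogonal)

text \<open>
  With an intensity of at most \<open>B\<close> on the set that is reached, a jump triggered by \<open>e\<close> takes at least the time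
  \<open>e / B\<close>.
\<close>

lemma jump_time_lower_bound:
  assumes B: "\<And>y. y \<in> slab a b \<Longrightarrow> lam y \<le> B"
    and "z \<in> slab a (b - t * a)" "0 \<le> t" "\<omega> \<in> space (stream_space Mark)" "fst (J z \<omega> n) \<le> ereal t"
  shows "(\<Sum>i<n. fst (\<omega> !! i)) \<le> B * t"
  using assms(2-)
proof (induction n arbitrary: z \<omega> t)
  case 0
  have a: "0 \<le> a" by (rule slab_nonneg[OF 0(1)])
  have "z \<in> slab a b" using 0(1,2) a slab_mono[of a a "b - t * a" b] by auto
  then have "0 \<le> B" using B rate_nonneg by (meson order_trans)
  with 0 show ?case by simp
next
  case (Suc n)
  have a: "0 \<le> a" by (rule slab_nonneg[OF Suc.prems(1)])
  obtain x \<omega>' where \<omega>: "\<omega> = x ## \<omega>'" by (cases \<omega>)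
  have mem: "x \<in> space Mark" "\<omega>' \<in> space (stream_space Mark)"
    using Suc.prems(3) by (auto simp: \<omega> space_stream_space streams_Stream)
  obtain T where T: "wait z (fst x) = ereal T" "0 \<le> T"
    using Suc.prems(4) J_Stream(1)[of z x \<omega>' n] wait_nonneg[of z "fst x"]
    by (cases "wait z (fst x)") (auto simp: \<omega>)
  define y where "y = refreshment_jump Orth (snd x) (free_flow T z)"
  have le: "ereal T + fst (J y \<omega>' n) \<le> ereal t"
    using Suc.prems(4) J_Stream(2)[OF T(1), of \<omega>' n] by (simp add: \<omega> y_def Let_def)
  then have J: "fst (J y \<omega>' n) \<le> ereal (t - T)" and Tt: "T \<le> t"
    using J_nonneg[of y \<omega>' n] by (cases "fst (J y \<omega>' n)"; auto)+
  have fl: "free_flow s z \<in> slab a (b - (t - s) * a)" if "0 \<le> s" for s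
    using Suc.prems(1) by (rule free_flow_slab) (use that in \<open>auto simp: algebra_simps\<close>)
  have "snd x \<in> space Xi" using mem(1) by (auto simp: space_pair_measure)
  then have "y \<in> slab a (b - (t - T) * a)"
    unfolding y_def by (simp add: jump_slab fl T(2))
  then have IH: "(\<Sum>i<n. fst (\<omega>' !! i)) \<le> B * (t - T)"
    by (rule Suc.IH) (use Tt mem J in auto)
  have "fst x \<le> Lam z T" by (rule Lam_ge_of_wait_le[OF T(2)]) (simp add: T(1))
  also have "\<dots> \<le> B * T"
  proof (rule Lam_bound[OF _ T(2)])
    fix s assume s: "0 \<le> s" "s \<le> T"
    have "slab a (b - (t - s) * a) \<subseteq> slab a b"
      using a s Tt by (intro slab_mono) auto
    then show "lam (free_flow s z) \<le> B" using fl[OF s(1)] by (intro B) auto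
  qed
  finally show ?case
    using IH unfolding \<omega> sum.lessThan_Suc_shift by (simp add: algebra_simps)
qed

lemma nn_integral_exp_minus_sum:
  "(\<integral>\<^sup>+\<omega>. ennreal (exp (- (\<Sum>i<n. fst (\<omega> !! i)))) \<partial>stream_space Mark) = ennreal ((1 / 2) ^ n)"
proof (induction n)
  case 0
  show ?case using Str.emeasure_space_1 by simp
next
  case (Suc n)
  have "(\<integral>\<^sup>+\<omega>. ennreal (exp (- (\<Sum>i<Suc n. fst (\<omega> !! i)))) \<partial>stream_space Mark)
      = (\<integral>\<^sup>+x. \<integral>\<^sup>+\<omega>. ennreal (exp (- (\<Sum>i<Suc n. fst ((x ## \<omega>) !! i)))) \<partial>stream_space Mark \<partial>Mark)"
    by (rule EX.nn_integral_stream_space) measurable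
  also have "\<dots> = (\<integral>\<^sup>+x. ennreal (exp (- fst x)) * ennreal ((1 / 2) ^ n) \<partial>Mark)"
  proof (rule nn_integral_cong)
    fix x :: "real \<times> 's"
    have "(\<integral>\<^sup>+\<omega>. ennreal (exp (- (\<Sum>i<Suc n. fst ((x ## \<omega>) !! i)))) \<partial>stream_space Mark)
        = (\<integral>\<^sup>+\<omega>. ennreal (exp (- fst x)) * ennreal (exp (- (\<Sum>i<n. fst (\<omega> !! i)))) \<partial>stream_space Mark)"
      by (intro nn_integral_cong)
         (simp add: sum.lessThan_Suc_shift ennreal_mult'[symmetric] exp_add[symmetric] del: sum.lessThan_Suc)
    also have "\<dots> = ennreal (exp (- fst x)) * ennreal ((1 / 2) ^ n)"
      by (subst nn_integral_cmult, measurable) (simp only: Suc.IH)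
    finally show "(\<integral>\<^sup>+\<omega>. ennreal (exp (- (\<Sum>i<Suc n. fst ((x ## \<omega>) !! i)))) \<partial>stream_space Mark)
        = ennreal (exp (- fst x)) * ennreal ((1 / 2) ^ n)" .
  qed
  also have "\<dots> = (\<integral>\<^sup>+x. ennreal (exp (- fst x)) \<partial>Mark) * ennreal ((1 / 2) ^ n)"
    by (rule nn_integral_multc) measurable
  also have "(\<integral>\<^sup>+x. ennreal (exp (- fst x)) \<partial>Mark)
      = (\<integral>\<^sup>+e. \<integral>\<^sup>+\<xi>. ennreal (exp (- fst (e, \<xi>))) \<partial>Xi \<partial>std_exponential)"
    by (rule nn_integral_fst[symmetric]) measurable
  also have "\<dots> = ennreal (1 / 2)"
    using nn_integral_std_exponential_exp_minus by (simp add: emeasure_space_1)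
  finally show ?case by (simp add: ennreal_mult'[symmetric] del: ennreal_half)
qed

text \<open>
  Markov's inequality for \<open>exp (- (e\<^sub>1 + \<dots> + e\<^sub>n))\<close>, whose expectation is \<open>2\<^sup>-\<^sup>n\<close>.
\<close>

lemma prob_jump_time_le:
  assumes B: "\<And>y. y \<in> slab a b \<Longrightarrow> lam y \<le> B" and z: "z \<in> slab a (b - t * a)" and t: "0 \<le> t"
  shows "Str.prob {\<omega> \<in> space (stream_space Mark). fst (J z \<omega> n) \<le> ereal t} \<le> exp (B * t) * (1 / 2) ^ n"
proof -
  let ?A = "{\<omega> \<in> space (stream_space Mark). fst (J z \<omega> n) \<le> ereal t}"
  have A: "?A \<in> sets (stream_space Mark)" by measurable
  have "ennreal (Str.prob ?A) = (\<integral>\<^sup>+\<omega>. indicator ?A \<omega> \<partial>stream_space Mark)"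
    using A by (simp add: Str.emeasure_eq_measure)
  also have "\<dots> \<le> (\<integral>\<^sup>+\<omega>. ennreal (exp (B * t)) * ennreal (exp (- (\<Sum>i<n. fst (\<omega> !! i)))) \<partial>stream_space Mark)"
  proof (rule nn_integral_mono)
    fix \<omega> assume "\<omega> \<in> space (stream_space Mark)"
    then have "1 \<le> exp (B * t) * exp (- (\<Sum>i<n. fst (\<omega> !! i)))" if "\<omega> \<in> ?A"
      using jump_time_lower_bound[OF B z t] that by (simp add: exp_add[symmetric])
    then show "indicator ?A \<omega> \<le> ennreal (exp (B * t)) * ennreal (exp (- (\<Sum>i<n. fst (\<omega> !! i))))"
      by (auto simp: ennreal_mult'[symmetric] split: split_indicator)
  qed
  also have "\<dots> = ennreal (exp (B * t)) * ennreal ((1 / 2) ^ n)"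
    by (subst nn_integral_cmult, measurable) (simp only: nn_integral_exp_minus_sum)
  also have "\<dots> = ennreal (exp (B * t) * (1 / 2) ^ n)"
    by (simp only: ennreal_mult' exp_ge_zero)
  finally show ?thesis by (subst (asm) ennreal_le_iff) auto
qed

end

section \<open>Continuity of the semigroup and its Duhamel formula\<close>

context isometric_refreshment
begin

text \<open>
  The semigroup, continued constantly to negative times, so that continuity in time and position can be
  stated on the whole space.
\<close>

definition evolve :: "((real^'d) \<times> (real^'d) \<Rightarrow> real) \<Rightarrow> real \<Rightarrow> (real^'d) \<times> (real^'d) \<Rightarrow> real" where
  "evolve f t z = refreshment_semigroup Xi lam Orth (max 0 t) f z"

lemma evolve_eq: "evolve f t z = (\<integral>\<omega>. f (Z z \<omega> (max 0 t)) \<partial>stream_space Mark)"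
  by (simp add: evolve_def refreshment_semigroup_def pdmp_semigroup_def)

lemma evolve_bound: "(\<And>z. \<bar>f z\<bar> \<le> C) \<Longrightarrow> \<bar>evolve f t z\<bar> \<le> C"
  unfolding evolve_eq by (rule Str.abs_expectation_le)

lemma evolve_integrable:
  fixes f :: "(real^'d) \<times> (real^'d) \<Rightarrow> real"
  assumes "f \<in> borel_measurable borel" "\<And>z. \<bar>f z\<bar> \<le> C"
  shows "integrable (stream_space Mark) (\<lambda>\<omega>. f (Z z \<omega> t))"
proof -
  note [measurable] = assms(1)
  show ?thesis by (rule Str.integrable_const_bound[of _ C]) (simp_all add: assms(2))
qed

lemma evolve_diff_bound:
  assumes f: "f \<in> C_zero" and g: "g \<in> C_zero" and e: "\<And>z. \<bar>f z - g z\<bar> \<le> e"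
  shows "\<bar>evolve f t z - evolve g t z\<bar> \<le> e"
proof -
  obtain C where C: "\<And>z. \<bar>f z\<bar> \<le> C" using C_zero_bounded[OF f] by blast
  obtain C' where C': "\<And>z. \<bar>g z\<bar> \<le> C'" using C_zero_bounded[OF g] by blast
  have m: "f \<in> borel_measurable borel" "g \<in> borel_measurable borel"
    using f g by (auto intro: borel_measurable_continuous_onI C_zero_continuous)
  have "evolve f t z - evolve g t z = (\<integral>\<omega>. f (Z z \<omega> (max 0 t)) - g (Z z \<omega> (max 0 t)) \<partial>stream_space Mark)"
    unfolding evolve_eq
    by (rule Bochner_Integration.integral_diff[symmetric]) (auto intro!: evolve_integrable m C C')
  also have "\<bar>\<dots>\<bar> \<le> e" by (rule Str.abs_expectation_le) (rule e)
  finally show ?thesis .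
qed

text \<open>
  The two sides differ only on the paths with at least \<open>n\<close> jumps up to time \<open>t\<close>.
\<close>

lemma evolve_trunc_bound:
  assumes f: "f \<in> borel_measurable borel" and C: "\<And>z. \<bar>f z\<bar> \<le> C"
    and B: "\<And>y. y \<in> slab a b \<Longrightarrow> lam y \<le> B" and z: "z \<in> slab a (b - t * a)" and t: "0 \<le> t"
  shows "\<bar>evolve f t z - trunc n f t z\<bar> \<le> C * exp (B * t) * (1 / 2) ^ n"
proof -
  note [measurable] = f
  have C0: "0 \<le> C" using C[of 0] by linarith
  let ?A = "{\<omega> \<in> space (stream_space Mark). fst (J z \<omega> n) \<le> ereal t}"
  have A[measurable]: "?A \<in> sets (stream_space Mark)" by measurable
  have "evolve f t z - trunc n f t z
      = (\<integral>\<omega>. f (Z z \<omega> t) - (if ereal t < fst (J z \<omega> n) then f (Z z \<omega> t) else 0) \<partial>stream_space Mark)"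
    unfolding evolve_eq trunc_def using t
    by (subst Bochner_Integration.integral_diff)
       (simp_all add: max_def evolve_integrable[OF f C] Str.integrable_const_bound[of _ C] C C0)
  also have "\<dots> = (\<integral>\<omega>. indicator ?A \<omega> * f (Z z \<omega> t) \<partial>stream_space Mark)"
    by (rule Bochner_Integration.integral_cong) (auto simp: indicator_def)
  also have "\<bar>\<dots>\<bar> \<le> C * Str.prob ?A"
    by (rule Str.abs_expectation_le_prob[OF A C0]) (simp add: C indicator_def)
  also have "\<dots> \<le> C * (exp (B * t) * (1 / 2) ^ n)"
    by (intro mult_left_mono prob_jump_time_le[OF B z t] C0)
  finally show ?thesis by (simp add: mult.assoc)
qed

lemma Q_integrable:
  fixes f :: "(real^'d) \<times> (real^'d) \<Rightarrow> real"
  assumes f: "continuous_on UNIV f"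
  shows "integrable Xi (\<lambda>\<xi>. f (refreshment_jump Orth \<xi> z))"
proof -
  have [measurable]: "f \<in> borel_measurable borel" by (rule borel_measurable_continuous_onI[OF f])
  have "compact (f ` slab (norm z) (norm z))"
    by (intro compact_continuous_image compact_slab continuous_on_subset[OF f]) auto
  then obtain B where "\<And>y. y \<in> slab (norm z) (norm z) \<Longrightarrow> \<bar>f y\<bar> \<le> B"
    by (fastforce dest: compact_imp_bounded simp: bounded_iff)
  then show ?thesis
    by (intro integrable_const_bound[of _ B]) (auto simp: jump_slab slab_cover)
qed

lemma Q_bound_on_slab:
  fixes f :: "(real^'d) \<times> (real^'d) \<Rightarrow> real"
  assumes "z \<in> slab a b" "\<And>y. y \<in> slab a b \<Longrightarrow> \<bar>f y\<bar> \<le> e"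
  shows "\<bar>Q f z\<bar> \<le> e"
  by (rule abs_expectation_le) (use assms in \<open>simp add: jump_slab\<close>)

lemma Q_diff:
  fixes f :: "(real^'d) \<times> (real^'d) \<Rightarrow> real"
  assumes "continuous_on UNIV f" "continuous_on UNIV g"
  shows "Q f z - Q g z = Q (\<lambda>y. f y - g y) z"
  using assms by (simp add: Q_integrable)

text \<open>
  The gain part \<open>\<lambda> Q f\<close> of the generator.
\<close>

definition jump_rate :: "((real^'d) \<times> (real^'d) \<Rightarrow> real) \<Rightarrow> (real^'d) \<times> (real^'d) \<Rightarrow> real" where
  "jump_rate f z = lam z * Q f z"

lemma supported_jump_rate: "supported a b f \<Longrightarrow> supported a b (jump_rate f)"
  unfolding supported_def jump_rate_def
proof (intro allI impI)
  fix z :: "(real^'d) \<times> (real^'d)"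
  assume "\<forall>z. z \<notin> slab a b \<longrightarrow> f z = 0" "z \<notin> slab a b"
  then have "Q f z = Q (\<lambda>_. 0) z"
    by (intro Bochner_Integration.integral_cong refl) (metis jump_slab)
  then show "lam z * Q f z = 0" by simp
qed

text \<open>
  The value at \<open>z\<close> depends on \<open>f\<close> only on the sphere of velocities of the same speed.  Hence \<open>f\<close> may be
  multiplied by a cutoff, after which the continuity hypothesis on the jumps applies.
\<close>

lemma isCont_jump_rate:
  assumes f: "continuous_on UNIV f"
  shows "isCont (jump_rate f) z0"
proof -
  obtain r where r: "\<And>z. z \<in> slab (norm z0 + 1) (norm z0 + 1) \<Longrightarrow> norm (z :: (real^'d) \<times> (real^'d)) \<le> r"
    using compact_imp_bounded[OF compact_slab] by (metis bounded_iff)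
  \<comment> \<open>equal to \<open>f\<close> on the slab around \<open>z0\<close>, and zero outside a ball\<close>
  let ?f = "\<lambda>z. f z * max 0 (min 1 (r + 1 - norm z))"
  have fc: "continuous_on UNIV ?f" by (intro continuous_intros f)
  have "?f \<in> C_zero"
    by (rule C_zeroI_compact_support[OF fc bounded_cball[of 0 "r + 1"]]) auto
  then have "continuous_on UNIV (jump_rate ?f)"
    using jump_rate_continuous[of ?f] by (simp add: jump_rate_def[abs_def])
  then have "isCont (jump_rate ?f) z0" by (simp add: continuous_on_eq_continuous_at)
  moreover have "\<forall>\<^sub>F z in nhds z0. jump_rate ?f z = jump_rate f z"
  proof (rule eventually_nhds_in_open[of "ball z0 1", THEN eventually_mono])
    fix z assume "z \<in> ball z0 1"
    then have "norm z \<le> norm z0 + 1"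
      using norm_triangle_sub[of z z0] by (simp add: dist_norm norm_minus_commute)
    then have z: "z \<in> slab (norm z0 + 1) (norm z0 + 1)"
      using slab_cover[of z] slab_mono[of "norm z" "norm z0 + 1"] by blast
    have "Q ?f z = Q f z"
      by (rule Bochner_Integration.integral_cong[OF refl]) (use r z in \<open>fastforce simp: jump_slab\<close>)
    then show "jump_rate ?f z = jump_rate f z" by (simp add: jump_rate_def)
  qed auto
  ultimately show ?thesis by (simp add: isCont_cong)
qed

text \<open>
  Continuity in \<open>z\<close> for fixed \<open>x\<close> is \<open>isCont_jump_rate\<close>; the dependence on \<open>x\<close> is uniform over compact sets of
  phase space, and jumps leave each \<^const>\<open>slab\<close> invariant.
\<close>

lemma continuous_jump_rate:
  fixes g :: "'b::t2_space \<Rightarrow> (real^'d) \<times> (real^'d) \<Rightarrow> real"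
  assumes g: "continuous_on UNIV (\<lambda>(x, z). g x z)"
  shows "continuous_on UNIV (\<lambda>(x, z). jump_rate (g x) z)"
proof -
  have "isCont (\<lambda>(x, z). jump_rate (g x) z) (x0, z0)" for x0 z0
    unfolding isCont_def
  proof (rule tendstoI)
    fix e :: real assume e: "0 < e"
    let ?K = "slab (norm z0 + 1) (norm z0 + 1) :: ((real^'d) \<times> (real^'d)) set"
    have gx: "continuous_on UNIV (g x)" for x by (rule continuous_on_Pair_fixed[OF g])
    obtain B where B: "0 \<le> B" "\<And>z. z \<in> ?K \<Longrightarrow> lam z \<le> B" by (rule lam_bounded_on_slab) blast
    define d where "d = e / (2 * (B + 1))"
    have d: "0 < d" using e B by (simp add: d_def)
    obtain X where X: "x0 \<in> X" "open X" "\<forall>x\<in>X \<inter> UNIV. \<forall>z\<in>?K. dist (case (x, z) of (x, z) \<Rightarrow> g x z) (case (x0, z) of (x, z) \<Rightarrow> g x z) \<le> d"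
      by (rule continuous_on_prod_compactE[OF continuous_on_subset[OF g subset_UNIV] compact_slab UNIV_I d]) blast
    have "(jump_rate (g x0) \<longlongrightarrow> jump_rate (g x0) z0) (nhds z0)"
      using isCont_jump_rate[OF gx[of x0], of z0] by (simp add: continuous_at tendsto_nhds_iff)
    from tendstoD[OF this, of "e / 2"] e
    obtain V where V: "open V" "z0 \<in> V" "\<And>z. z \<in> V \<Longrightarrow> dist (jump_rate (g x0) z) (jump_rate (g x0) z0) < e / 2"
      by (auto simp: eventually_nhds)
    have "\<forall>\<^sub>F p in nhds (x0, z0). p \<in> X \<times> (V \<inter> ball z0 1)"
      by (rule eventually_nhds_in_open) (use X V in \<open>auto intro!: open_Times open_Int\<close>)
    then have "\<forall>\<^sub>F p in nhds (x0, z0). dist (case p of (x, z) \<Rightarrow> jump_rate (g x) z) (jump_rate (g x0) z0) < e"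
    proof eventually_elim
      case (elim p)
      obtain x z where p: "p = (x, z)" by (cases p)
      have z: "x \<in> X" "z \<in> V" "z \<in> ball z0 1" using elim p by auto
      then have "norm z \<le> norm z0 + 1"
        using norm_triangle_sub[of z z0] by (simp add: dist_norm norm_minus_commute)
      then have zK: "z \<in> ?K"
        using slab_cover[of z] slab_mono[of "norm z" "norm z0 + 1"] by blast
      have "\<bar>Q (g x) z - Q (g x0) z\<bar> \<le> d"
        unfolding Q_diff[OF gx gx]
        by (rule Q_bound_on_slab[OF zK]) (use X(3) z(1) in \<open>auto simp: dist_real_def\<close>)
      then have "lam z * \<bar>Q (g x) z - Q (g x0) z\<bar> \<le> B * d"
        using B zK d by (intro mult_mono) auto
      also have "\<dots> < e / 2" using B e by (simp add: d_def field_simps)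
      finally have "\<bar>jump_rate (g x) z - jump_rate (g x0) z\<bar> < e / 2"
        by (simp add: jump_rate_def right_diff_distrib[symmetric] abs_mult rate_nonneg)
      with V(3)[OF z(2)] show ?case unfolding p dist_real_def split_conv by linarith
    qed
    then show "\<forall>\<^sub>F p in at (x0, z0). dist (case p of (x, z) \<Rightarrow> jump_rate (g x) z)
        (case (x0, z0) of (x, z) \<Rightarrow> jump_rate (g x) z) < e"
      by (simp add: eventually_at_filter eventually_mono)
  qed
  then show ?thesis by (simp add: continuous_on_eq_continuous_at split_paired_All)
qed

lemma trunc_duhamel:
  assumes f: "continuous_on UNIV f" "\<And>z. \<bar>f z\<bar> \<le> C"
    and U: "continuous_on UNIV (\<lambda>(t, z). trunc n f (max 0 t) z)" and t: "0 \<le> t"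
  shows "trunc (Suc n) f t z = f (free_flow t z) * exp (- Lam z t) +
    integral {0..t} (\<lambda>s. jump_rate (trunc n f (max 0 (t - s))) (free_flow s z) * exp (- Lam z s))"
proof -
  have "continuous_on UNIV (\<lambda>s. jump_rate (trunc n f (max 0 (t - s))) (free_flow s z) * exp (- Lam z s))"
    by (intro continuous_intros continuous_on_case_prod_compose[OF continuous_jump_rate[OF U]])
  then have "set_integrable lborel {0..t} (\<lambda>s. jump_rate (trunc n f (max 0 (t - s))) (free_flow s z) * exp (- Lam z s))"
    by (intro borel_integrable_atLeastAtMost') (auto intro: continuous_on_subset)
  note int = set_borel_integral_eq_integral(2)[OF this]
  have "integral {0..t} (\<lambda>s. jump_rate (trunc n f (max 0 (t - s))) (free_flow s z) * exp (- Lam z s))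
     = (LINT s:{0..t}|lborel. lam (free_flow s z) * Q (trunc n f (t - s)) (free_flow s z) * exp (- Lam z s))"
    unfolding int[symmetric] by (rule set_lebesgue_integral_cong) (auto simp: jump_rate_def)
  then show ?thesis
    using trunc_Suc[of f C t n z] f t borel_measurable_continuous_onI[OF f(1)] by simp
qed

text \<open>
  Each step of the Picard iteration integrates a function that is jointly continuous by the previous step.
\<close>

lemma continuous_trunc:
  assumes f: "continuous_on UNIV f" "\<And>z. \<bar>f z\<bar> \<le> C"
  shows "continuous_on UNIV (\<lambda>(t, z). trunc n f (max 0 t) z)"
proof (induction n)
  case 0
  have "trunc 0 f (max 0 t) z = 0" for t z by (rule trunc_0) simp
  then show ?case by simp
next
  case (Suc n)
  have c: "continuous_on UNIV (\<lambda>p. integral {0..max 0 (fst p)} (\<lambda>s. jump_rate (trunc n f (max 0 (max 0 (fst p) - s)))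
      (free_flow s (snd p)) * exp (- Lam (snd p) s)))"
    by (rule continuous_on_integral_upper)
       (auto simp: split_beta intro!: continuous_intros continuous_on_case_prod_compose[OF continuous_jump_rate[OF Suc]])
  have c': "continuous_on UNIV (\<lambda>p. f (free_flow (max 0 (fst p)) (snd p)) * exp (- Lam (snd p) (max 0 (fst p))))"
    by (intro continuous_on_mult continuous_on_compose2[OF f(1)] continuous_intros) auto
  have "trunc (Suc n) f (max 0 (fst p)) (snd p)
      = f (free_flow (max 0 (fst p)) (snd p)) * exp (- Lam (snd p) (max 0 (fst p))) +
        integral {0..max 0 (fst p)} (\<lambda>s. jump_rate (trunc n f (max 0 (max 0 (fst p) - s)))
          (free_flow s (snd p)) * exp (- Lam (snd p) s))" for p
    by (rule trunc_duhamel[OF f Suc]) simp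
  then show ?case
    using continuous_on_add[OF c' c] by (simp only: split_beta)
qed

text \<open>
  Locally uniform limit of the continuous functions \<^const>\<open>trunc\<close>.
\<close>

lemma continuous_evolve:
  assumes f: "f \<in> C_zero"
  shows "continuous_on UNIV (\<lambda>(t, z). evolve f t z)"
proof -
  obtain C where C: "\<And>z. \<bar>f z\<bar> \<le> C" using C_zero_bounded[OF f] by blast
  have C0: "0 \<le> C" using C[of 0] by linarith
  note fc = C_zero_continuous[OF f, of UNIV]
  note fm = borel_measurable_continuous_onI[OF fc]
  have "isCont (\<lambda>(t, z). evolve f t z) (t0, z0)" for t0 z0
  proof -
    \<comment> \<open>The processes started in the ball of radius \<open>r\<close> stay in \<open>slab r (r + T * r)\<close> up to time \<open>T\<close>.\<close>
    define T r where "T = max 0 t0 + 1" and "r = norm z0 + 1"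
    let ?V = "{..<T} \<times> (ball 0 r :: ((real^'d) \<times> (real^'d)) set)"
    obtain B where B: "0 \<le> B" "\<And>z. z \<in> slab r (r + T * r) \<Longrightarrow> lam z \<le> B" by (rule lam_bounded_on_slab) blast
    have bound: "\<bar>evolve f t z - trunc n f (max 0 t) z\<bar> \<le> C * exp (B * T) * (1 / 2) ^ n"
      if "(t, z) \<in> ?V" for t z n
    proof -
      have r: "0 \<le> r" "0 \<le> T" by (auto simp: r_def T_def)
      have tT: "max 0 t \<le> T" using that by (auto simp: T_def)
      have "max 0 t * r \<le> T * r" using tT r by (intro mult_right_mono)
      then have "z \<in> slab r (r + T * r - max 0 t * r)"
        using slab_cover[of z] slab_mono[of "norm z" r "norm z" "r + T * r - max 0 t * r"] that by auto
      from evolve_trunc_bound[OF fm C B(2) this max.cobounded1]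
      have "\<bar>evolve f t z - trunc n f (max 0 t) z\<bar> \<le> C * exp (B * max 0 t) * (1 / 2) ^ n"
        by (simp add: evolve_def)
      also have "\<dots> \<le> C * exp (B * T) * (1 / 2) ^ n"
        using tT B C0 by (intro mult_right_mono mult_left_mono) (auto intro: mult_left_mono)
      finally show ?thesis .
    qed
    have "uniform_limit ?V (\<lambda>n (t, z). trunc n f (max 0 t) z) (\<lambda>(t, z). evolve f t z) sequentially"
    proof (rule uniform_limitI)
      fix e :: real assume "0 < e"
      have "(\<lambda>n. C * exp (B * T) * (1 / 2) ^ n) \<longlonglongrightarrow> C * exp (B * T) * 0"
        by (intro tendsto_mult_left LIMSEQ_power_zero) auto
      from order_tendstoD(2)[OF this, of e] \<open>0 < e\<close>
      have "\<forall>\<^sub>F n in sequentially. C * exp (B * T) * (1 / 2) ^ n < e" by simp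
      then show "\<forall>\<^sub>F n in sequentially. \<forall>p\<in>?V. dist (case p of (t, z) \<Rightarrow> trunc n f (max 0 t) z)
          (case p of (t, z) \<Rightarrow> evolve f t z) < e"
      proof eventually_elim
        case (elim n)
        show ?case
        proof
          fix p assume p: "p \<in> ?V"
          obtain t z where tz: "p = (t, z)" by (cases p)
          with bound[of t z n] p elim
          show "dist (case p of (t, z) \<Rightarrow> trunc n f (max 0 t) z) (case p of (t, z) \<Rightarrow> evolve f t z) < e"
            by (simp add: dist_real_def abs_minus_commute)
        qed
      qed
    qed
    then have "continuous_on ?V (\<lambda>(t, z). evolve f t z)"
      by (rule uniform_limit_theorem[rotated])
         (auto intro!: always_eventually continuous_on_subset[OF continuous_trunc[OF fc C]])
    moreover have "open ?V" "(t0, z0) \<in> ?V"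
      by (auto intro: open_Times simp: T_def r_def)
    ultimately show ?thesis by (simp add: continuous_on_eq_continuous_at)
  qed
  then show ?thesis by (simp add: continuous_on_eq_continuous_at split_paired_All)
qed

lemma continuous_jump_rate_evolve:
  "f \<in> C_zero \<Longrightarrow> continuous_on UNIV (\<lambda>(t, z). jump_rate (evolve f t) z)"
  by (intro continuous_jump_rate continuous_evolve)

lemma trunc_tendsto_evolve:
  assumes f: "f \<in> C_zero" and t: "0 \<le> t"
  shows "(\<lambda>n. trunc n f t z) \<longlonglongrightarrow> evolve f t z"
proof -
  obtain C where C: "\<And>z. \<bar>f z\<bar> \<le> C" using C_zero_bounded[OF f] by blast
  note fm = borel_measurable_continuous_onI[OF C_zero_continuous[OF f, of UNIV]]
  define b where "b = norm z + t * norm z"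
  obtain B where B: "0 \<le> B" "\<And>z'. z' \<in> slab (norm z) b \<Longrightarrow> lam z' \<le> B" by (rule lam_bounded_on_slab) blast
  have "z \<in> slab (norm z) (b - t * norm z)" by (simp add: b_def slab_cover)
  note le = evolve_trunc_bound[OF fm C B(2) this t]
  have l: "(\<lambda>n. C * exp (B * t) * (1 / 2) ^ n) \<longlonglongrightarrow> 0"
    by (intro tendsto_mult_right_zero LIMSEQ_power_zero) simp
  have "(\<lambda>n. evolve f t z - trunc n f t z) \<longlonglongrightarrow> 0"
    by (rule Lim_null_comparison[OF always_eventually l]) (simp only: real_norm_def le simp_thms)
  from tendsto_diff[OF tendsto_const[of "evolve f t z"] this]
  show ?thesis by (simp only: diff_diff_eq2 add_diff_cancel_left' diff_0_right)
qed

text \<open>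
  Limit of \<open>trunc_duhamel\<close>; on the bounded set that is reached up to time \<open>t\<close>, the integrands converge uniformly.
\<close>

lemma evolve_duhamel:
  assumes f: "f \<in> C_zero" and t: "0 \<le> t"
  shows "evolve f t z = f (free_flow t z) * exp (- Lam z t) +
    integral {0..t} (\<lambda>s. jump_rate (evolve f (t - s)) (free_flow s z) * exp (- Lam z s))"
proof -
  obtain C where C: "\<And>z. \<bar>f z\<bar> \<le> C" using C_zero_bounded[OF f] by blast
  have C0: "0 \<le> C" using C[of 0] by linarith
  note fc = C_zero_continuous[OF f, of UNIV]
  note fm = borel_measurable_continuous_onI[OF fc]
  note ct = continuous_trunc[OF fc C] and ce = continuous_evolve[OF f]
  define a b where "a = norm z" and "b = norm z + t * norm z"
  obtain B where B: "0 \<le> B" "\<And>z'. z' \<in> slab a b \<Longrightarrow> lam z' \<le> B" by (rule lam_bounded_on_slab) blast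
  let ?g = "\<lambda>n s. jump_rate (trunc n f (max 0 (t - s))) (free_flow s z) * exp (- Lam z s)"
  let ?h = "\<lambda>s. jump_rate (evolve f (t - s)) (free_flow s z) * exp (- Lam z s)"
  have int_g: "?g n integrable_on {0..t}" for n
    by (intro integrable_continuous_real continuous_intros
        continuous_on_case_prod_compose[OF continuous_jump_rate[OF ct[of n]]])
  have int_h: "?h integrable_on {0..t}"
    by (intro integrable_continuous_real continuous_intros
        continuous_on_case_prod_compose[OF continuous_jump_rate[OF ce]])
  have diff: "\<bar>?h s - ?g n s\<bar> \<le> B * (C * exp (B * t) * (1 / 2) ^ n)" if s: "s \<in> {0..t}" for n s
  proof -
    have fl: "free_flow s z \<in> slab a (b - (t - s) * a)"
      by (rule free_flow_slab[OF slab_cover[of z, folded a_def]])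
         (use s in \<open>auto simp: a_def b_def algebra_simps\<close>)
    have "(t - s) * a \<ge> 0" using s by (simp add: a_def)
    then have lB: "lam (free_flow s z) \<le> B"
      using fl slab_mono[of a a "b - (t - s) * a" b] by (intro B) auto
    have "\<bar>Q (evolve f (t - s)) (free_flow s z) - Q (trunc n f (t - s)) (free_flow s z)\<bar> \<le> C * exp (B * (t - s)) * (1 / 2) ^ n"
    proof -
      have "continuous_on UNIV (trunc n f (t - s))"
        using continuous_on_Pair_fixed[OF ct[of n], of UNIV "t - s"] s by simp
      then show ?thesis
        unfolding Q_diff[OF continuous_on_Pair_fixed[OF ce] \<open>continuous_on UNIV (trunc n f (t - s))\<close>]
        by (intro Q_bound_on_slab[OF fl] evolve_trunc_bound[OF fm C B(2)]) (use s in auto)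
    qed
    also have "\<dots> \<le> C * exp (B * t) * (1 / 2) ^ n"
      using s B C0 by (intro mult_right_mono mult_left_mono) (auto intro: mult_left_mono)
    finally have q: "\<bar>Q (evolve f (t - s)) (free_flow s z) - Q (trunc n f (t - s)) (free_flow s z)\<bar> \<le> C * exp (B * t) * (1 / 2) ^ n" .
    have "\<bar>?h s - ?g n s\<bar> = lam (free_flow s z) *
        \<bar>Q (evolve f (t - s)) (free_flow s z) - Q (trunc n f (t - s)) (free_flow s z)\<bar> * exp (- Lam z s)"
    proof -
      have "?h s - ?g n s = lam (free_flow s z) *
        (Q (evolve f (t - s)) (free_flow s z) - Q (trunc n f (t - s)) (free_flow s z)) * exp (- Lam z s)"
        using s by (simp add: jump_rate_def algebra_simps)
      then show ?thesis by (simp only: abs_mult) (simp add: rate_nonneg)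
    qed
    also have "\<dots> \<le> B * (C * exp (B * t) * (1 / 2) ^ n) * 1"
      by (intro mult_mono lB q) (use B C0 Lam_nonneg in auto)
    finally show ?thesis by simp
  qed
  have "\<bar>integral {0..t} ?h - integral {0..t} (?g n)\<bar> \<le> t * (B * (C * exp (B * t) * (1 / 2) ^ n))" for n
  proof -
    have "norm (integral {0..t} (\<lambda>s. ?h s - ?g n s)) \<le> integral {0..t} (\<lambda>_. B * (C * exp (B * t) * (1 / 2) ^ n))"
      by (intro integral_norm_bound_integral integrable_diff int_g int_h) (use diff in auto)
    then show ?thesis using t int_g int_h by (simp add: Henstock_Kurzweil_Integration.integral_diff mult_ac)
  qed
  note le = this
  have l: "(\<lambda>n. t * (B * (C * exp (B * t) * (1 / 2) ^ n))) \<longlonglongrightarrow> 0"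
    by (intro tendsto_mult_right_zero LIMSEQ_power_zero) simp
  have "(\<lambda>n. integral {0..t} ?h - integral {0..t} (?g n)) \<longlonglongrightarrow> 0"
    by (rule Lim_null_comparison[OF always_eventually l]) (simp only: real_norm_def le simp_thms)
  from tendsto_diff[OF tendsto_const[of "integral {0..t} ?h"] this]
  have "(\<lambda>n. integral {0..t} (?g n)) \<longlonglongrightarrow> integral {0..t} ?h" by (simp only: diff_diff_eq2 add_diff_cancel_left' diff_0_right)
  then have "(\<lambda>n. trunc (Suc n) f t z) \<longlonglongrightarrow> f (free_flow t z) * exp (- Lam z t) + integral {0..t} ?h"
    unfolding trunc_duhamel[OF fc C ct t] by (intro tendsto_intros)
  moreover have "(\<lambda>n. trunc (Suc n) f t z) \<longlonglongrightarrow> evolve f t z"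
    using trunc_tendsto_evolve[OF f t] by (rule LIMSEQ_Suc)
  ultimately show ?thesis by (rule LIMSEQ_unique[rotated])
qed

lemma evolve_0 [simp]: "f \<in> C_zero \<Longrightarrow> evolve f 0 z = f z"
  using evolve_duhamel[of f 0 z] by simp

lemma supported_trunc:
  assumes f: "continuous_on UNIV f" "supported a b f" and a: "0 \<le> a" and t: "0 \<le> t"
  shows "supported a (b + t * a) (trunc n f t)"
  using t
proof (induction n arbitrary: t)
  case 0
  then show ?case by (simp add: supported_def trunc_0)
next
  case (Suc n)
  note f0 = C_zeroI_supported[OF f]
  obtain C where C: "\<And>z. \<bar>f z\<bar> \<le> C" using C_zero_bounded[OF f0] by blast
  show ?case
    unfolding supported_def
  proof (intro allI impI)
    fix z :: "(real^'d) \<times> (real^'d)" assume z: "z \<notin> slab a (b + t * a)"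
    have 1: "f (free_flow t z) = 0"
      using f(2) free_flow_slab_reverse[of t z a b "b + t * a"] z Suc.prems by (auto simp: supported_def)
    have 2: "jump_rate (trunc n f (max 0 (t - s))) (free_flow s z) = 0" if s: "s \<in> {0..t}" for s
    proof -
      have "supported a (b + (t - s) * a) (jump_rate (trunc n f (t - s)))"
        by (rule supported_jump_rate[OF Suc.IH]) (use s in simp)
      moreover have "free_flow s z \<notin> slab a (b + (t - s) * a)"
        using free_flow_slab_reverse[of s z a "b + (t - s) * a" "b + t * a"] z s by (auto simp: algebra_simps)
      ultimately show ?thesis using s by (auto simp: supported_def)
    qed
    have "integral {0..t} (\<lambda>s. jump_rate (trunc n f (max 0 (t - s))) (free_flow s z) * exp (- Lam z s))
        = integral {0..t} (\<lambda>_. 0)"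
      by (rule Henstock_Kurzweil_Integration.integral_cong) (simp only: 2 mult_zero_left)
    then show "trunc (Suc n) f t z = 0"
      unfolding trunc_duhamel[OF f(1) C continuous_trunc[OF f(1) C] Suc.prems] by (simp add: 1)
  qed
qed

text \<open>
  A path that is in \<open>slab a b\<close> at time \<open>t\<close> started in \<open>slab a (b + t * a)\<close>.
\<close>

lemma supported_evolve:
  assumes f: "continuous_on UNIV f" "supported a b f" and a: "0 \<le> a" and t: "0 \<le> t"
  shows "supported a (b + t * a) (evolve f t)"
  unfolding supported_def
proof (intro allI impI)
  fix z :: "(real^'d) \<times> (real^'d)" assume z: "z \<notin> slab a (b + t * a)"
  have "(\<lambda>n. trunc n f t z) \<longlonglongrightarrow> evolve f t z"
    by (rule trunc_tendsto_evolve[OF C_zeroI_supported[OF f] t])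
  moreover have "trunc n f t z = 0" for n
    using supported_trunc[OF f a t, of n] z by (simp add: supported_def)
  ultimately show "evolve f t z = 0" by (simp add: LIMSEQ_const_iff)
qed

end

section \<open>Uniform limits at time zero\<close>

text \<open>
  All difference quotients at time zero are brought into this form.  The integrand depends on \<open>t\<close> as well,
  because Duhamel's formula integrates \<open>u\<^sub>t\<^sub>-\<^sub>s\<close> over \<open>s\<close>.
\<close>

lemma uniform_limit_average:
  fixes m :: "real \<Rightarrow> real \<Rightarrow> 'a::topological_space \<Rightarrow> real"
  assumes m: "continuous_on UNIV (\<lambda>(x, z). m (fst x) (snd x) z)" and K: "compact K"
    and 0: "\<And>t s z. z \<notin> K \<Longrightarrow> 0 \<le> s \<Longrightarrow> s \<le> t \<Longrightarrow> t \<le> 1 \<Longrightarrow> m t s z = 0"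
  shows "uniform_limit UNIV (\<lambda>t z. integral {0..t} (\<lambda>s. m t s z) / t) (m 0 0) (at_right 0)"
proof (rule uniform_limitI)
  fix e :: real assume e: "0 < e"
  obtain X where X: "(0, 0) \<in> X" "open X"
    "\<forall>x\<in>X \<inter> UNIV. \<forall>z\<in>K. dist (case (x, z) of (x, z) \<Rightarrow> m (fst x) (snd x) z)
      (case ((0, 0), z) of (x, z) \<Rightarrow> m (fst x) (snd x) z) \<le> e / 2"
    by (rule continuous_on_prod_compactE[OF continuous_on_subset[OF m subset_UNIV] K UNIV_I, of "e / 2" "(0, 0)"])
       (use e in auto)
  obtain A B where AB: "open A" "open B" "(0::real) \<in> A" "(0::real) \<in> B" "A \<times> B \<subseteq> X"
    using X(1,2) by (auto elim!: open_prod_elim)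
  obtain d where d: "0 < d" "ball 0 d \<subseteq> A \<inter> B"
    using AB by (metis IntI open_Int openE)
  have ev: "\<forall>\<^sub>F t in at_right (0::real). t \<in> {0<..<min d 1}"
    by (rule eventually_at_right_real) (use d in auto)
  then show "\<forall>\<^sub>F t in at_right 0. \<forall>z\<in>UNIV. dist (integral {0..t} (\<lambda>s. m t s z) / t) (m 0 0 z) < e"
  proof eventually_elim
    case (elim t)
    show ?case
    proof
      fix z :: 'a
      have "continuous_on UNIV (\<lambda>s. m t s z)"
        using continuous_on_compose2[OF m, of UNIV "\<lambda>s. ((t, s), z)"]
        by (simp add: continuous_on_Pair continuous_on_const continuous_on_id)
      then have int: "(\<lambda>s. m t s z) integrable_on {0..t}"
        by (intro integrable_continuous_real) (auto intro: continuous_on_subset)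
      have le: "\<bar>m t s z - m 0 0 z\<bar> \<le> e / 2" if "s \<in> {0..t}" for s
      proof (cases "z \<in> K")
        case True
        have "s \<in> ball 0 d" "t \<in> ball 0 d" using that elim by auto
        then have "(t, s) \<in> X" using AB d by blast
        with X(3) True show ?thesis by (auto simp: dist_real_def)
      next
        case False
        then show ?thesis using 0[OF False, of s t] 0[OF False, of 0 0] elim that e by simp
      qed
      have "norm (integral {0..t} (\<lambda>s. m t s z - m 0 0 z)) \<le> integral {0..t} (\<lambda>_. e / 2)"
        using le int by (intro integral_norm_bound_integral) (auto intro: integrable_diff)
      moreover have "integral {0..t} (\<lambda>s. m t s z - m 0 0 z) = integral {0..t} (\<lambda>s. m t s z) - t * m 0 0 z"
        using Henstock_Kurzweil_Integration.integral_diff[OF int integrable_const_ivl, of "m 0 0 z"] elim by simp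
      ultimately have "\<bar>integral {0..t} (\<lambda>s. m t s z) - t * m 0 0 z\<bar> \<le> t * (e / 2)"
        using elim by simp
      then have "\<bar>integral {0..t} (\<lambda>s. m t s z) / t - m 0 0 z\<bar> \<le> e / 2"
        using elim by (simp add: abs_le_iff field_simps)
      then show "dist (integral {0..t} (\<lambda>s. m t s z) / t) (m 0 0 z) < e"
        using e by (simp add: dist_real_def)
    qed
  qed
qed

lemma uniform_limit_at_start:
  fixes h :: "real \<Rightarrow> 'a::topological_space \<Rightarrow> real"
  assumes h: "continuous_on UNIV (\<lambda>(t, z). h t z)" and K: "compact K"
    and 0: "\<And>t z. z \<notin> K \<Longrightarrow> 0 \<le> t \<Longrightarrow> t \<le> 1 \<Longrightarrow> h t z = 0"
  shows "uniform_limit UNIV h (h 0) (at_right 0)"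
proof (rule uniform_limitI)
  fix e :: real assume e: "0 < e"
  obtain X where X: "0 \<in> X" "open X"
    "\<forall>x\<in>X \<inter> UNIV. \<forall>z\<in>K. dist (case (x, z) of (x, z) \<Rightarrow> h x z) (case (0, z) of (x, z) \<Rightarrow> h x z) \<le> e / 2"
    by (rule continuous_on_prod_compactE[OF continuous_on_subset[OF h subset_UNIV] K UNIV_I, of "e / 2" 0])
       (use e in auto)
  obtain d where d: "0 < d" "ball 0 d \<subseteq> X" using X(1,2) by (meson open_contains_ball)
  have "\<forall>\<^sub>F t in at_right (0::real). t \<in> {0<..<min d 1}"
    by (rule eventually_at_right_real) (use d in auto)
  then show "\<forall>\<^sub>F t in at_right 0. \<forall>z\<in>UNIV. dist (h t z) (h 0 z) < e"
  proof eventually_elim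
    case (elim t)
    then have t: "t \<in> X" using d by (auto simp: subset_iff)
    show ?case
    proof
      fix z :: 'a
      show "dist (h t z) (h 0 z) < e"
      proof (cases "z \<in> K")
        case True
        with X(3) t have "dist (h t z) (h 0 z) \<le> e / 2" by simp
        with e show ?thesis by simp
      next
        case False
        with 0[OF False, of t] 0[OF False, of 0] elim e show ?thesis by simp
      qed
    qed
  qed
qed

section \<open>The Feller property\<close>

context isometric_refreshment
begin

abbreviation P where "P \<equiv> refreshment_semigroup Xi lam Orth"

lemma P_eq_evolve: "0 \<le> t \<Longrightarrow> P t f = evolve f t"
  by (rule ext) (simp add: evolve_def)

lemma evolve_uniform_limit:
  assumes f: "f \<in> C_zero"
  shows "uniform_limit UNIV (\<lambda>t. evolve f t) f (at_right 0)"
proof (rule uniform_limitI)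
  fix e :: real assume e: "0 < e"
  obtain g a b where g: "continuous_on UNIV g" "0 \<le> a" "0 \<le> b" "supported a b g" "\<And>z. \<bar>f z - g z\<bar> \<le> e / 4"
    using C_zero_approx_supported[OF f, of "e / 4"] e by auto
  note g0 = C_zeroI_supported[OF g(1,4)]
  have "uniform_limit UNIV (\<lambda>t. evolve g t) (evolve g 0) (at_right 0)"
  proof (rule uniform_limit_at_start[OF continuous_evolve[OF g0] compact_slab])
    fix t :: real and z :: "(real^'d) \<times> (real^'d)" assume z: "z \<notin> slab a (b + a)" and t: "0 \<le> t" "t \<le> 1"
    have "supported a (b + a) (evolve g t)"
      by (rule supported_mono[OF supported_evolve[OF g(1,4,2) t(1)]]) (use t g in \<open>auto simp: mult_left_le_one_le\<close>)
    with z show "evolve g t z = 0" by (simp add: supported_def)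
  qed
  then have "\<forall>\<^sub>F t in at_right 0. \<forall>z\<in>UNIV. dist (evolve g t z) (evolve g 0 z) < e / 4"
    using e by (intro uniform_limitD) auto
  then show "\<forall>\<^sub>F t in at_right 0. \<forall>z\<in>UNIV. dist (evolve f t z) (f z) < e"
  proof eventually_elim
    case (elim t)
    show ?case
    proof
      fix z
      have "\<bar>evolve g t z - g z\<bar> < e / 4" using elim g0 by (simp add: dist_real_def)
      with evolve_diff_bound[OF f g0 g(5), of t z] g(5)[of z] e
      show "dist (evolve f t z) (f z) < e" unfolding dist_real_def by linarith
    qed
  qed
qed

text \<open>
  Contractivity reduces the decay at infinity to functions of compact support.
\<close>

lemma evolve_C_zero:
  assumes f: "f \<in> C_zero" and t: "0 \<le> t"
  shows "evolve f t \<in> C_zero"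
proof -
  have "continuous_on UNIV (evolve f t)"
    by (rule continuous_on_Pair_fixed[OF continuous_evolve[OF f]])
  moreover have "(evolve f t \<longlongrightarrow> 0) at_infinity"
  proof (rule tendstoI)
    fix e :: real assume e: "0 < e"
    obtain g a b where g: "continuous_on UNIV g" "0 \<le> a" "0 \<le> b" "supported a b g" "\<And>z. \<bar>f z - g z\<bar> \<le> e / 2"
      using C_zero_approx_supported[OF f, of "e / 2"] e by auto
    note g0 = C_zeroI_supported[OF g(1,4)]
    note s = supported_evolve[OF g(1,4,2) t]
    obtain r where r: "\<And>z. z \<in> slab a (b + t * a) \<Longrightarrow> norm (z :: (real^'d) \<times> (real^'d)) \<le> r"
      using compact_imp_bounded[OF compact_slab] by (metis bounded_iff)
    have "dist (evolve f t z) 0 < e" if "r + 1 \<le> norm z" for z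
    proof -
      have "z \<notin> slab a (b + t * a)" using r[of z] that by auto
      then have "evolve g t z = 0" using s by (simp add: supported_def)
      with evolve_diff_bound[OF f g0 g(5), of t z] e show ?thesis by simp
    qed
    then show "\<forall>\<^sub>F z in at_infinity. dist (evolve f t z) 0 < e"
      unfolding eventually_at_infinity by blast
  qed
  ultimately show ?thesis by (simp add: C_zero_def)
qed

lemma uniform_limit_P_cong:
  "uniform_limit UNIV (\<lambda>t z. F t (P t f z) z) g (at_right 0) \<longleftrightarrow>
   uniform_limit UNIV (\<lambda>t z. F t (evolve f t z) z) g (at_right (0::real))"
proof (rule uniform_limit_cong)
  show "\<forall>\<^sub>F t in at_right 0. \<forall>z\<in>UNIV. F t (P t f z) z = F t (evolve f t z) z"
    using eventually_at_right_less[of "0::real"]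
    by eventually_elim (simp add: P_eq_evolve)
qed simp

theorem feller_P: "feller P"
  unfolding feller_def
  using evolve_C_zero evolve_uniform_limit uniform_limit_P_cong[where F="\<lambda>t x z. x"]
  by (simp add: P_eq_evolve)

end

section \<open>The derivative along the flow\<close>

text \<open>
  The limit is one-sided and uniform, like the one in the definition of the generator.  For the functions to which this
  is applied, no derivative in \<open>q\<close> or \<open>p\<close> separately needs to exist.
\<close>

definition flow_derivative :: "('a::real_normed_vector \<times> 'a \<Rightarrow> real) \<Rightarrow> ('a \<times> 'a \<Rightarrow> real) \<Rightarrow> bool" where
  "flow_derivative f g \<longleftrightarrow> uniform_limit UNIV (\<lambda>t z. (f (free_flow t z) - f z) / t) g (at_right 0)"

lemma flow_derivative_pointwise:
  "flow_derivative f g \<Longrightarrow> ((\<lambda>t. (f (free_flow t z) - f z) / t) \<longlongrightarrow> g z) (at_right 0)"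
  unfolding flow_derivative_def by (rule tendsto_uniform_limitI) auto

lemma flow_derivative_continuous:
  assumes f: "continuous_on UNIV f" and "flow_derivative f g"
  shows "continuous_on UNIV g"
proof (rule uniform_limit_theorem[OF always_eventually assms(2)[unfolded flow_derivative_def]
      trivial_limit_at_right_real], rule allI)
  show "continuous_on UNIV (\<lambda>z. (f (free_flow t z) - f z) / t)" for t :: real
    by (cases "t = 0") (auto intro!: continuous_intros continuous_on_compose2[OF f])
qed

lemma flow_derivative_supported:
  assumes f: "supported a b f" and a: "0 \<le> a" and "flow_derivative f g"
  shows "supported a (b + a) g"
  unfolding supported_def
proof (intro allI impI)
  fix z :: "'a \<times> 'a" assume z: "z \<notin> slab a (b + a)"
  have "\<forall>\<^sub>F t in at_right (0::real). t \<in> {0<..<1}" by (rule eventually_at_right_real) simp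
  then have "\<forall>\<^sub>F t in at_right 0. (f (free_flow t z) - f z) / t = 0"
  proof eventually_elim
    case (elim t)
    then have "b + t * a \<le> b + a" using a by (simp add: mult_left_le_one_le)
    then have "f (free_flow t z) = 0" using supported_free_flow[OF f a _ _ z, of t] elim by simp
    moreover have "f z = 0" using supported_free_flow[OF f a _ _ z, of 0] a by simp
    ultimately show ?case by simp
  qed
  then have "((\<lambda>t. (f (free_flow t z) - f z) / t) \<longlongrightarrow> 0) (at_right 0)"
    by (rule tendsto_eventually)
  with flow_derivative_pointwise[OF assms(3), of z] show "g z = 0"
    by (rule tendsto_unique[rotated]) simp
qed

lemma flow_derivative_scale:
  "flow_derivative f g \<Longrightarrow> flow_derivative (\<lambda>z. c * f z) (\<lambda>z. c * g z)"
  unfolding flow_derivative_def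
  using bounded_linear.uniform_limit[OF bounded_linear_mult_right[of c]]
  by (fastforce simp: right_diff_distrib)

section \<open>The generator on functions of compact support\<close>

context isometric_refreshment
begin

text \<open>
  To first order in time, the semigroup differs from the flow by the jump part of the generator.
\<close>

lemma evolve_minus_flow:
  assumes f: "continuous_on UNIV f" "supported a b f" and a: "0 \<le> a"
  shows "uniform_limit UNIV (\<lambda>t z. (evolve f t z - f (free_flow t z)) / t)
    (\<lambda>z. jump_rate f z - lam z * f z) (at_right 0)"
proof -
  note f0 = C_zeroI_supported[OF f]
  define m where "m t s z = (jump_rate (evolve f (t - s)) (free_flow s z)
    - lam (free_flow s z) * f (free_flow t z)) * exp (- Lam z s)" for t s z
  have mc: "continuous_on UNIV (\<lambda>(x, z). m (fst x) (snd x) z)"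
    unfolding m_def split_beta
    by (intro continuous_intros continuous_on_compose2[OF f(1)]
        continuous_on_case_prod_compose[OF continuous_jump_rate_evolve[OF f0]]) auto
  have lim: "uniform_limit UNIV (\<lambda>t z. integral {0..t} (\<lambda>s. m t s z) / t) (m 0 0) (at_right 0)"
  proof (rule uniform_limit_average[OF mc compact_slab])
    fix t s :: real and z :: "(real^'d) \<times> (real^'d)" assume z: "z \<notin> slab a (b + a)" and t: "0 \<le> s" "s \<le> t" "t \<le> 1"
    have 1: "b + t * a \<le> b + a" using a t by (simp add: mult_left_le_one_le)
    have "f (free_flow t z) = 0" by (rule supported_free_flow[OF f(2) a _ 1 z]) (use t in simp)
    moreover have "jump_rate (evolve f (t - s)) (free_flow s z) = 0"
      by (rule supported_free_flow[OF supported_jump_rate[OF supported_evolve[OF f a]] a t(1) _ z])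
         (use t 1 in \<open>auto simp: algebra_simps\<close>)
    ultimately show "m t s z = 0" by (simp add: m_def)
  qed
  have eq: "evolve f t z - f (free_flow t z) = integral {0..t} (\<lambda>s. m t s z)" if t: "0 \<le> t" for t z
  proof -
    let ?j = "\<lambda>s. jump_rate (evolve f (t - s)) (free_flow s z) * exp (- Lam z s)"
    have "?j integrable_on {0..t}"
      by (intro integrable_continuous_real continuous_intros
          continuous_on_case_prod_compose[OF continuous_jump_rate_evolve[OF f0]])
    then have "((\<lambda>s. ?j s - f (free_flow t z) * (lam (free_flow s z) * exp (- Lam z s))) has_integral
        integral {0..t} ?j - f (free_flow t z) * (1 - exp (- Lam z t))) {0..t}"
      by (intro has_integral_diff has_integral_mult_right has_integral_rate_exp_Lam t integrable_integral)
    then have "integral {0..t} (\<lambda>s. m t s z) = integral {0..t} ?j - f (free_flow t z) * (1 - exp (- Lam z t))"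
      by (intro integral_unique) (simp add: m_def algebra_simps)
    then show ?thesis using evolve_duhamel[OF f0 t, of z] by (simp add: algebra_simps)
  qed
  have "\<forall>\<^sub>F t in at_right 0. \<forall>z\<in>UNIV. integral {0..t} (\<lambda>s. m t s z) / t = (evolve f t z - f (free_flow t z)) / t"
    using eventually_at_right_less[of "0::real"] by eventually_elim (simp add: eq)
  moreover have "m 0 0 z = jump_rate f z - lam z * f z" for z
  proof -
    have "evolve f 0 = f" using f0 by auto
    then show ?thesis by (simp add: m_def)
  qed
  ultimately show ?thesis
    using lim uniform_limit_cong[of UNIV "\<lambda>t z. integral {0..t} (\<lambda>s. m t s z) / t"
        "\<lambda>t z. (evolve f t z - f (free_flow t z)) / t" "at_right 0" "m 0 0"] by force
qed

theorem has_generator_supported: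
  assumes f: "continuous_on UNIV f" "supported a b f" and a: "0 \<le> a" and g: "flow_derivative f g"
  shows "has_generator P f (\<lambda>z. g z + jump_rate f z - lam z * f z)"
  unfolding has_generator_def
proof (intro conjI)
  show "f \<in> C_zero" by (rule C_zeroI_supported[OF f])
  have s: "supported a (b + a) g" by (rule flow_derivative_supported[OF f(2) a g])
  have s': "supported a (b + a) f" by (rule supported_mono[OF f(2)]) (use a in auto)
  have "continuous_on UNIV (jump_rate f)"
    using isCont_jump_rate[OF f(1)] by (simp add: continuous_on_eq_continuous_at)
  then have "continuous_on UNIV (\<lambda>z. g z + jump_rate f z - lam z * f z)"
    by (intro continuous_intros flow_derivative_continuous[OF f(1) g] f(1))
  moreover have "supported a (b + a) (\<lambda>z. g z + jump_rate f z - lam z * f z)"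
    using s s' supported_jump_rate[OF s'] by (simp add: supported_def)
  ultimately show "(\<lambda>z. g z + jump_rate f z - lam z * f z) \<in> C_zero"
    by (rule C_zeroI_supported)
  have "uniform_limit UNIV (\<lambda>t z. (f (free_flow t z) - f z) / t + (evolve f t z - f (free_flow t z)) / t)
      (\<lambda>z. g z + (jump_rate f z - lam z * f z)) (at_right 0)"
    by (intro uniform_limit_add g[unfolded flow_derivative_def] evolve_minus_flow[OF f a])
  then show "uniform_limit UNIV (\<lambda>t z. (P t f z - f z) / t) (\<lambda>z. g z + jump_rate f z - lam z * f z) (at_right 0)"
    unfolding uniform_limit_P_cong[where F="\<lambda>t x z. (x - f z) / t"]
    by (simp add: add_divide_distrib[symmetric] add_diff_eq)
qed

section \<open>Time averages of the semigroup\<close>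

definition evolve_average :: "real \<Rightarrow> ((real^'d) \<times> (real^'d) \<Rightarrow> real) \<Rightarrow> (real^'d) \<times> (real^'d) \<Rightarrow> real" where
  "evolve_average h f z = integral {0..h} (\<lambda>s. evolve f s z)"

lemma continuous_evolve_average:
  assumes "f \<in> C_zero"
  shows "continuous_on UNIV (evolve_average h f)"
  unfolding evolve_average_def[abs_def]
  by (rule continuous_on_integral_upper)
     (auto simp: split_beta intro!: continuous_on_case_prod_compose[OF continuous_evolve[OF assms]] continuous_intros)

text \<open>
  Duhamel's formula holds along each trajectory of the flow, from any intermediate time on: the
  contribution of the first jumps before time \<open>r\<close> is split off.
\<close>

lemma evolve_restart:
  assumes f: "f \<in> C_zero" and r: "0 \<le> r" and t: "0 \<le> t"
  shows "evolve f (t + r) z = exp (- Lam z r) * evolve f t (free_flow r z)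
    + integral {0..r} (\<lambda>s. jump_rate (evolve f (t + r - s)) (free_flow s z) * exp (- Lam z s))"
proof -
  let ?g = "\<lambda>s. jump_rate (evolve f (t + r - s)) (free_flow s z) * exp (- Lam z s)"
  have E: "exp (- Lam z (r + s)) = exp (- Lam z r) * exp (- Lam (free_flow r z) s)" if "0 \<le> s" for s
    by (simp add: Lam_add[OF r that] exp_add[symmetric])
  have fl: "free_flow (r + s) z = free_flow s (free_flow r z)" for s
    by (simp add: add.commute)
  have g: "continuous_on UNIV ?g"
    by (intro continuous_intros continuous_on_case_prod_compose[OF continuous_jump_rate_evolve[OF f]])
  have "evolve f (t + r) z = f (free_flow (r + t) z) * exp (- Lam z (r + t)) + integral {0..r + t} ?g"
    using evolve_duhamel[OF f, of "t + r" z] r t by (simp add: add.commute)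
  also have "integral {0..r + t} ?g = integral {0..r} ?g + integral {0..t} (\<lambda>s. ?g (r + s))"
    by (rule integral_combine_shift[OF g r t])
  also have "integral {0..t} (\<lambda>s. ?g (r + s)) = integral {0..t} (\<lambda>s. exp (- Lam z r) *
      (jump_rate (evolve f (t - s)) (free_flow s (free_flow r z)) * exp (- Lam (free_flow r z) s)))"
  proof (rule Henstock_Kurzweil_Integration.integral_cong)
    fix s assume "s \<in> {0..t}"
    then have "0 \<le> s" by simp
    have "t + r - (r + s) = t - s" by simp
    then show "?g (r + s) = exp (- Lam z r) *
        (jump_rate (evolve f (t - s)) (free_flow s (free_flow r z)) * exp (- Lam (free_flow r z) s))"
      by (simp only: E[OF \<open>0 \<le> s\<close>] fl mult_ac)
  qed
  also have "\<dots> = exp (- Lam z r) * integral {0..t} (\<lambda>s.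
      jump_rate (evolve f (t - s)) (free_flow s (free_flow r z)) * exp (- Lam (free_flow r z) s))"
    by simp
  also have "\<dots> = exp (- Lam z r) * evolve f t (free_flow r z) - f (free_flow (r + t) z) * exp (- Lam z (r + t))"
    unfolding evolve_duhamel[OF f t, of "free_flow r z"] E[OF t] fl by (simp add: algebra_simps)
  finally show ?thesis by simp
qed

text \<open>
  Fubini's theorem for the time and the random jump.
\<close>

lemma jump_rate_evolve_average:
  assumes f: "f \<in> C_zero" and h: "0 \<le> h"
  shows "jump_rate (evolve_average h f) z = integral {0..h} (\<lambda>s. jump_rate (evolve f s) z)"
proof -
  obtain C where C: "\<And>z. \<bar>f z\<bar> \<le> C" using C_zero_bounded[OF f] by blast
  have C0: "0 \<le> C" using C[of 0] by linarith
  note ce = continuous_evolve[OF f]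
  have [measurable]: "(\<lambda>x. evolve f (t x) (g x)) \<in> borel_measurable M"
    if "t \<in> borel_measurable M" "g \<in> borel_measurable M" for t g and M :: "('b) measure"
    using ce by (intro borel_measurable_continuous_Pair[OF that]) (simp add: split_beta)
  interpret XL: pair_sigma_finite Xi lborel ..
  let ?u = "\<lambda>\<xi> s. indicator {0..h} s * evolve f s (refreshment_jump Orth \<xi> z)"
  have cont1: "continuous_on A (\<lambda>s. evolve f s y)" for A y
    by (intro continuous_on_case_prod_compose[OF ce] continuous_intros)
  have L: "integral {0..h} k = (LBINT s. indicator {0..h} s * k s)" if "continuous_on {0..h} k" for k :: "real \<Rightarrow> real"
    using set_borel_integral_eq_integral(2)[OF borel_integrable_atLeastAtMost'[OF that]]
    by (simp add: set_lebesgue_integral_def)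
  have int: "integrable (Xi \<Otimes>\<^sub>M lborel) (\<lambda>(\<xi>, s). ?u \<xi> s)"
  proof (rule Bochner_Integration.integrable_bound[where f="\<lambda>x. C * indicator (space Xi \<times> {0..h}) x"])
    have "emeasure (Xi \<Otimes>\<^sub>M lborel) (space Xi \<times> {0..h}) = emeasure Xi (space Xi) * emeasure lborel {0..h}"
      by (rule lborel.emeasure_pair_measure_Times) auto
    then show "integrable (Xi \<Otimes>\<^sub>M lborel) (\<lambda>x. C * indicator (space Xi \<times> {0..h}) x)"
      using h by (intro integrable_mult_right integrable_real_indicator) (auto simp: emeasure_space_1)
    show "(\<lambda>(\<xi>, s). ?u \<xi> s) \<in> borel_measurable (Xi \<Otimes>\<^sub>M lborel)"
      by measurable
    show "AE x in Xi \<Otimes>\<^sub>M lborel. norm (case x of (\<xi>, s) \<Rightarrow> ?u \<xi> s) \<le> norm (C * indicator (space Xi \<times> {0..h}) x)"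
      by (rule AE_I2) (auto simp: space_pair_measure indicator_def abs_of_nonneg[OF C0] intro!: evolve_bound C)
  qed
  have "Q (evolve_average h f) z = (\<integral>\<xi>. (LBINT s. ?u \<xi> s) \<partial>Xi)"
    by (simp add: evolve_average_def L cont1)
  also have "\<dots> = (LBINT s. (\<integral>\<xi>. ?u \<xi> s \<partial>Xi))"
    by (rule XL.Fubini_integral[OF int, symmetric])
  also have "\<dots> = (LBINT s. indicator {0..h} s * Q (evolve f s) z)" by simp
  finally have "jump_rate (evolve_average h f) z = (LBINT s. indicator {0..h} s * jump_rate (evolve f s) z)"
    by (simp add: jump_rate_def mult.left_commute)
  also have "\<dots> = integral {0..h} (\<lambda>s. jump_rate (evolve f s) z)"
    by (rule L[symmetric])
       (intro continuous_on_case_prod_compose[OF continuous_jump_rate_evolve[OF f]] continuous_intros)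
  finally show ?thesis .
qed

lemma supported_evolve_average:
  assumes f: "continuous_on UNIV f" "supported a b f" and a: "0 \<le> a" and h: "0 \<le> h"
  shows "supported a (b + h * a) (evolve_average h f)"
  unfolding supported_def
proof (intro allI impI)
  fix z :: "(real^'d) \<times> (real^'d)" assume z: "z \<notin> slab a (b + h * a)"
  have 0: "evolve f s z = 0" if "s \<in> {0..h}" for s
  proof -
    have "supported a (b + h * a) (evolve f s)"
      by (rule supported_mono[OF supported_evolve[OF f a]]) (use that a in \<open>auto intro: mult_right_mono\<close>)
    with z show ?thesis by (simp add: supported_def)
  qed
  have "integral {0..h} (\<lambda>s. evolve f s z) = integral {0..h} (\<lambda>_. 0)"
    by (rule Henstock_Kurzweil_Integration.integral_cong) (rule 0)
  then show "evolve_average h f z = 0" by (simp add: evolve_average_def)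
qed

text \<open>
  By \<open>evolve_restart\<close>, moving the starting point along the flow amounts to shifting the time window of the
  average, up to the jumps in between.  Shifting the window contributes the difference \<open>evolve f h - f\<close> of
  the values at its ends.  The other two terms cancel the jump part in the generator, so that
  \<open>evolve f h - f\<close> is all that remains there.
\<close>

lemma flow_derivative_evolve_average:
  assumes f: "continuous_on UNIV f" "supported a b f" and a: "0 \<le> a" and h: "0 \<le> h"
  shows "flow_derivative (evolve_average h f)
    (\<lambda>z. evolve f h z - f z - jump_rate (evolve_average h f) z + lam z * evolve_average h f z)"
proof -
  note f0 = C_zeroI_supported[OF f]
  note ce = continuous_evolve[OF f0] and cj = continuous_jump_rate_evolve[OF f0]
  note cF = continuous_evolve_average[OF f0, of h]
  let ?F = "evolve_average h f"
  \<comment> \<open>the jumps at time \<open>s \<le> r\<close> along the flow, accumulated over the time window\<close>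
  define k where "k r s z = integral {0..h} (\<lambda>t. jump_rate (evolve f (t + r - s)) (free_flow s z))" for r s z
  define m where "m r s z = evolve f (h + s) z - evolve f s z - exp (- Lam z s) * k r s z
    + ?F (free_flow r z) * (lam (free_flow s z) * exp (- Lam z s))" for r s z
  have "continuous_on UNIV (\<lambda>p. k (fst (fst p)) (snd (fst p)) (snd p))"
    unfolding k_def
    by (rule continuous_on_integral_upper)
       (auto simp: split_beta intro!: continuous_on_case_prod_compose[OF cj] continuous_intros)
  then have mc: "continuous_on UNIV (\<lambda>(x, z). m (fst x) (snd x) z)"
    unfolding m_def split_beta
    by (intro continuous_on_add continuous_on_diff continuous_on_mult continuous_on_case_prod_compose[OF ce]
        continuous_on_compose2[OF cF] continuous_intros) auto
  have lim: "uniform_limit UNIV (\<lambda>t z. integral {0..t} (\<lambda>s. m t s z) / t) (m 0 0) (at_right 0)"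
  proof (rule uniform_limit_average[OF mc compact_slab])
    fix r s :: real and z :: "(real^'d) \<times> (real^'d)" assume z: "z \<notin> slab a (b + (h + 1) * a)" and r: "0 \<le> s" "s \<le> r" "r \<le> 1"
    have mono: "b + t * a \<le> b + (h + 1) * a" if "t \<le> h + 1" for t
      using that a by (intro add_left_mono mult_right_mono)
    have u: "evolve f t z = 0" if "0 \<le> t" "t \<le> h + 1" for t
    proof -
      have "supported a (b + (h + 1) * a) (evolve f t)"
        by (rule supported_mono[OF supported_evolve[OF f a that(1)] order_refl mono[OF that(2)]])
      with z show ?thesis by (simp add: supported_def)
    qed
    have "?F (free_flow r z) = 0"
      by (rule supported_free_flow[OF supported_evolve_average[OF f a h] a _ _ z])
         (use r mono[of "h + r"] in \<open>auto simp: algebra_simps\<close>)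
    moreover have "jump_rate (evolve f (t + r - s)) (free_flow s z) = 0" if "t \<in> {0..h}" for t
      by (rule supported_free_flow[OF supported_jump_rate[OF supported_evolve[OF f a]] a r(1) _ z])
         (use r that mono[of "t + r"] in \<open>auto simp: algebra_simps\<close>)
    then have "k r s z = integral {0..h} (\<lambda>_. 0)"
      unfolding k_def by (rule Henstock_Kurzweil_Integration.integral_cong)
    moreover have "evolve f (h + s) z = 0" "evolve f s z = 0" using r h by (intro u; simp)+
    ultimately show "m r s z = 0" by (simp add: m_def)
  qed
  have eq: "?F (free_flow r z) - ?F z = integral {0..r} (\<lambda>s. m r s z)" if r: "0 \<le> r" for r z
  proof -
    let ?E = "\<lambda>s. exp (- Lam z s)"
    let ?j = "\<lambda>t s. jump_rate (evolve f (t + r - s)) (free_flow s z) * ?E s"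
    have cu: "continuous_on UNIV (\<lambda>s. evolve f (c + s) y)" for c y
      by (intro continuous_on_case_prod_compose[OF ce] continuous_intros)
    have iu: "(\<lambda>s. evolve f (c + s) y) integrable_on {0..x}" for c x y
      by (intro integrable_continuous_real) (rule continuous_on_subset[OF cu], simp)
    have cjj: "continuous_on UNIV (\<lambda>(t, s). ?j t s)"
      unfolding split_beta by (intro continuous_on_case_prod_compose[OF cj] continuous_intros)
    have "continuous_on UNIV (\<lambda>t. integral {0..r} (?j t))"
      by (rule continuous_on_integral_upper) (use cjj in auto)
    then have ij: "(\<lambda>t. integral {0..r} (?j t)) integrable_on {0..h}"
      by (intro integrable_continuous_real) (auto intro: continuous_on_subset)
    \<comment> \<open>exchanges the time of the average and the time of the first jump\<close>
    have swap: "integral {0..h} (\<lambda>t. integral {0..r} (?j t)) = integral {0..r} (\<lambda>s. ?E s * k r s z)"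
      using integral_swap_continuous[of 0 0 h r ?j] continuous_on_subset[OF cjj]
      by (simp add: k_def mult.commute)
    have "?E r * ?F (free_flow r z) = integral {0..h} (\<lambda>t. ?E r * evolve f t (free_flow r z))"
      by (simp add: evolve_average_def)
    also have "\<dots> = integral {0..h} (\<lambda>t. evolve f (r + t) z - integral {0..r} (?j t))"
      by (rule Henstock_Kurzweil_Integration.integral_cong)
         (use evolve_restart[OF f0 r, of _ z] in \<open>simp add: add.commute\<close>)
    also have "\<dots> = integral {0..h} (\<lambda>t. evolve f (r + t) z) - integral {0..r} (\<lambda>s. ?E s * k r s z)"
      unfolding swap[symmetric] by (rule Henstock_Kurzweil_Integration.integral_diff[OF iu ij])
    also have "integral {0..h} (\<lambda>t. evolve f (r + t) z) = ?F z + integral {0..r} (\<lambda>s. evolve f (h + s) z) - integral {0..r} (\<lambda>s. evolve f (0 + s) z)"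
      using integral_combine_shift[OF cu[of 0 z] r h] integral_combine_shift[OF cu[of 0 z] h r]
      by (simp add: evolve_average_def add.commute)
    finally have 1: "?E r * ?F (free_flow r z) - ?F z = integral {0..r} (\<lambda>s. evolve f (h + s) z)
        - integral {0..r} (\<lambda>s. evolve f (0 + s) z) - integral {0..r} (\<lambda>s. ?E s * k r s z)" by simp
    have "continuous_on UNIV (\<lambda>s. k r s z)"
      unfolding k_def
      by (rule continuous_on_integral_upper)
         (auto simp: split_beta intro!: continuous_on_case_prod_compose[OF cj] continuous_intros)
    then have ik: "(\<lambda>s. ?E s * k r s z) integrable_on {0..r}"
      by (intro integrable_continuous_real continuous_intros) (auto intro: continuous_on_subset)
    have "((\<lambda>s. evolve f (h + s) z - evolve f (0 + s) z - ?E s * k r s z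
        + ?F (free_flow r z) * (lam (free_flow s z) * ?E s)) has_integral
        integral {0..r} (\<lambda>s. evolve f (h + s) z) - integral {0..r} (\<lambda>s. evolve f (0 + s) z)
        - integral {0..r} (\<lambda>s. ?E s * k r s z) + ?F (free_flow r z) * (1 - ?E r)) {0..r}"
      by (intro has_integral_add has_integral_diff has_integral_mult_right integrable_integral iu ik
          has_integral_rate_exp_Lam r)
    then have "integral {0..r} (\<lambda>s. m r s z) = integral {0..r} (\<lambda>s. evolve f (h + s) z) - integral {0..r} (\<lambda>s. evolve f (0 + s) z)
        - integral {0..r} (\<lambda>s. ?E s * k r s z) + ?F (free_flow r z) * (1 - ?E r)"
      by (intro integral_unique) (simp add: m_def)
    with 1 show ?thesis by (simp add: algebra_simps)
  qed
  have "\<forall>\<^sub>F t in at_right 0. \<forall>z\<in>UNIV. integral {0..t} (\<lambda>s. m t s z) / t = (?F (free_flow t z) - ?F z) / t"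
    using eventually_at_right_less[of "0::real"] by eventually_elim (simp add: eq)
  moreover have "m 0 0 z = evolve f h z - f z - jump_rate ?F z + lam z * ?F z" for z
    using f0 h by (simp add: m_def k_def jump_rate_evolve_average)
  ultimately show ?thesis
    using lim uniform_limit_cong[of UNIV "\<lambda>t z. integral {0..t} (\<lambda>s. m t s z) / t"
        "\<lambda>t z. (?F (free_flow t z) - ?F z) / t" "at_right 0" "m 0 0"]
    unfolding flow_derivative_def by force
qed

end

section \<open>Mollification that respects the flow\<close>

lemma uniformly_close_on_compact:
  fixes g :: "'b::real_normed_vector \<Rightarrow> 'a::topological_space \<Rightarrow> real"
  assumes g: "continuous_on UNIV (\<lambda>(x, z). g x z)" and K: "compact K" and e: "0 < e"
  obtains d where "0 < d" "\<And>x z. norm x < d \<Longrightarrow> z \<in> K \<Longrightarrow> \<bar>g x z - g 0 z\<bar> \<le> e"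
proof -
  obtain X where X: "0 \<in> X" "open X"
    "\<forall>x\<in>X \<inter> UNIV. \<forall>z\<in>K. dist (case (x, z) of (x, z) \<Rightarrow> g x z) (case (0, z) of (x, z) \<Rightarrow> g x z) \<le> e"
    by (rule continuous_on_prod_compactE[OF continuous_on_subset[OF g subset_UNIV] K UNIV_I e, of 0]) blast
  obtain d where d: "0 < d" "ball 0 d \<subseteq> X" using X(1,2) by (meson openE)
  have "\<bar>g x z - g 0 z\<bar> \<le> e" if "norm x < d" "z \<in> K" for x z
  proof -
    have "x \<in> X" using d that by (auto simp: subset_iff)
    with X(3) that show ?thesis by (simp add: dist_real_def)
  qed
  with d that show ?thesis by blast
qed

lemma slab_subset_cbox:
  obtains l u :: "'a::euclidean_space \<times> 'a" where "slab a b \<subseteq> cbox l u"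
  by (meson bounded_subset_cbox_symmetric compact_imp_bounded compact_slab)

lemma Cc_infinity_supported:
  fixes f :: "'a::euclidean_space \<times> 'a \<Rightarrow> real"
  assumes "f \<in> Cc_infinity"
  obtains a where "0 \<le> a" "supported a a f"
proof -
  have "bounded {z. f z \<noteq> 0}"
    using assms by (auto simp: Cc_infinity_def dest!: compact_imp_bounded intro: bounded_subset[OF _ closure_subset])
  then obtain a where a: "\<And>z. f z \<noteq> 0 \<Longrightarrow> norm z \<le> a" by (auto simp: bounded_iff)
  have "supported (max 0 a) (max 0 a) f"
  proof (unfold supported_def, intro allI impI, rule ccontr)
    fix z :: "'a \<times> 'a" assume z: "z \<notin> slab (max 0 a) (max 0 a)" "f z \<noteq> 0"
    have "norm z \<le> max 0 a" using a[OF z(2)] by simp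
    then have "z \<in> slab (max 0 a) (max 0 a)"
      using slab_cover[of z] slab_mono[of "norm z" "max 0 a" "norm z" "max 0 a"] by blast
    with z(1) show False by simp
  qed
  then show ?thesis using that[of "max 0 a"] by simp
qed

lemma Ck_imp_continuous: "Ck k f \<Longrightarrow> continuous_on UNIV f"
  by (cases k) (auto intro!: continuous_at_imp_continuous_on differentiable_imp_continuous_within)

lemma Cc_infinity_flow_derivative:
  fixes f :: "'a::euclidean_space \<times> 'a \<Rightarrow> real"
  assumes f: "f \<in> Cc_infinity"
  shows "flow_derivative f (\<lambda>z. frechet_derivative f (at z) (snd z, 0))"
proof -
  have Ck: "Ck k f" for k using f by (simp add: Cc_infinity_def)
  let ?D = "\<lambda>z. frechet_derivative f (at z)"
  have diff: "(f has_derivative ?D z) (at z)" for z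
    using Ck[of 1] by (simp add: frechet_derivative_works)
  have fc: "continuous_on UNIV f" by (rule Ck_imp_continuous[OF Ck[of 0]])
  have Dc: "continuous_on UNIV (\<lambda>z. ?D z v)" for v
    using Ck[of 1] by simp
  have lin: "linear (?D z)" for z by (rule has_derivative_linear[OF diff])
  have D_eq: "?D z (v, 0) = (\<Sum>b\<in>Basis. (v \<bullet> b) * ?D z (b, 0))" for z v
  proof -
    have "(v, 0) = (\<Sum>b\<in>Basis. (v \<bullet> b) *\<^sub>R (b, 0 :: 'a))"
      by (simp add: prod_eq_iff fst_sum snd_sum euclidean_representation)
    then have "?D z (v, 0) = ?D z (\<Sum>b\<in>Basis. (v \<bullet> b) *\<^sub>R (b, 0 :: 'a))" by simp
    also have "\<dots> = (\<Sum>b\<in>Basis. (v \<bullet> b) * ?D z (b, 0))"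
      by (simp only: linear_sum[OF lin] linear_scale[OF lin] real_scaleR_def)
    finally show ?thesis .
  qed
  obtain a where a: "0 \<le> a" "supported a a f" by (rule Cc_infinity_supported[OF f])
  define m where "m t s z = ?D (free_flow s z) (snd z, 0)" for t s :: real and z :: "'a \<times> 'a"
  have mc: "continuous_on UNIV (\<lambda>(x, z). m (fst x) (snd x) z)"
  proof -
    have "m t s z = (\<Sum>b\<in>Basis. (snd z \<bullet> b) * ?D (free_flow s z) (b, 0))" for t s z
      unfolding m_def by (rule D_eq)
    then show ?thesis
      unfolding split_beta
      by (simp only:) (intro continuous_intros continuous_on_compose2[OF Dc], auto)
  qed
  have eq: "f (free_flow t z) - f z = integral {0..t} (\<lambda>s. m t s z)" if t: "0 \<le> t" for t z
  proof -
    have "((\<lambda>s. m t s z) has_integral f (free_flow t z) - f (free_flow 0 z)) {0..t}"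
    proof (rule fundamental_theorem_of_calculus[OF t])
      fix s assume "s \<in> {0..t}"
      have 1: "((\<lambda>s. free_flow s z) has_derivative (\<lambda>h. (h *\<^sub>R snd z, 0))) (at s within {0..t})"
        unfolding free_flow_def split_beta by (auto intro!: derivative_eq_intros)
      have "((\<lambda>s. f (free_flow s z)) has_derivative (\<lambda>h. ?D (free_flow s z) (h *\<^sub>R snd z, 0))) (at s within {0..t})"
        by (rule has_derivative_compose[OF 1 diff])
      moreover have "?D (free_flow s z) (h *\<^sub>R snd z, 0) = h *\<^sub>R m t s z" for h
        using linear_scale[OF lin, of "free_flow s z" h "(snd z, 0)"] by (simp add: m_def)
      ultimately show "((\<lambda>s. f (free_flow s z)) has_vector_derivative m t s z) (at s within {0..t})"
        by (simp add: has_vector_derivative_def)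
    qed
    then show ?thesis by (simp add: integral_unique)
  qed
  have "uniform_limit UNIV (\<lambda>t z. integral {0..t} (\<lambda>s. m t s z) / t) (m 0 0) (at_right 0)"
  proof (rule uniform_limit_average[OF mc compact_slab])
    fix t s :: real and z :: "'a \<times> 'a"
    assume z: "z \<notin> slab a (a + 2 * a)" and t: "0 \<le> s" "s \<le> t" "t \<le> 1"
    have "(\<lambda>_. 0) = ?D (free_flow s z)"
    proof (rule has_derivative_unique[OF _ diff])
      have fl: "free_flow s z \<notin> slab a a"
        using free_flow_slab_reverse[of s z a a "a + 2 * a"] z t a mult_right_mono[of s 2 a] by auto
      show "(f has_derivative (\<lambda>_. 0)) (at (free_flow s z))"
        by (rule has_derivative_transform_within_open[of "\<lambda>_. 0" _ _ _ "- slab a a"])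
           (use fl a compact_imp_closed[OF compact_slab] in \<open>auto simp: supported_def\<close>)
    qed
    then show "m t s z = 0" by (metis m_def)
  qed
  moreover have "\<forall>\<^sub>F t in at_right 0. \<forall>z\<in>UNIV. integral {0..t} (\<lambda>s. m t s z) / t = (f (free_flow t z) - f z) / t"
    using eventually_at_right_less[of "0::real"] by eventually_elim (simp add: eq)
  ultimately show ?thesis
    using uniform_limit_cong[of UNIV "\<lambda>t z. integral {0..t} (\<lambda>s. m t s z) / t"
        "\<lambda>t z. (f (free_flow t z) - f z) / t" "at_right 0" "m 0 0"]
    unfolding flow_derivative_def by (force simp: m_def)
qed

text \<open>
  Translations of the position commute with the free flow; hence mollifying in \<open>q\<close> mollifies the derivative
  along the flow.  The result \<open>F1\<close> has derivatives \<open>H z v\<close> in all directions \<open>v\<close> of the position, jointly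
  continuous in \<open>z\<close> and \<open>v\<close>, and \<open>H z (snd z)\<close> is its derivative along the flow.
\<close>

lemma mollify_position:
  fixes F G :: "'a::euclidean_space \<times> 'a \<Rightarrow> real"
  assumes F: "continuous_on UNIV F" "supported a b F" and ab: "0 \<le> a" "0 \<le> b"
    and G: "flow_derivative F G" and e: "0 < e"
  obtains F1 H where "continuous_on UNIV F1" "supported a (b + 1) F1" "\<And>z. \<bar>F1 z - F z\<bar> \<le> e"
    "continuous_on UNIV (\<lambda>(z, v). H z v)" "\<And>z. \<bar>H z (snd z) - G z\<bar> \<le> e"
    "\<And>z v r. ((\<lambda>r. F1 (z + r *\<^sub>R (v, 0))) has_real_derivative H (z + r *\<^sub>R (v, 0)) v) (at r)"
    "\<And>z v. z \<notin> slab a (b + 1) \<Longrightarrow> H z v = 0"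
proof -
  have Gc: "continuous_on UNIV G" by (rule flow_derivative_continuous[OF F(1) G])
  have Gs: "supported a (b + a) G" by (rule flow_derivative_supported[OF F(2) ab(1) G])
  have tr: "continuous_on UNIV (\<lambda>(x, z). f (fst z + x, snd z))" if "continuous_on UNIV f" for f :: "'a \<times> 'a \<Rightarrow> real"
    unfolding split_beta by (intro continuous_on_compose2[OF that] continuous_intros) auto
  obtain d1 where d1: "0 < d1" "\<And>x z. norm x < d1 \<Longrightarrow> z \<in> slab a (b + 1) \<Longrightarrow> \<bar>F (fst z + x, snd z) - F (fst z + 0, snd z)\<bar> \<le> e"
    by (rule uniformly_close_on_compact[OF tr[OF F(1)] compact_slab[of a "b + 1"] e]) blast
  obtain d2 where d2: "0 < d2" "\<And>x z. norm x < d2 \<Longrightarrow> z \<in> slab a (b + a + 1) \<Longrightarrow> \<bar>G (fst z + x, snd z) - G (fst z + 0, snd z)\<bar> \<le> e"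
    by (rule uniformly_close_on_compact[OF tr[OF Gc] compact_slab[of a "b + a + 1"] e]) blast
  define d where "d = min 1 (min d1 d2)"
  have d: "0 < d" "d \<le> 1" "d \<le> d1" "d \<le> d2" using d1 d2 by (auto simp: d_def)
  have close: "\<bar>f (fst z + x, snd z) - f z\<bar> \<le> e"
    if f: "supported a c f" and dd: "\<And>x z. norm x < d \<Longrightarrow> z \<in> slab a (c + 1) \<Longrightarrow> \<bar>f (fst z + x, snd z) - f (fst z + 0, snd z)\<bar> \<le> e"
      and x: "norm x < d" for f c x z
  proof (cases "z \<in> slab a (c + 1)")
    case True
    from dd[OF x this] show ?thesis by simp
  next
    case False
    have "norm (fst z) \<le> norm (fst z + x) + norm x" using norm_triangle_ineq4[of "fst z + x" x] by simp
    then have "(fst z + x, snd z) \<notin> slab a c" "z \<notin> slab a c" using False x d by (auto simp: slab_def)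
    then show ?thesis using f e by (simp add: supported_def)
  qed
  have closeF: "\<bar>F (fst z + x, snd z) - F z\<bar> \<le> e" if "norm x < d" for x z
    by (rule close[OF F(2) _ that]) (use d1 d in auto)
  have closeG: "\<bar>G (fst z + x, snd z) - G z\<bar> \<le> e" if "norm x < d" for x z
    by (rule close[OF Gs _ that]) (use d2 d in auto)
  obtain \<kappa> :: "'a \<Rightarrow> real" where \<kappa>: "mollifier d \<kappa>"
    using mollifier_exists[OF d(1)] by blast
  note \<kappa>S = mollifierD(1)[OF \<kappa>] and \<kappa>0 = mollifierD(3)[OF \<kappa>]
  have \<kappa>c: "continuous_on UNIV \<kappa>" by (rule mollifierD(5)[OF \<kappa>])
  obtain E where E: "\<And>x. (\<kappa> has_derivative E x) (at x)" "\<And>v. (\<lambda>x. E x v) \<in> smooth_class"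
    using smooth_class_derivative[OF \<kappa>S] by blast
  obtain u :: 'a where u: "cball 0 (b + 1) \<subseteq> cbox (- u) u"
    using bounded_subset_cbox_symmetric[OF bounded_cball] by blast
  define F1 where "F1 z = mollify \<kappa> (\<lambda>q. F (q, snd z)) (fst z)" for z
  define H where "H z v = integral (cbox (- u) u) (\<lambda>w. F (w, snd z) * ((- 1) * E (w - fst z) v))" for z v
  have Fq: "continuous_on UNIV (\<lambda>q. f (q, p))" if "continuous_on UNIV f" for p and f :: "'a \<times> 'a \<Rightarrow> real"
    by (intro continuous_on_compose2[OF that] continuous_intros) auto
  have F0: "F (w, p) = 0" if "w \<notin> cbox (- u) u" for w p
    using u that F(2) by (force simp: supported_def slab_def)
  have F1_eq: "F1 z = integral (cbox (- u) u) (\<lambda>w. F (w, snd z) * \<kappa> (w - fst z))" for z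
    unfolding F1_def by (rule mollify_translate[OF Fq[OF F(1)] F0 \<kappa>c])
  show ?thesis
  proof (rule that[of F1 H])
    show "continuous_on UNIV F1"
      unfolding F1_eq[abs_def]
      by (rule integral_continuous_on_param)
         (auto simp: split_beta intro!: continuous_intros continuous_on_compose2[OF F(1)] continuous_on_compose2[OF \<kappa>c])
    have mz: "mollify \<kappa> (\<lambda>q. f (q, snd z)) (fst z) = 0"
      if f: "\<And>w. norm w < d \<Longrightarrow> f (fst z + w, snd z) = 0" for f :: "'a \<times> 'a \<Rightarrow> real" and z
    proof -
      have "(\<lambda>w. f (fst z + w, snd z) * \<kappa> w) = (\<lambda>_. 0)"
        using f \<kappa>0 by (metis mult_eq_0_iff not_less)
      then show ?thesis by (simp add: mollify_def)
    qed
    show "supported a (b + 1) F1"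
      unfolding supported_def F1_def
    proof (intro allI impI mz)
      fix z :: "'a \<times> 'a" and w :: 'a assume "z \<notin> slab a (b + 1)" "norm w < d"
      moreover have "norm (fst z) \<le> norm (fst z + w) + norm w" using norm_triangle_ineq4[of "fst z + w" w] by simp
      ultimately have "(fst z + w, snd z) \<notin> slab a b" using d by (auto simp: slab_def)
      then show "F (fst z + w, snd z) = 0" using F(2) by (simp add: supported_def)
    qed
    show "\<bar>F1 z - F z\<bar> \<le> e" for z
      unfolding F1_def
      by (rule mollify_approx[OF \<kappa> Fq[OF F(1)]]) (rule closeF)
    have Ec: "continuous_on UNIV (\<lambda>x. E x v)" for v by (rule smooth_class_continuous[OF E(2)])
    have linE: "linear (E x)" for x by (rule has_derivative_linear[OF E(1)])
    have E_eq: "E x v = (\<Sum>b\<in>Basis. (v \<bullet> b) * E x b)" for x v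
    proof -
      have "E x v = E x (\<Sum>b\<in>Basis. (v \<bullet> b) *\<^sub>R b)" by (simp add: euclidean_representation)
      also have "\<dots> = (\<Sum>b\<in>Basis. (v \<bullet> b) * E x b)"
        by (simp add: linear_sum[OF linE] linear_scale[OF linE])
      finally show ?thesis .
    qed
    show "continuous_on UNIV (\<lambda>(z, v). H z v)"
    proof -
      have H_eq: "H z v = integral (cbox (- u) u) (\<lambda>w. F (w, snd z) * ((- 1) * (\<Sum>b\<in>Basis. (v \<bullet> b) * E (w - fst z) b)))" for z v
        unfolding H_def by (rule arg_cong[where f="integral (cbox (- u) u)"], rule ext, subst E_eq, rule refl)
      show ?thesis
        unfolding split_beta H_eq
        by (rule integral_continuous_on_param)
           (auto simp: split_beta intro!: continuous_intros continuous_on_compose2[OF F(1)] continuous_on_compose2[OF Ec])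
    qed
    show der: "((\<lambda>r. F1 (z + r *\<^sub>R (v, 0))) has_real_derivative H (z + r *\<^sub>R (v, 0)) v) (at r)" for z v r
    proof -
      have 1: "((\<lambda>r. fst z + r *\<^sub>R v) has_derivative (\<lambda>h. h *\<^sub>R v)) (at r)"
        by (auto intro!: derivative_eq_intros)
      from has_derivative_compose[OF 1 convolution_derivative[OF Fq[OF F(1), of "snd z"] \<kappa>S E, of "- u" u]]
      have "((\<lambda>r. F1 (z + r *\<^sub>R (v, 0))) has_derivative (\<lambda>h. H (z + r *\<^sub>R (v, 0)) (h *\<^sub>R v))) (at r)"
        by (simp add: F1_eq H_def)
      moreover have "H (z + r *\<^sub>R (v, 0)) (h *\<^sub>R v) = H (z + r *\<^sub>R (v, 0)) v * h" for h
        unfolding H_def linear_scale[OF linE]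
        by (simp add: mult.left_commute[of _ h] mult.commute)
      ultimately show ?thesis by (simp add: has_field_derivative_def)
    qed
    show "H z v = 0" if z: "z \<notin> slab a (b + 1)" for z v
    proof -
      have "\<forall>\<^sub>F r in nhds 0. F1 (z + r *\<^sub>R (v, 0)) = 0"
      proof -
        have "open ((\<lambda>r. z + r *\<^sub>R (v, 0)) -` (- slab a (b + 1)))"
          by (intro open_vimage) (auto intro!: continuous_intros compact_imp_closed[OF compact_slab])
        then have "\<forall>\<^sub>F r in nhds 0. r \<in> (\<lambda>r. z + r *\<^sub>R (v, 0)) -` (- slab a (b + 1))"
          by (rule eventually_nhds_in_open) (use z in \<open>simp add: zero_prod_def[symmetric]\<close>)
        then show ?thesis
          by eventually_elim (use \<open>supported a (b + 1) F1\<close> in \<open>auto simp: supported_def\<close>)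
      qed
      then have "((\<lambda>r. F1 (z + r *\<^sub>R (v, 0))) has_real_derivative 0) (at 0)"
        by (subst DERIV_cong_ev[OF refl _ refl, of _ "\<lambda>_. 0"]) auto
      with der[of z v 0] have "H (z + 0 *\<^sub>R (v, 0)) v = 0" by (rule DERIV_unique)
      then show "H z v = 0" by (simp add: zero_prod_def[symmetric])
    qed
    \<comment> \<open>Two expressions for the derivative of \<open>F1\<close> along the flow: the uniform limit passes through the
      mollification, and \<open>F1\<close> is differentiable in the position.\<close>
    have H_mollify: "H z (snd z) = mollify \<kappa> (\<lambda>q. G (q, snd z)) (fst z)" for z
    proof -
      let ?M = "\<lambda>f. mollify \<kappa> (\<lambda>q. f (q, snd z)) (fst z)"
      have lim: "((\<lambda>t. (F1 (free_flow t z) - F1 z) / t) \<longlongrightarrow> ?M G) (at_right 0)"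
      proof (rule tendstoI)
        fix \<epsilon> :: real assume \<epsilon>: "0 < \<epsilon>"
        have "\<forall>\<^sub>F t in at_right 0. \<forall>z\<in>UNIV. dist ((F (free_flow t z) - F z) / t) (G z) < \<epsilon> / 2"
          using G \<epsilon> unfolding flow_derivative_def by (intro uniform_limitD) auto
        then show "\<forall>\<^sub>F t in at_right 0. dist ((F1 (free_flow t z) - F1 z) / t) (?M G) < \<epsilon>"
        proof eventually_elim
          case (elim t)
          let ?D = "\<lambda>y. (F (free_flow t y) - F y) / t - G y"
          have int: "(\<lambda>w. f w * \<kappa> w) integrable_on cbox (- One) One" if "continuous_on UNIV f" for f
            by (intro integrable_continuous continuous_intros continuous_on_subset[OF \<kappa>c] continuous_on_subset[OF that]) auto
          have k0: "\<kappa> w = 0" if "w \<notin> cbox (- One) One" for w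
          proof (rule \<kappa>0, rule ccontr)
            assume "\<not> d \<le> norm w"
            then have "norm w \<le> 1" using d by simp
            then have "\<bar>w \<bullet> i\<bar> \<le> 1" if "i \<in> Basis" for i using Basis_le_norm[OF that, of w] by simp
            then have "w \<in> cbox (- One) One" by (auto simp: mem_box abs_le_iff) 
            with that show False by simp
          qed
          have mc: "mollify \<kappa> f y = integral (cbox (- One) One) (\<lambda>w. f (y + w) * \<kappa> w)" for f y
            by (rule mollify_cbox) (rule k0)
          have c1: "continuous_on UNIV (\<lambda>w. F (fst z + t *\<^sub>R snd z + w, snd z))" "continuous_on UNIV (\<lambda>w. F (fst z + w, snd z))"
              "continuous_on UNIV (\<lambda>w. G (fst z + w, snd z))"
            by (auto intro!: continuous_on_compose2[OF F(1)] continuous_on_compose2[OF Gc] continuous_intros)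
          have "(F1 (free_flow t z) - F1 z) / t - ?M G = ?M ?D"
          proof -
            have "?M ?D = integral (cbox (- One) One) (\<lambda>w. (1 / t) * (F (fst z + t *\<^sub>R snd z + w, snd z) * \<kappa> w)
                - (1 / t) * (F (fst z + w, snd z) * \<kappa> w) - G (fst z + w, snd z) * \<kappa> w)"
              unfolding mc
              by (rule Henstock_Kurzweil_Integration.integral_cong)
                 (simp add: free_flow_def algebra_simps diff_divide_distrib)
            also have "\<dots> = (1 / t) * F1 (free_flow t z) - (1 / t) * F1 z - ?M G"
              unfolding F1_def mc fst_free_flow snd_free_flow
              by (intro integral_unique has_integral_diff has_integral_mult_right integrable_integral int c1)
            finally show ?thesis by (simp add: diff_divide_distrib)
          qed
          also have "\<bar>?M ?D\<bar> \<le> \<epsilon> / 2"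
          proof -
            have "\<bar>?M ?D - 0\<bar> \<le> \<epsilon> / 2"
            proof (rule mollify_approx[OF \<kappa>])
              have "continuous_on UNIV ?D"
                by (cases "t = 0") (auto intro!: continuous_intros continuous_on_compose2[OF F(1)] Gc)
              then show "continuous_on UNIV (\<lambda>q. ?D (q, snd z))" by (rule Fq)
            next
              fix w
              show "\<bar>?D (fst z + w, snd z) - 0\<bar> \<le> \<epsilon> / 2"
                using elim by (simp add: dist_real_def less_imp_le)
            qed
            then show ?thesis by simp
          qed
          finally show ?case using \<epsilon> by (simp add: dist_real_def)
        qed
      qed
      have "((\<lambda>t. (F1 (z + t *\<^sub>R (snd z, 0)) - F1 z) / t) \<longlongrightarrow> H z (snd z)) (at 0)"
        using der[of z "snd z" 0] by (simp add: DERIV_def zero_prod_def[symmetric])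
      then have "((\<lambda>t. (F1 (free_flow t z) - F1 z) / t) \<longlongrightarrow> H z (snd z)) (at_right 0)"
      proof -
        have "free_flow t z = z + t *\<^sub>R (snd z, 0)" for t
          by (simp add: free_flow_def prod_eq_iff split_beta)
        then show ?thesis
          using \<open>((\<lambda>t. (F1 (z + t *\<^sub>R (snd z, 0)) - F1 z) / t) \<longlongrightarrow> H z (snd z)) (at 0)\<close>
          by (simp add: filterlim_at_split)
      qed
      then show ?thesis by (rule tendsto_unique[OF trivial_limit_at_right_real _ lim])
    qed
    show "\<bar>H z (snd z) - G z\<bar> \<le> e" for z
      unfolding H_mollify
      by (rule mollify_approx[OF \<kappa> Fq[OF Gc]]) (rule closeG)
  qed
qed

text \<open>
  Once the gradient in \<open>q\<close> is continuous, mollification in all variables replaces \<open>H z (snd z)\<close> by averages of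
  \<open>H (z + w) (snd z)\<close> over small \<open>w\<close>, which are uniformly close.
\<close>

lemma smooth_approximation:
  fixes F G :: "'a::euclidean_space \<times> 'a \<Rightarrow> real"
  assumes F: "continuous_on UNIV F" "supported a b F" and ab: "0 \<le> a" "0 \<le> b"
    and G: "flow_derivative F G" and e: "0 < e"
  obtains f g where "f \<in> Cc_infinity" "supported (a + 1) (b + 2) f" "flow_derivative f g"
    "\<And>z. \<bar>f z - F z\<bar> \<le> e" "\<And>z. \<bar>g z - G z\<bar> \<le> e"
proof -
  have e2: "0 < e / 2" using e by simp
  obtain F1 H where F1: "continuous_on UNIV F1" "supported a (b + 1) F1" "\<And>z. \<bar>F1 z - F z\<bar> \<le> e / 2"
    and H: "continuous_on UNIV (\<lambda>(z, v). H z v)" "\<And>z. \<bar>H z (snd z) - G z\<bar> \<le> e / 2"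
    "\<And>z v r. ((\<lambda>r. F1 (z + r *\<^sub>R (v, 0))) has_real_derivative H (z + r *\<^sub>R (v, 0)) v) (at r)"
    "\<And>z v. z \<notin> slab a (b + 1) \<Longrightarrow> H z v = 0"
    by (rule mollify_position[OF F ab G e2]) blast
  have c1: "continuous_on UNIV (\<lambda>(x, z). F1 (z + x))"
    unfolding split_beta by (intro continuous_on_compose2[OF F1(1)] continuous_intros) auto
  have c2: "continuous_on UNIV (\<lambda>(x, z). H (z + x) (snd z))"
    unfolding split_beta by (intro continuous_on_case_prod_compose[OF H(1)] continuous_intros)
  obtain d1 where d1: "0 < d1" "\<And>x z. norm x < d1 \<Longrightarrow> z \<in> slab (a + 1) (b + 2) \<Longrightarrow> \<bar>F1 (z + x) - F1 (z + 0)\<bar> \<le> e / 2"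
    by (rule uniformly_close_on_compact[OF c1 compact_slab[of "a + 1" "b + 2"] e2]) blast
  obtain d2 where d2: "0 < d2" "\<And>x z. norm x < d2 \<Longrightarrow> z \<in> slab (a + 1) (b + 2) \<Longrightarrow> \<bar>H (z + x) (snd z) - H (z + 0) (snd z)\<bar> \<le> e / 2"
    by (rule uniformly_close_on_compact[OF c2 compact_slab[of "a + 1" "b + 2"] e2]) blast
  define d where "d = min 1 (min d1 d2)"
  have d: "0 < d" "d \<le> 1" "d \<le> d1" "d \<le> d2" using d1 d2 by (auto simp: d_def)
  have away: "z + w \<notin> slab a (b + 1)" if "z \<notin> slab (a + 1) (b + 2)" "norm w < d" for z w :: "'a \<times> 'a"
  proof -
    have w: "norm (fst w) \<le> 1" "norm (snd w) \<le> 1"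
      using that(2) d(2) norm_fst_le[of "fst w" "snd w"] norm_snd_le[of "snd w" "fst w"] by auto
    have "norm (fst z) \<le> norm (fst z + fst w) + norm (fst w)" "norm (snd z) \<le> norm (snd z + snd w) + norm (snd w)"
      using norm_triangle_ineq4[of "fst z + fst w" "fst w"] norm_triangle_ineq4[of "snd z + snd w" "snd w"] by auto
    with w that(1) show ?thesis by (auto simp: slab_def)
  qed
  have near: "z \<in> slab (a + 1) (b + 2)" if "z \<in> slab a (b + 1)" for z :: "'a \<times> 'a"
    using that slab_mono[of a "a + 1" "b + 1" "b + 2"] by auto
  have close1: "\<bar>F1 (z + x) - F1 z\<bar> \<le> e / 2" if "norm x < d" for x z
  proof (cases "z \<in> slab (a + 1) (b + 2)")
    case True
    then show ?thesis using d1(2)[of x z] that d by simp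
  next
    case False
    have "z \<notin> slab a (b + 1)" using near False by blast
    then have "F1 (z + x) = 0" "F1 z = 0"
      using F1(2) away[OF False that] by (simp_all add: supported_def)
    with e show ?thesis by simp
  qed
  have close2: "\<bar>H (z + x) (snd z) - H z (snd z)\<bar> \<le> e / 2" if "norm x < d" for x z
  proof (cases "z \<in> slab (a + 1) (b + 2)")
    case True
    then show ?thesis using d2(2)[of x z] that d by simp
  next
    case False
    have "z \<notin> slab a (b + 1)" using near False by blast
    then have "H (z + x) (snd z) = 0" "H z (snd z) = 0"
      using H(4) away[OF False that] by simp_all
    with e show ?thesis by simp
  qed
  obtain \<kappa> :: "'a \<times> 'a \<Rightarrow> real" where \<kappa>: "mollifier d \<kappa>"
    using mollifier_exists[OF d(1)] by blast
  note \<kappa>S = mollifierD(1)[OF \<kappa>] and \<kappa>0 = mollifierD(3)[OF \<kappa>]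
  have \<kappa>c: "continuous_on UNIV \<kappa>" by (rule mollifierD(5)[OF \<kappa>])
  obtain l u :: "'a \<times> 'a" where lu: "slab a (b + 1) \<subseteq> cbox l u" by (rule slab_subset_cbox)
  obtain l' u' :: "'a \<times> 'a" where lu': "cball 0 d \<subseteq> cbox l' u'"
    by (metis bounded_subset_cbox_symmetric[OF bounded_cball])
  define f where "f = mollify \<kappa> F1"
  have f_eq: "f z = integral (cbox l u) (\<lambda>w. F1 w * \<kappa> (w - z))" for z
    unfolding f_def by (rule mollify_translate[OF F1(1) _ \<kappa>c]) (use F1(2) lu in \<open>auto simp: supported_def\<close>)
  have k0: "\<kappa> w = 0" if "w \<notin> cbox l' u'" for w
    by (rule \<kappa>0) (use lu' that in \<open>force simp: subset_iff\<close>)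
  have f_eq': "f z = integral (cbox l' u') (\<lambda>w. F1 (z + w) * \<kappa> w)" for z
    unfolding f_def by (rule mollify_cbox[OF k0])
  have Ck: "Ck k f" for k
    unfolding f_eq[abs_def] by (rule Ck_convolution[OF F1(1) \<kappa>S])
  have fs: "supported (a + 1) (b + 2) f"
    unfolding supported_def
  proof (intro allI impI)
    fix z :: "'a \<times> 'a" assume z: "z \<notin> slab (a + 1) (b + 2)"
    have "(\<lambda>w. F1 (z + w) * \<kappa> w) = (\<lambda>_. 0)"
    proof
      fix w show "F1 (z + w) * \<kappa> w = 0"
        using \<kappa>0[of w] away[OF z, of w] F1(2) by (cases "norm w < d") (auto simp: supported_def)
    qed
    then show "f z = 0" by (simp add: f_def mollify_def)
  qed
  have "bounded {z. f z \<noteq> 0}"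
    by (rule bounded_subset[OF compact_imp_bounded[OF compact_slab]]) (use fs in \<open>auto simp: supported_def\<close>)
  then have fC: "f \<in> Cc_infinity" using Ck by (simp add: Cc_infinity_def)
  \<comment> \<open>The direction \<open>(snd z, 0)\<close> is fixed while the variable of integration moves, so only the derivatives of
    \<open>F1\<close> in the position enter.\<close>
  have "frechet_derivative f (at z) (snd z, 0) = mollify \<kappa> (\<lambda>y. H y (snd z)) z" for z
  proof -
    let ?v = "(snd z, 0) :: 'a \<times> 'a"
    have "(f has_derivative frechet_derivative f (at z)) (at z)"
      using Ck[of 1] by (simp add: frechet_derivative_works)
    then have 1: "(f has_derivative frechet_derivative f (at z)) (at (z + 0 *\<^sub>R ?v))"
      by (simp add: zero_prod_def[symmetric])
    have 2: "((\<lambda>r. z + r *\<^sub>R ?v) has_derivative (\<lambda>h. h *\<^sub>R ?v)) (at 0)"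
      by (auto intro!: derivative_eq_intros)
    have "((\<lambda>r. f (z + r *\<^sub>R ?v)) has_derivative (\<lambda>h. frechet_derivative f (at z) (h *\<^sub>R ?v))) (at 0)"
      by (rule has_derivative_compose[OF 2 1])
    moreover have "frechet_derivative f (at z) (h *\<^sub>R ?v) = frechet_derivative f (at z) ?v * h" for h
      using linear_scale[OF has_derivative_linear[OF 1], of h ?v] by simp
    ultimately have 3: "((\<lambda>r. f (z + r *\<^sub>R ?v)) has_real_derivative frechet_derivative f (at z) ?v) (at 0)"
      by (simp add: has_field_derivative_def)
    have "((\<lambda>r. integral (cbox l' u') (\<lambda>w. F1 (z + r *\<^sub>R ?v + w) * \<kappa> w)) has_field_derivative
        integral (cbox l' u') (\<lambda>w. H (z + 0 *\<^sub>R ?v + w) (snd z) * \<kappa> w)) (at 0 within UNIV)"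
    proof (rule leibniz_rule_field_derivative)
      fix r :: real and w :: "'a \<times> 'a"
      have "((\<lambda>r. F1 ((z + w) + r *\<^sub>R ?v) * \<kappa> w) has_real_derivative H ((z + w) + r *\<^sub>R ?v) (snd z) * \<kappa> w) (at r)"
        by (rule DERIV_cmult_right[OF H(3)])
      then show "((\<lambda>r. F1 (z + r *\<^sub>R ?v + w) * \<kappa> w) has_field_derivative H (z + r *\<^sub>R ?v + w) (snd z) * \<kappa> w) (at r within UNIV)"
        by (simp add: add_ac)
    next
      fix r :: real
      show "(\<lambda>w. F1 (z + r *\<^sub>R ?v + w) * \<kappa> w) integrable_on cbox l' u'"
        by (intro integrable_continuous continuous_intros continuous_on_compose2[OF F1(1)]
            continuous_on_subset[OF \<kappa>c]) auto
    next
      show "continuous_on (UNIV \<times> cbox l' u') (\<lambda>(r, w). H (z + r *\<^sub>R ?v + w) (snd z) * \<kappa> w)"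
        unfolding split_beta
        by (intro continuous_on_mult continuous_on_case_prod_compose[OF H(1)] continuous_on_compose2[OF \<kappa>c] continuous_intros) auto
    qed auto
    then have "((\<lambda>r. f (z + r *\<^sub>R ?v)) has_real_derivative mollify \<kappa> (\<lambda>y. H y (snd z)) z) (at 0)"
      by (simp add: f_eq' mollify_cbox[OF k0] zero_prod_def[symmetric])
    with 3 show ?thesis by (rule DERIV_unique)
  qed
  then have fg: "flow_derivative f (\<lambda>z. mollify \<kappa> (\<lambda>y. H y (snd z)) z)"
    using Cc_infinity_flow_derivative[OF fC] by simp
  show ?thesis
  proof (rule that[OF fC fs fg])
    fix z
    have "\<bar>f z - F1 z\<bar> \<le> e / 2"
      unfolding f_def by (rule mollify_approx[OF \<kappa> F1(1)]) (rule close1)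
    with F1(3)[of z] show "\<bar>f z - F z\<bar> \<le> e" by linarith
    have "continuous_on UNIV (\<lambda>y. H y (snd z))"
      by (intro continuous_on_case_prod_compose[OF H(1)] continuous_intros)
    then have "\<bar>mollify \<kappa> (\<lambda>y. H y (snd z)) z - H z (snd z)\<bar> \<le> e / 2"
      by (rule mollify_approx[OF \<kappa>]) (rule close2)
    with H(2)[of z] show "\<bar>mollify \<kappa> (\<lambda>y. H y (snd z)) z - G z\<bar> \<le> e" by linarith
  qed
qed

section \<open>The core\<close>

context isometric_refreshment
begin

lemma Cc_infinity_generator_dom: "Cc_infinity \<subseteq> generator_dom P"
proof
  fix f :: "(real^'d) \<times> (real^'d) \<Rightarrow> real" assume f: "f \<in> Cc_infinity"
  obtain a where a: "0 \<le> a" "supported a a f" by (rule Cc_infinity_supported[OF f])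
  have "continuous_on UNIV f"
    using f by (auto simp: Cc_infinity_def intro: Ck_imp_continuous)
  from has_generator_supported[OF this a(2,1) Cc_infinity_flow_derivative[OF f]]
  show "f \<in> generator_dom P" by (auto simp: generator_dom_def)
qed

lemma jump_rate_close:
  fixes f g :: "(real^'d) \<times> (real^'d) \<Rightarrow> real"
  assumes "continuous_on UNIV f" "continuous_on UNIV g" "\<And>z. \<bar>f z - g z\<bar> \<le> e"
  shows "\<bar>jump_rate f z - jump_rate g z\<bar> \<le> lam z * e"
proof -
  have "\<bar>Q f z - Q g z\<bar> \<le> e"
    unfolding Q_diff[OF assms(1,2)] by (rule abs_expectation_le) (rule assms(3))
  then show ?thesis
    by (simp add: jump_rate_def right_diff_distrib[symmetric] abs_mult rate_nonneg mult_left_mono)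
qed

text \<open>
  The jump part of the generator is Lipschitz in the supremum norm on functions supported in a common
  \<^const>\<open>slab\<close>, with constant twice a bound of the intensity.
\<close>

lemma generator_smooth_approximation:
  assumes F: "continuous_on UNIV F" "supported a b F" and ab: "0 \<le> a" "0 \<le> b"
    and G: "flow_derivative F G" and e: "0 < e"
  obtains f h where "f \<in> Cc_infinity" "has_generator P f h"
    "\<And>z. \<bar>f z - F z\<bar> \<le> e" "\<And>z. \<bar>h z - (G z + jump_rate F z - lam z * F z)\<bar> \<le> e"
proof -
  obtain B where B: "0 \<le> B" "\<And>z. z \<in> slab (a + 1) (b + 2) \<Longrightarrow> lam z \<le> B"
    by (rule lam_bounded_on_slab) blast
  \<comment> \<open>shares the error among the flow derivative and the two terms of the jump part\<close>
  define d where "d = e / (1 + 2 * B)"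
  have d: "0 < d" using e B(1) by (simp add: d_def)
  have "d * (1 + 2 * B) = e" using B(1) by (simp add: d_def)
  then have d2: "d + 2 * (B * d) = e" by (simp add: algebra_simps)
  have d3: "d \<le> e" using d2 mult_nonneg_nonneg[OF B(1) less_imp_le[OF d]] by linarith
  obtain f g where f: "f \<in> Cc_infinity" "supported (a + 1) (b + 2) f" "flow_derivative f g"
    "\<And>z. \<bar>f z - F z\<bar> \<le> d" "\<And>z. \<bar>g z - G z\<bar> \<le> d"
    by (rule smooth_approximation[OF F ab G d]) blast
  have fc: "continuous_on UNIV f"
    using f(1) by (auto simp: Cc_infinity_def intro: Ck_imp_continuous)
  have Fs: "supported (a + 1) (b + 2) F" by (rule supported_mono[OF F(2)]) auto
  show ?thesis
  proof (rule that[OF f(1) has_generator_supported[OF fc f(2) _ f(3)]])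
    show "0 \<le> a + 1" using ab by simp
    fix z
    show "\<bar>f z - F z\<bar> \<le> e" using f(4)[of z] d3 by linarith
    have 1: "\<bar>lam z * f z - lam z * F z\<bar> \<le> B * d \<and> \<bar>jump_rate f z - jump_rate F z\<bar> \<le> B * d"
    proof (cases "z \<in> slab (a + 1) (b + 2)")
      case True
      have "\<bar>lam z * f z - lam z * F z\<bar> \<le> lam z * d"
        using f(4)[of z] by (simp add: right_diff_distrib[symmetric] abs_mult rate_nonneg mult_left_mono)
      moreover have "lam z * d \<le> B * d" using B(2)[OF True] d by (simp add: mult_right_mono)
      ultimately show ?thesis using jump_rate_close[OF fc F(1) f(4), of z] by linarith
    next
      case False
      then have "f z = 0" "F z = 0" "jump_rate f z = 0" "jump_rate F z = 0"
        using f(2) Fs supported_jump_rate[OF f(2)] supported_jump_rate[OF Fs] by (simp_all add: supported_def)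
      then show ?thesis using B(1) d by simp
    qed
    show "\<bar>g z + jump_rate f z - lam z * f z - (G z + jump_rate F z - lam z * F z)\<bar> \<le> e"
      using 1 f(5)[of z] d2 by linarith
  qed
qed

text \<open>
  Time averages over a short interval, of a function of compact support close to \<open>f\<close>, followed by smoothing.
\<close>

lemma Cc_infinity_approximation:
  assumes f: "has_generator P f h" and e: "0 < e"
  obtains g k where "g \<in> Cc_infinity" "has_generator P g k" "\<And>z. \<bar>g z - f z\<bar> \<le> e" "\<And>z. \<bar>k z - h z\<bar> \<le> e"
proof -
  have f0: "f \<in> C_zero" and lim: "uniform_limit UNIV (\<lambda>t z. (evolve f t z - f z) / t) h (at_right 0)"
    using f uniform_limit_P_cong[where F="\<lambda>t x z. (x - f z) / t"] by (auto simp: has_generator_def)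
  have "\<forall>\<^sub>F t in at_right 0. (\<forall>z\<in>UNIV. dist ((evolve f t z - f z) / t) (h z) < e / 4) \<and>
      (\<forall>z\<in>UNIV. dist (evolve f t z) (f z) < e / 4)"
    using lim evolve_uniform_limit[OF f0] e by (intro eventually_conj uniform_limitD) auto
  then obtain b0 where b0: "0 < b0" "\<And>t z. 0 < t \<Longrightarrow> t < b0 \<Longrightarrow> \<bar>(evolve f t z - f z) / t - h z\<bar> < e / 4"
      "\<And>t z. 0 < t \<Longrightarrow> t < b0 \<Longrightarrow> \<bar>evolve f t z - f z\<bar> < e / 4"
    unfolding eventually_at_right_field dist_real_def by auto
  define t where "t = b0 / 2"
  have t: "0 < t" "t < b0" using b0 by (auto simp: t_def)
  \<comment> \<open>The second bound compensates for the division by \<open>t\<close> in the difference quotient.\<close>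
  define d where "d = min (e / 4) (e * t / 8)"
  have d: "0 < d" "d \<le> e / 4" "d \<le> e * t / 8" using e t by (auto simp: d_def)
  obtain g a b where g: "continuous_on UNIV g" "0 \<le> a" "0 \<le> b" "supported a b g" "\<And>z. \<bar>f z - g z\<bar> \<le> d"
    using C_zero_approx_supported[OF f0 d(1)] by blast
  note g0 = C_zeroI_supported[OF g(1,4)]
  let ?A = "evolve_average t g"
  let ?F = "\<lambda>z. 1 / t * ?A z"
  let ?G = "\<lambda>z. 1 / t * (evolve g t z - g z - jump_rate ?A z + lam z * ?A z)"
  have Fc: "continuous_on UNIV ?F" by (intro continuous_intros continuous_evolve_average g0)
  have Fs: "supported a (b + t * a) ?F"
    using supported_evolve_average[OF g(1,4,2), of t] t by (simp add: supported_def)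
  have FG: "flow_derivative ?F ?G"
    by (rule flow_derivative_scale[OF flow_derivative_evolve_average[OF g(1,4,2)]]) (use t in simp)
  have b': "0 \<le> b + t * a" "0 < e / 4" using g t e by auto
  obtain f' h' where f': "f' \<in> Cc_infinity" "has_generator P f' h'" "\<And>z. \<bar>f' z - ?F z\<bar> \<le> e / 4"
      "\<And>z. \<bar>h' z - (?G z + jump_rate ?F z - lam z * ?F z)\<bar> \<le> e / 4"
    by (rule generator_smooth_approximation[OF Fc Fs g(2) b'(1) FG b'(2)]) blast
  have gen: "?G z + jump_rate ?F z - lam z * ?F z = (evolve g t z - g z) / t" for z
    by (simp add: jump_rate_def diff_divide_distrib add_divide_distrib algebra_simps)
  show ?thesis
  proof (rule that[OF f'(1,2)])
    fix z
    have close: "\<bar>evolve g s z - f z\<bar> \<le> e / 2" if "s \<in> {0..t}" for s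
    proof -
      have "\<bar>evolve f s z - f z\<bar> \<le> e / 4"
        using b0(3)[of s z] that t e f0 by (cases "s = 0") auto
      with evolve_diff_bound[OF f0 g0 g(5), of s z] d(2) show ?thesis by linarith
    qed
    have int: "(\<lambda>s. evolve g s z) integrable_on {0..t}"
      by (intro integrable_continuous_real continuous_on_case_prod_compose[OF continuous_evolve[OF g0]] continuous_intros)
    have "norm (integral {0..t} (\<lambda>s. evolve g s z - f z)) \<le> integral {0..t} (\<lambda>_. e / 2)"
      using close int by (intro integral_norm_bound_integral) (auto intro: integrable_diff)
    moreover have "integral {0..t} (\<lambda>s. evolve g s z - f z) = ?A z - t * f z"
      using Henstock_Kurzweil_Integration.integral_diff[OF int integrable_const_ivl, of "f z"] t
      by (simp add: evolve_average_def)
    ultimately have "\<bar>?A z - t * f z\<bar> \<le> t * (e / 2)" using t by simp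
    then have "\<bar>?F z - f z\<bar> \<le> e / 2" using t by (simp add: abs_le_iff field_simps)
    with f'(3)[of z] e show "\<bar>f' z - f z\<bar> \<le> e" by linarith
    have "\<bar>(evolve g t z - g z) - (evolve f t z - f z)\<bar> \<le> 2 * d"
      using evolve_diff_bound[OF f0 g0 g(5), of t z] g(5)[of z] by linarith
    also have "\<dots> \<le> t * (e / 4)" using d(3) by (simp add: field_simps)
    finally have "\<bar>(evolve g t z - g z) / t - (evolve f t z - f z) / t\<bar> \<le> e / 4"
      unfolding diff_divide_distrib[symmetric] using t by (simp add: pos_divide_le_eq mult.commute)
    with f'(4)[of z] b0(2)[OF t, of z] show "\<bar>h' z - h z\<bar> \<le> e"
      unfolding gen by linarith
  qed
qed

lemma uniform_limit_inverse_Suc: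
  fixes F :: "nat \<Rightarrow> 'b \<Rightarrow> real"
  assumes "\<And>n z. \<bar>F n z - f z\<bar> \<le> inverse (real (Suc n))"
  shows "uniform_limit UNIV F f sequentially"
proof (rule uniform_limitI)
  fix e :: real assume "0 < e"
  then have "\<forall>\<^sub>F n in sequentially. inverse (real (Suc n)) < e"
    using order_tendstoD(2)[OF LIMSEQ_inverse_real_of_nat] by blast
  then show "\<forall>\<^sub>F n in sequentially. \<forall>z\<in>UNIV. dist (F n z) (f z) < e"
    by eventually_elim (use assms in \<open>auto simp: dist_real_def intro: le_less_trans\<close>)
qed

theorem core_P: "core P Cc_infinity"
  unfolding core_def
proof (intro conjI ballI Cc_infinity_generator_dom)
  fix f assume "f \<in> generator_dom P"
  then obtain h where h: "has_generator P f h" by (auto simp: generator_dom_def)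
  have "\<exists>g k. g \<in> Cc_infinity \<and> has_generator P g k \<and>
      (\<forall>z. \<bar>g z - f z\<bar> \<le> inverse (real (Suc n))) \<and> (\<forall>z. \<bar>k z - h z\<bar> \<le> inverse (real (Suc n)))" for n
  proof (rule Cc_infinity_approximation[OF h])
    show "0 < inverse (real (Suc n))" by simp
  qed blast
  then obtain F K where F: "\<And>n. F n \<in> Cc_infinity" "\<And>n. has_generator P (F n) (K n)"
      "\<And>n z. \<bar>F n z - f z\<bar> \<le> inverse (real (Suc n))" "\<And>n z. \<bar>K n z - h z\<bar> \<le> inverse (real (Suc n))"
    by metis
  have "(\<lambda>n. generator P (F n)) = K" using generator_eqI[OF F(2)] by auto
  then show "\<exists>F. (\<forall>n. F n \<in> Cc_infinity) \<and> uniform_limit UNIV F f sequentially \<and>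
      uniform_limit UNIV (\<lambda>n. generator P (F n)) (generator P f) sequentially"
    using F(1,3,4) generator_eqI[OF h] by (intro exI[of _ F]) (auto intro!: uniform_limit_inverse_Suc)
qed

end

theorem corollary6p2:
  fixes Xi :: "'s measure"
    and lam :: "(real^'d) \<times> (real^'d) \<Rightarrow> real"
    and Orth :: "'s \<Rightarrow> real^'d \<Rightarrow> real^'d^'d"
  assumes "isometric_refreshment Xi lam Orth"
  shows "feller (refreshment_semigroup Xi lam Orth) \<and>
         core (refreshment_semigroup Xi lam Orth) Cc_infinity"
proof -
  interpret isometric_refreshment Xi lam Orth by fact
  show ?thesis using feller_P core_P ..
qed

end
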